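(* Let $\Delta$ be a finite simplicial complex with $\operatorname{depth}\Delta = d-1$, and let $r$ be a positive integer with $r<d/2$. Suppose $\Delta$ is shifted with respect to a vertex $a$. Then $\Delta$ is strictly $r$-EKR; that is: (i) for every intersecting family $\mathcal{A}$ of $r$-element faces of $\Delta$ there is a vertex $v$ of $\Delta$ with $|\mathcal{A}|\le f_{r-1}(\operatorname{link}_\Delta v)$, and (ii) every intersecting family of $r$-element faces of $\Delta$ of maximum possible cardinality has a common intersection (i.e. some vertex lies in all of its members).
   Context: A simplicial complex $\Delta$ is a nonempty finite family of sets closed under taking subsets; its members are faces, and the dimension of a face $A$ is $|A|-1$. For a nonnegative integer $k$, $f_k(\Delta)$ denotes the number of $k$-element faces of $\Delta$. The link of a face $A$ is $\operatorname{link}_\Delta A=\{B\in\Delta: A\cap B=\emptyset,\ A\cup B\in\Delta\}$. Fix a field $\mathbb{F}$ (depth is taken over $\mathbb{F}$). $\Delta$ is Cohen-Macaulay if $\tilde H_i(\operatorname{link}_\Delta A;\mathbb{F})=0$ for every face $A\in\Delta$ (including $A=\emptyset$) and every $i<\dim\operatorname{link}_\Delta A$, where $\tilde H_i$ is reduced simplicial homology. The $k$-dimensional skeleton of $\Delta$ is the subcomplex of faces of dimension at most $k$. The depth of $\Delta$ is the largest $k$ such that the $k$-dimensional skeleton of $\Delta$ is Cohen-Macaulay. $\Delta$ is shifted with respect to a vertex $a$ (a near-cone with apex $a$) if whenever $B\in\Delta$ and $w\in B$, also $(B\setminus\{w\})\cup\{a\}\in\Delta$. A family is intersecting if any two of its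 members have nonempty intersection. *)

theory Defs
  imports Main
begin

definition simplicial_complex :: "'a set set \<Rightarrow> bool" where
  "simplicial_complex \<Delta> \<longleftrightarrow> finite \<Delta> \<and> \<Delta> \<noteq> {} \<and> (\<forall>A\<in>\<Delta>. \<forall>B. B \<subseteq> A \<longrightarrow> B \<in> \<Delta>)"

definition fvec :: "nat \<Rightarrow> 'a set set \<Rightarrow> nat" where
  "fvec k \<Delta> = card {A\<in>\<Delta>. card A = k}"

definition link :: "'a set set \<Rightarrow> 'a set \<Rightarrow> 'a set set" where
  "link \<Delta> A = {B\<in>\<Delta>. A \<inter> B = {} \<and> A \<union> B \<in> \<Delta>}"

text \<open>Largest face cardinality (= dimension + 1).\<close>
definition maxcard :: "'a set set \<Rightarrow> nat" where
  "maxcard \<Delta> = Max (card ` \<Delta>)"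

definition osign :: "'a::linorder \<Rightarrow> 'a set \<Rightarrow> 'k::field" where
  "osign v A = (-1) ^ card {u\<in>A. u < v}"

definition bdry :: "'a::linorder set set \<Rightarrow> ('a set \<Rightarrow> 'k::field) \<Rightarrow> 'a set \<Rightarrow> 'k" where
  "bdry \<Delta> c B = (\<Sum>v\<in>{v. v \<notin> B \<and> insert v B \<in> \<Delta>}. osign v (insert v B) * c (insert v B))"

text \<open>Reduced homology in dimension k-1 (chains on k-element faces, the empty face
  giving the augmentation) vanishes, with coefficients in the field 'k.\<close>
definition rhom_vanish :: "'k::field itself \<Rightarrow> 'a::linorder set set \<Rightarrow> nat \<Rightarrow> bool" where
  "rhom_vanish F \<Delta> k \<longleftrightarrow>
     (\<forall>c :: 'a set \<Rightarrow> 'k.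
        (k = 0 \<or> (\<forall>B\<in>\<Delta>. card B = k - 1 \<longrightarrow> bdry \<Delta> c B = 0)) \<longrightarrow>
        (\<exists>b :: 'a set \<Rightarrow> 'k. \<forall>A\<in>\<Delta>. card A = k \<longrightarrow> bdry \<Delta> b A = c A))"

text \<open>Cohen-Macaulay: for every face A and every i < dim(link A), reduced H_i(link A) = 0.
  With k = i+1 (k \<ge> 0 covers i \<ge> -1) the condition i < dim reads k < maxcard.\<close>
definition cohen_macaulay :: "'k::field itself \<Rightarrow> 'a::linorder set set \<Rightarrow> bool" where
  "cohen_macaulay F \<Delta> \<longleftrightarrow>
     (\<forall>A\<in>\<Delta>. \<forall>k. k < maxcard (link \<Delta> A) \<longrightarrow> rhom_vanish F (link \<Delta> A) k)"

text \<open>Skeleton consisting of the faces with at most m elements (dimension m-1 skeleton).\<close>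
definition skel :: "nat \<Rightarrow> 'a set set \<Rightarrow> 'a set set" where
  "skel m \<Delta> = {A\<in>\<Delta>. card A \<le> m}"

text \<open>Depth: largest k \<le> dim \<Delta> such that the k-skeleton is Cohen-Macaulay (k \<ge> -1).\<close>
definition depth :: "'k::field itself \<Rightarrow> 'a::linorder set set \<Rightarrow> int" where
  "depth F \<Delta> = int (GREATEST m. m \<le> maxcard \<Delta> \<and> cohen_macaulay F (skel m \<Delta>)) - 1"

definition shifted_wrt :: "'a set set \<Rightarrow> 'a \<Rightarrow> bool" where
  "shifted_wrt \<Delta> a \<longleftrightarrow> (\<forall>B\<in>\<Delta>. \<forall>w\<in>B. insert a (B - {w}) \<in> \<Delta>)"

definition intersecting :: "'a set set \<Rightarrow> bool" where
  "intersecting \<A> \<longleftrightarrow> (\<forall>A\<in>\<A>. \<forall>B\<in>\<A>. A \<inter> B \<noteq> {})"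

end

theory Submission
  imports Defs "HOL-Computational_Algebra.Polynomial" "HOL-Computational_Algebra.Fraction_Field"
    "HOL-Library.Nat_Bijection" "HOL-Library.Function_Algebras"
begin

text \<open>
  The argument is exterior algebraic shifting. Over an infinite field, the chains supported on a
  family of \<open>i\<close>-sets, read in generic coordinates, have as many leading index sets as the family
  has members. Intersecting families yield intersecting families of index sets, and the initial
  family of any family is shifted. On a shifted intersecting family, reflecting the longest balanced
  prefix of the members avoiding \<open>0\<close> is injective into the sets containing \<open>0\<close>.

  Depth enters through the claim that index sets of faces may be enlarged downwards: if the least
  element of \<open>S\<close> exceeds \<open>j\<close> and there is enough depth, then \<open>insert j S\<close> is again an initial set.
  By semicontinuity this can be checked on one special coordinate system, the moment curve
  \<open>v \<mapsto> \<alpha> v ^ t\<close>, where it becomes a statement about simultaneous cycles of several weighted boundary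
  operators. It is proved by treating the weights as polynomial in an auxiliary variable. In
  particular, the reflected sets stay within the initial family of the complex, and for a near-cone
  the number of initial sets containing \<open>0\<close> is the size of the star of the apex.

  For strictness, equality forces all initial sets of the extremal family to contain \<open>0\<close>. Averaging
  over vertices gives a vertex \<open>x\<close> whose link family is larger than the corresponding bound in the
  link; its initial family then has a member avoiding \<open>0\<close>, and this excludes any member of the family
  avoiding \<open>x\<close>.
\<close>

section \<open>Weighted boundary operators\<close>

text \<open>The obstacle is the enlargement claim: depth controls one boundary operator, whereas a
  leading set calls for a chain killed by several at once. The operators with weights
  \<open>c v * \<alpha> v ^ t\<close>, t < J, are therefore packed into one operator with weights
  \<open>c v * poly q (\<alpha> v)\<close>, q ranging over the polynomials of degree below J. The
  moment curve is chosen because on the hyperplane q(\<alpha> v) = 0 the polynomial factors, which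
  lowers J by one and creates exactly one new zero weight. A zero weight costs one unit of depth, so
  the balance i + J + zeros \<le> m survives. Consequently each q(\<alpha> v) with c v nonzero acts
  surjectively on homology, while a product of such factors annihilates it, so homology vanishes in
  large polynomial degree; multiplication by the top coefficient of q is injective and carries the
  vanishing down to every degree. The inequality r < d/2 enters as 2r + 1 \<le> d. Its last unit
  makes room for a test set with largest element 2r, and pays for the deletion of a vertex.\<close>

lemma osign_insert:
  assumes "finite B" "w \<notin> B"
  shows "(osign v (insert w B) :: 'k::field) = (if w < v then - osign v B else osign v B)"
proof -
  have "{u \<in> insert w B. u < v} = (if w < v then insert w {u\<in>B. u < v} else {u\<in>B. u < v})"
    by auto
  then show ?thesis
    using assms by (simp add: osign_def)
qed

lemma osign_insert_self [simp]: "osign v (insert v B) = osign v B"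
proof -
  have "{u \<in> insert v B. u < v} = {u\<in>B. u < v}" by auto
  then show ?thesis by (simp add: osign_def)
qed

lemma osign_sq [simp]: "osign v B * osign v B = (1 :: 'k::field)"
  by (simp add: osign_def flip: power_add mult_2)

lemma osign_sq2 [simp]: "osign v B * (osign v B * x) = (x :: 'k::field)"
  by (simp add: osign_def flip: power_add mult_2 mult.assoc)

lemma osign_nonzero [simp]: "osign v B \<noteq> (0 :: 'k::field)"
  by (simp add: osign_def)

locale ground =
  fixes V :: "'a::linorder set"
  assumes finV [simp]: "finite V"
begin

text \<open>Contraction by the linear form f on the exterior algebra over V; weight 1 gives the
  simplicial boundary. Chains are functions on all sets, hence the explicit value 0 outside
  V.\<close>

definition bd :: "('a \<Rightarrow> 'k::field) \<Rightarrow> ('a set \<Rightarrow> 'k) \<Rightarrow> 'a set \<Rightarrow> 'k" where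
  "bd f u B = (if B \<subseteq> V then (\<Sum>v\<in>V - B. osign v B * f v * u (insert v B)) else 0)"

text \<open>Exterior multiplication from the left by the basis vector of v.\<close>

definition vmul :: "'a \<Rightarrow> ('a set \<Rightarrow> 'k::field) \<Rightarrow> 'a set \<Rightarrow> 'k" where
  "vmul v u A = (if v \<in> A \<and> A \<subseteq> V then osign v A * u (A - {v}) else 0)"

definition supp :: "('a set \<Rightarrow> 'k::field) \<Rightarrow> 'a set set \<Rightarrow> bool" where
  "supp u X \<longleftrightarrow> (\<forall>A. u A \<noteq> 0 \<longrightarrow> A \<in> X)"

lemma finite_sub: "B \<subseteq> V \<Longrightarrow> finite B"
  using finV finite_subset by blast

lemma bd_add: "bd f (\<lambda>A. x A + y A) B = bd f x B + bd f y B"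
  by (simp add: bd_def distrib_left sum.distrib)

lemma bd_diff: "bd f (\<lambda>A. x A - y A) B = bd f x B - bd f y B"
  by (simp add: bd_def right_diff_distrib sum_subtractf)

lemma bd_scale: "bd f (\<lambda>A. c * x A) B = c * bd f x B"
  by (simp add: bd_def sum_distrib_left mult_ac)

lemma bd_uminus: "bd f (\<lambda>A. - x A) B = - bd f x B"
  using bd_scale[of f "-1" x B] by simp

lemma bd_zero [simp]: "bd f (\<lambda>A. 0) = (\<lambda>B. 0)"
  by (rule ext) (simp add: bd_def)

lemma bd_sum: "bd f (\<lambda>A. \<Sum>i\<in>I. x i A) B = (\<Sum>i\<in>I. bd f (x i) B)"
proof (cases "B \<subseteq> V")
  case True
  have "bd f (\<lambda>A. \<Sum>i\<in>I. x i A) B = (\<Sum>v\<in>V - B. \<Sum>i\<in>I. osign v B * f v * x i (insert v B))"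
    using True by (simp add: bd_def sum_distrib_left)
  also have "\<dots> = (\<Sum>i\<in>I. \<Sum>v\<in>V - B. osign v B * f v * x i (insert v B))"
    by (rule sum.swap)
  finally show ?thesis using True by (simp add: bd_def)
qed (simp add: bd_def)

lemma bd_fun_add: "bd (\<lambda>v. f v + g v) u B = bd f u B + bd g u B"
  by (simp add: bd_def distrib_left distrib_right sum.distrib)

lemma bd_fun_scale: "bd (\<lambda>v. c * f v) u B = c * bd f u B"
  by (simp add: bd_def sum_distrib_left mult_ac)

lemma bd_fun_sum: "bd (\<lambda>v. \<Sum>i\<in>I. g i v) u B = (\<Sum>i\<in>I. bd (g i) u B)"
proof (cases "B \<subseteq> V")
  case True
  have "bd (\<lambda>v. \<Sum>i\<in>I. g i v) u B = (\<Sum>v\<in>V - B. \<Sum>i\<in>I. osign v B * g i v * u (insert v B))"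
    using True by (simp add: bd_def sum_distrib_left sum_distrib_right)
  also have "\<dots> = (\<Sum>i\<in>I. \<Sum>v\<in>V - B. osign v B * g i v * u (insert v B))"
    by (rule sum.swap)
  finally show ?thesis using True by (simp add: bd_def)
qed (simp add: bd_def)

lemma bd_cong:
  assumes "\<And>v. v \<in> V \<Longrightarrow> f v = g v" "\<And>A. A \<subseteq> V \<Longrightarrow> u A = w A"
  shows "bd f u B = bd g w B"
  unfolding bd_def using assms by (auto intro!: sum.cong)

text \<open>Each pair of added vertices occurs in both orders with opposite signs. Grouping them
  leaves a 2 by 2 minor of f and g, from which anticommutation and vanishing squares are both
  immediate.\<close>

lemma bd_bd:
  assumes "B \<subseteq> V"
  shows "bd f (bd g u) B =
    (\<Sum>v\<in>V - B. \<Sum>w\<in>V - B. if v < w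
        then osign v B * osign w B * (f w * g v - f v * g w) * u (insert v (insert w B)) else 0)"
proof -
  define h where "h v w = osign v B * osign w (insert v B) * (f v * g w) * u (insert v (insert w B))" for v w
  have fB: "finite B" using assms finite_sub by blast
  have "bd f (bd g u) B = (\<Sum>v\<in>V - B. \<Sum>w\<in>V - insert v B. h v w)"
    using assms by (auto simp: bd_def h_def sum_distrib_left insert_commute mult_ac intro!: sum.cong)
  also have "\<dots> = (\<Sum>v\<in>V - B. \<Sum>w\<in>V - B. (if v < w then h v w else 0) + (if w < v then h v w else 0))"
  proof (rule sum.cong[OF refl])
    fix v assume v: "v \<in> V - B"
    have "(\<Sum>w\<in>V - insert v B. h v w)
      = (\<Sum>w\<in>V - insert v B. (if v < w then h v w else 0) + (if w < v then h v w else 0))"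
      by (rule sum.cong) auto
    also have "\<dots> = (\<Sum>w\<in>V - B. (if v < w then h v w else 0) + (if w < v then h v w else 0))"
      by (rule sum.mono_neutral_left) auto
    finally show "(\<Sum>w\<in>V - insert v B. h v w) = (\<Sum>w\<in>V - B. (if v < w then h v w else 0) + (if w < v then h v w else 0))" .
  qed
  also have "\<dots> = (\<Sum>v\<in>V - B. \<Sum>w\<in>V - B. if v < w then h v w else 0) + (\<Sum>v\<in>V - B. \<Sum>w\<in>V - B. if w < v then h v w else 0)"
    by (simp add: sum.distrib)
  also have "(\<Sum>v\<in>V - B. \<Sum>w\<in>V - B. if w < v then h v w else 0) = (\<Sum>v\<in>V - B. \<Sum>w\<in>V - B. if v < w then h w v else 0)"
    by (rule sum.swap)
  also have "(\<Sum>v\<in>V - B. \<Sum>w\<in>V - B. if v < w then h v w else 0) + \<dots>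
     = (\<Sum>v\<in>V - B. \<Sum>w\<in>V - B. if v < w then h v w + h w v else 0)"
    unfolding sum.distrib[symmetric] by (intro sum.cong refl) simp
  also have "\<dots> = (\<Sum>v\<in>V - B. \<Sum>w\<in>V - B. if v < w
        then osign v B * osign w B * (f w * g v - f v * g w) * u (insert v (insert w B)) else 0)"
    using fB by (intro sum.cong refl) (auto simp: h_def osign_insert algebra_simps insert_commute)
  finally show ?thesis .
qed

lemma bd_anticomm: "bd f (bd g u) B = - bd g (bd f u) B"
proof (cases "B \<subseteq> V")
  case True
  show ?thesis
    unfolding bd_bd[OF True] sum_negf[symmetric]
    by (intro sum.cong refl) (auto simp: algebra_simps)
qed (simp add: bd_def)

lemma bd_sq [simp]: "bd f (bd f u) = (\<lambda>B. 0)"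
proof
  fix B show "bd f (bd f u) B = 0"
  proof (cases "B \<subseteq> V")
    case True
    show ?thesis unfolding bd_bd[OF True] by (intro sum.neutral ballI) (simp add: mult.commute)
  qed (simp add: bd_def)
qed

text \<open>Contraction is an antiderivation. Where f v is nonzero this makes multiplication by v a
  contracting homotopy; where f v = 0 it moves multiplication by v through the boundary up to
  sign.\<close>

lemma bd_vmul:
  fixes u :: "'a set \<Rightarrow> 'k::field"
  assumes "v \<in> V" "B \<subseteq> V"
  shows "bd f (vmul v u) B + vmul v (bd f u) B = f v * u B"
proof (cases "v \<in> B")
  case False
  have "bd f (vmul v u) B = (\<Sum>x\<in>V - B. if x = v then f v * u B else 0)"
  proof -
    have "osign x B * f x * vmul v u (insert x B) = (if x = v then f v * u B else 0)" if "x \<in> V - B" for x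
      using assms False that by (cases "x = v") (auto simp: vmul_def mult_ac)
    then show ?thesis using assms by (simp add: bd_def)
  qed
  also have "\<dots> = f v * u B"
    using assms False by simp
  finally show ?thesis using False by (simp add: vmul_def)
next
  case True
  have fB: "finite B" using assms finite_sub by blast
  define C where "C = B - {v}"
  have C: "B = insert v C" "v \<notin> C" "finite C" "C \<subseteq> V" using True fB assms C_def by auto
  \<comment> \<open>Adding v back contributes \<open>f v * u B\<close>; the other terms cancel
    against the first summand.\<close>
  have VC: "V - C = insert v (V - B)" using C assms by auto
  have "vmul v (bd f u) B = osign v B * (\<Sum>x\<in>V - C. osign x C * f x * u (insert x C))"
    using True assms(2) C(4) unfolding vmul_def bd_def C_def[symmetric] by simp
  also have "\<dots> = f v * u B + (\<Sum>x\<in>V - B. osign v B * (osign x C * f x * u (insert x C)))"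
  proof -
    have "v \<notin> V - B" "osign v C = (osign v B :: 'k)" using C by auto
    then show ?thesis
      unfolding VC by (simp add: distrib_left sum_distrib_left mult.assoc C(1)[symmetric])
  qed
  finally have 1: "vmul v (bd f u) B = f v * u B + (\<Sum>x\<in>V - B. osign v B * (osign x C * f x * u (insert x C)))" .
  have "bd f (vmul v u) B = (\<Sum>x\<in>V - B. - (osign v B * (osign x C * f x * u (insert x C))))"
  proof -
    have "osign x B * f x * vmul v u (insert x B) = - (osign v B * (osign x C * f x * u (insert x C)))"
      if x: "x \<in> V - B" for x
    proof -
      have "x \<notin> C" "x \<noteq> v" using x C by auto
      then have e: "insert x B - {v} = insert x C" using C by auto
      have "(osign x B :: 'k) * osign v (insert x B) = - (osign v B * osign x C)"
        using x C \<open>x \<noteq> v\<close> by (auto simp: osign_insert)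
      then have "osign x B * osign v (insert x B) * (f x * u (insert x C))
          = - (osign v B * osign x C) * (f x * u (insert x C))"
        by (rule arg_cong)
      then have "osign x B * f x * (osign v (insert x B) * u (insert x C))
          = - (osign v B * (osign x C * f x * u (insert x C)))"
        by (simp only: mult_ac mult_minus_left mult_minus_right)
      moreover have "vmul v u (insert x B) = osign v (insert x B) * u (insert x C)"
        using x True assms e by (simp add: vmul_def)
      ultimately show ?thesis by (simp only:)
    qed
    then show ?thesis using assms by (simp add: bd_def)
  qed
  then show ?thesis using 1 by (simp add: sum_negf)
qed

end

section \<open>Chains as vectors, complexes and exactness\<close>

global_interpretation fvs: vector_space "\<lambda>(c::'k::field) (f::'b \<Rightarrow> 'k) x. c * f x"
  by unfold_locales (auto simp: algebra_simps fun_eq_iff)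

global_interpretation fvsp: vector_space_pair
  "\<lambda>(c::'k::field) (f::'b \<Rightarrow> 'k) x. c * f x" "\<lambda>(c::'k::field) (f::'c \<Rightarrow> 'k) x. c * f x"
  by unfold_locales

lemma sum_apply_fun: "(\<Sum>i\<in>I. f i) x = (\<Sum>i\<in>I. f i x :: 'k::comm_monoid_add)"
  by (induction I rule: infinite_finite_induct) auto

definition lvl :: "'a set set \<Rightarrow> nat \<Rightarrow> 'a set set" where
  "lvl X i = {A\<in>X. card A = i}"

definition delta :: "'b \<Rightarrow> 'b \<Rightarrow> 'k::field" where
  "delta v x = (if x = v then 1 else 0)"

context ground
begin

definition cpx :: "'a set set \<Rightarrow> bool" where
  "cpx X \<longleftrightarrow> X \<subseteq> Pow V \<and> (\<forall>A\<in>X. \<forall>B. B \<subseteq> A \<longrightarrow> B \<in> X)"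

definition exact :: "('a \<Rightarrow> 'k::field) \<Rightarrow> 'a set set \<Rightarrow> nat \<Rightarrow> bool" where
  "exact f X i \<longleftrightarrow> (\<forall>u. supp u (lvl X i) \<longrightarrow> bd f u = (\<lambda>B. 0) \<longrightarrow>
     (\<exists>b. supp b (lvl X (Suc i)) \<and> bd f b = u))"

text \<open>The range depends on m and \<open>card U\<close> but not on the dimension of the link.
  In this form it passes to links of vertices with m lowered by one, as the induction on zero
  weights requires.\<close>

definition links_exact :: "'k::field itself \<Rightarrow> 'a set set \<Rightarrow> nat \<Rightarrow> bool" where
  "links_exact F X m \<longleftrightarrow> (\<forall>U\<in>X. \<forall>i. i + card U < m \<longrightarrow> exact (\<lambda>_. 1 :: 'k) (link X U) i)"

lemma cpx_sub: "cpx X \<Longrightarrow> A \<in> X \<Longrightarrow> A \<subseteq> V"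
  by (auto simp: cpx_def)

lemma cpx_down: "cpx X \<Longrightarrow> A \<in> X \<Longrightarrow> B \<subseteq> A \<Longrightarrow> B \<in> X"
  by (auto simp: cpx_def)

lemma cpx_fin: "cpx X \<Longrightarrow> A \<in> X \<Longrightarrow> finite A"
  by (rule finite_sub[OF cpx_sub])

lemma finite_cpx: "cpx X \<Longrightarrow> finite X"
  by (rule finite_subset[of X "Pow V"]) (auto simp: cpx_def)

lemma finite_lvl: "cpx X \<Longrightarrow> finite (lvl X i)"
  using finite_cpx by (simp add: lvl_def)

lemma cpx_link: "cpx X \<Longrightarrow> cpx (link X U)"
  unfolding cpx_def link_def
proof (intro conjI ballI allI impI; elim conjE)
  fix A B assume *: "\<forall>A\<in>X. \<forall>B\<subseteq>A. B \<in> X" "A \<in> {B \<in> X. U \<inter> B = {} \<and> U \<union> B \<in> X}" "B \<subseteq> A"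
  then have "U \<union> B \<in> X" by (metis (mono_tags, lifting) Un_mono mem_Collect_eq subset_refl)
  then show "B \<in> {B \<in> X. U \<inter> B = {} \<and> U \<union> B \<in> X}" using * by blast
qed blast

lemma link_empty [simp]: "link X {} = X"
  by (auto simp: link_def)

lemma link_link:
  assumes "cpx X" "U \<in> link X {v}"
  shows "link (link X {v}) U = link X (insert v U)"
proof -
  have 1: "insert v B \<in> X" if "insert v (U \<union> B) \<in> X" for B
    using cpx_down[OF assms(1) that] by auto
  have 2: "U \<union> B \<in> X" if "insert v (U \<union> B) \<in> X" for B
    using cpx_down[OF assms(1) that] by auto
  show ?thesis
    using assms 1 2 by (auto simp: link_def)
qed

lemma link_subset: "link X U \<subseteq> X"
  by (auto simp: link_def)

lemma suppD: "supp u X \<Longrightarrow> A \<notin> X \<Longrightarrow> u A = 0"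
  by (auto simp: supp_def)

lemma suppI: "(\<And>A. A \<notin> X \<Longrightarrow> u A = 0) \<Longrightarrow> supp u X"
  by (auto simp: supp_def)

lemma supp_mono: "supp u X \<Longrightarrow> X \<subseteq> Y \<Longrightarrow> supp u Y"
  by (auto simp: supp_def)

lemma supp_add: "supp u X \<Longrightarrow> supp w X \<Longrightarrow> supp (\<lambda>A. u A + w A) X"
  by (rule suppI) (simp add: suppD[of u X] suppD[of w X])

lemma supp_diff: "supp u X \<Longrightarrow> supp w X \<Longrightarrow> supp (\<lambda>A. u A - w A) X"
  by (rule suppI) (simp add: suppD[of u X] suppD[of w X])

lemma supp_scale: "supp u X \<Longrightarrow> supp (\<lambda>A. c * u A) X"
  by (auto simp: supp_def)

lemma supp_zero [simp]: "supp (\<lambda>A. 0) X"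
  by (auto simp: supp_def)

lemma supp_sum: "(\<And>i. i \<in> I \<Longrightarrow> supp (x i) X) \<Longrightarrow> supp (\<lambda>A. \<Sum>i\<in>I. c i * x i A) X"
  unfolding supp_def
proof (intro allI impI)
  fix A assume *: "\<And>i. i \<in> I \<Longrightarrow> \<forall>A. x i A \<noteq> 0 \<longrightarrow> A \<in> X" "(\<Sum>i\<in>I. c i * x i A) \<noteq> 0"
  show "A \<in> X"
  proof (rule ccontr)
    assume "A \<notin> X"
    then have "(\<Sum>i\<in>I. c i * x i A) = 0" using *(1) by (intro sum.neutral) auto
    with *(2) show False ..
  qed
qed

lemma supp_delta: "A \<in> X \<Longrightarrow> supp (delta A) X"
  by (auto simp: supp_def delta_def)

lemma supp_bd:
  assumes "cpx X" "supp u (lvl X i)"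
  shows "supp (bd f u) (lvl X (i - 1))"
  unfolding supp_def
proof (intro allI impI)
  fix B assume "bd f u B \<noteq> 0"
  then obtain v where v: "v \<in> V - B" "u (insert v B) \<noteq> 0" "B \<subseteq> V"
    unfolding bd_def by (smt (verit, ccfv_SIG) mult_eq_0_iff sum.neutral)
  then have "insert v B \<in> X" "card (insert v B) = i"
    using assms(2) by (auto simp: supp_def lvl_def)
  then show "B \<in> lvl X (i - 1)"
    using v finite_sub[of B] cpx_down[OF assms(1), of "insert v B" B] by (auto simp: lvl_def)
qed

lemma bd_level_0:
  assumes "cpx X" "supp u (lvl X 0)"
  shows "bd f u = (\<lambda>B. 0)"
proof
  fix B
  have "u (insert v B) = 0" if "B \<subseteq> V" for v
    using assms(2) finite_sub[OF that] by (auto simp: supp_def lvl_def)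
  then show "bd f u B = 0" by (simp add: bd_def)
qed

lemma expand_delta:
  assumes "finite X" "supp u X"
  shows "u A = (\<Sum>B\<in>X. u B * delta B A)"
proof (cases "A \<in> X")
  case True
  have "(\<Sum>B\<in>X. u B * delta B A) = (\<Sum>B\<in>X. if B = A then u A else 0)"
    by (intro sum.cong) (auto simp: delta_def)
  then show ?thesis using True assms(1) by simp
next
  case False
  then have "(\<Sum>B\<in>X. u B * delta B A) = 0" by (intro sum.neutral) (auto simp: delta_def)
  then show ?thesis using suppD[OF assms(2) False] by simp
qed

lemma bd_expand:
  assumes "finite X" "supp u X"
  shows "bd f u B = (\<Sum>A\<in>X. u A * bd f (delta A) B)"
proof -
  have "u = (\<lambda>A. \<Sum>B\<in>X. u B * delta B A)"
    using expand_delta[OF assms] by blast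
  then have "bd f u B = bd f (\<lambda>A. \<Sum>B\<in>X. u B * delta B A) B" by (rule arg_cong)
  also have "\<dots> = (\<Sum>A\<in>X. bd f (\<lambda>C. u A * delta A C) B)" by (rule bd_sum)
  finally show ?thesis by (simp add: bd_scale)
qed

text \<open>A linear right inverse of the boundary on its image, stored by its values
  \<open>g B\<close> on the basis. Stored this way it can be applied to coefficients from a larger
  field or to polynomial functions.\<close>

lemma ex_section:
  fixes f :: "'a \<Rightarrow> 'k::field"
  assumes X: "cpx X"
  obtains g :: "'a set \<Rightarrow> 'a set \<Rightarrow> 'k" where
    "\<And>B. supp (g B) (lvl X (Suc i))"
    "\<And>u. supp u (lvl X (Suc i)) \<Longrightarrow> bd f (\<lambda>A. \<Sum>B\<in>lvl X i. bd f u B * g B A) = bd f u"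
proof -
  let ?s = "\<lambda>(c::'k) (f::'a set \<Rightarrow> 'k) x. c * f x"
  have lin: "Vector_Spaces.linear ?s ?s (bd f)"
    by unfold_locales (auto simp: fun_eq_iff bd_add bd_scale plus_fun_def)
  have "fvs.subspace {u::'a set \<Rightarrow> 'k. supp u (lvl X (Suc i))}"
    by (auto simp: fvs.subspace_def zero_fun_def plus_fun_def intro: supp_add supp_scale)
  then have "\<exists>G. range G \<subseteq> {u. supp u (lvl X (Suc i))} \<and> Vector_Spaces.linear ?s ?s G \<and>
      (\<forall>v\<in>bd f ` {u. supp u (lvl X (Suc i))}. bd f (G v) = v)"
    by (rule fvsp.linear_exists_right_inverse_on[OF lin])
  then obtain G where G: "range G \<subseteq> {u. supp u (lvl X (Suc i))} \<and> Vector_Spaces.linear ?s ?s G \<and>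
      (\<forall>v\<in>bd f ` {u. supp u (lvl X (Suc i))}. bd f (G v) = v)" ..
  interpret G: Vector_Spaces.linear ?s ?s G using G by blast
  show thesis
  proof (rule that[of "\<lambda>B. G (delta B)"])
    show "supp (G (delta B)) (lvl X (Suc i))" for B using G by auto
    fix u :: "'a set \<Rightarrow> 'k" assume u: "supp u (lvl X (Suc i))"
    have fin: "finite (lvl X i)" using X by (rule finite_lvl)
    have b: "supp (bd f u) (lvl X i)" using supp_bd[OF X u] by simp
    have "bd f u = (\<Sum>B\<in>lvl X i. (\<lambda>A. bd f u B * delta B A))"
      by (rule HOL.ext, unfold sum_apply_fun, rule expand_delta[OF fin b])
    then have "G (bd f u) = G (\<Sum>B\<in>lvl X i. (\<lambda>A. bd f u B * delta B A))"
      by (rule arg_cong)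
    also have "\<dots> = (\<Sum>B\<in>lvl X i. (\<lambda>A. bd f u B * G (delta B) A))"
      unfolding G.sum G.scale ..
    finally have "G (bd f u) = (\<lambda>A. \<Sum>B\<in>lvl X i. bd f u B * G (delta B) A)"
      by (auto simp: fun_eq_iff sum_apply_fun)
    then show "bd f (\<lambda>A. \<Sum>B\<in>lvl X i. bd f u B * G (delta B) A) = bd f u"
      using G u by (metis (mono_tags, lifting) image_eqI mem_Collect_eq)
  qed
qed

lemma exactE:
  assumes "exact f X i" "supp u (lvl X i)" "\<And>B. bd f u B = 0"
  shows "\<exists>b. supp b (lvl X (Suc i)) \<and> (\<forall>B. bd f b B = u B)"
proof -
  have "bd f u = (\<lambda>B. 0)" using assms(3) by (rule HOL.ext)
  then obtain b where "supp b (lvl X (Suc i))" "bd f b = u"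
    using assms(1,2) unfolding exact_def by blast
  then show ?thesis by (intro exI[of _ b]) simp
qed

lemma exactI:
  assumes "\<And>u. supp u (lvl X i) \<Longrightarrow> (\<And>B. bd f u B = 0) \<Longrightarrow> \<exists>b. supp b (lvl X (Suc i)) \<and> (\<forall>B. bd f b B = u B)"
  shows "exact f X i"
  unfolding exact_def
proof (intro allI impI)
  fix u assume "supp u (lvl X i)" "bd f u = (\<lambda>B. 0)"
  then obtain b where "supp b (lvl X (Suc i))" "\<forall>B. bd f b B = u B"
    using assms[of u] by auto
  then show "\<exists>b. supp b (lvl X (Suc i)) \<and> bd f b = u"
    by (intro exI[of _ b]) (simp add: fun_eq_iff)
qed

text \<open>Exactness over a subfield is witnessed by a chain contraction, which extends scalars.\<close>

lemma exact_extend_field: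
  fixes \<iota> :: "'k::field \<Rightarrow> 'l::field"
  assumes add: "\<And>x y. \<iota> (x + y) = \<iota> x + \<iota> y" and mult: "\<And>x y. \<iota> (x * y) = \<iota> x * \<iota> y"
    and one: "\<iota> 1 = 1"
    and X: "cpx X" and ex: "exact (\<lambda>_. 1 :: 'k) X i"
  shows "exact (\<lambda>_. 1 :: 'l) X i"
proof (rule exactI)
  fix u :: "'a set \<Rightarrow> 'l"
  assume u: "supp u (lvl X i)" and cyc: "\<And>B. bd (\<lambda>_. 1) u B = 0"
  have zero: "\<iota> 0 = 0" using add[of 0 0] by (metis add.right_neutral add_left_cancel)
  have minus: "\<iota> (- x) = - \<iota> x" for x using add[of x "- x"] zero by (simp add: eq_neg_iff_add_eq_0 add.commute)
  have diff: "\<iota> (x - y) = \<iota> x - \<iota> y" for x y using add[of x "- y"] minus by simp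
  have sum: "\<iota> (\<Sum>i\<in>I. f i) = (\<Sum>i\<in>I. \<iota> (f i))" for f :: "'b set \<Rightarrow> 'k" and I
    by (induction I rule: infinite_finite_induct) (auto simp: zero add)
  have sum': "\<iota> (\<Sum>i\<in>I. f i) = (\<Sum>i\<in>I. \<iota> (f i))" for f :: "'b \<Rightarrow> 'k" and I
    by (induction I rule: infinite_finite_induct) (auto simp: zero add)
  have os: "\<iota> (osign v B) = osign v B" for v B
  proof -
    have "\<iota> ((-1) ^ k) = (-1) ^ k" for k by (induction k) (auto simp: one mult minus)
    then show ?thesis by (simp add: osign_def)
  qed
  have \<iota>_delta: "\<iota> (delta A C) = delta A C" for A C :: "'a set"
    by (simp add: delta_def zero one)
  have bd_\<iota>: "bd (\<lambda>_. 1) (\<lambda>A. \<iota> (w A)) B = \<iota> (bd (\<lambda>_. 1) w B)" for w B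
    by (simp add: bd_def sum' mult os zero)
  have fin: "finite (lvl X j)" for j using X by (rule finite_lvl)
  obtain g :: "'a set \<Rightarrow> 'a set \<Rightarrow> 'k" where
    g1: "\<And>B. supp (g B) (lvl X i)"
    and g2: "\<And>u. supp u (lvl X i) \<Longrightarrow>
      bd (\<lambda>_. 1) (\<lambda>A. \<Sum>B\<in>lvl X (i - 1). bd (\<lambda>_. 1) u B * g B A) = bd (\<lambda>_. 1) u"
  proof (cases i)
    \<comment> \<open>At cardinality 0 there is no lower level and \<open>i - 1\<close> is again 0;
      all boundaries vanish, so the zero section serves.\<close>
    case 0
    have "supp u (lvl X i) \<Longrightarrow> bd (\<lambda>_. 1) u = (\<lambda>_. 0)" for u :: "'a set \<Rightarrow> 'k"
      using bd_level_0[OF X] 0 by blast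
    then show ?thesis using that[of "\<lambda>_ _. 0"] by simp
  next
    case (Suc j)
    then show ?thesis using ex_section[OF X, of j "\<lambda>_. 1 :: 'k"] that by auto
  qed
  \<comment> \<open>Subtracting the section of its boundary projects a basis chain onto the cycles.
    Over the small field each of these cycles bounds, and the finitely many fillings determine a
    filling of every cycle over the large field.\<close>
  define z where "z A C = delta A C - (\<Sum>B\<in>lvl X (i - 1). bd (\<lambda>_. 1 :: 'k) (delta A) B * g B C)" for A C
  have "\<exists>\<beta>. supp \<beta> (lvl X (Suc i)) \<and> (\<forall>B. bd (\<lambda>_. 1) \<beta> B = z A B)" if "A \<in> lvl X i" for A
  proof -
    have d: "supp (delta A :: _ \<Rightarrow> 'k) (lvl X i)" using that by (rule supp_delta)
    have "supp (z A) (lvl X i)"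
      unfolding z_def by (rule supp_diff[OF d supp_sum]) (rule g1)
    moreover have "bd (\<lambda>_. 1) (z A) B = 0" for B
      unfolding z_def bd_diff fun_cong[OF g2[OF d]] by simp
    ultimately show ?thesis by (rule exactE[OF ex])
  qed
  then have "\<exists>\<beta>. \<forall>A\<in>lvl X i. supp (\<beta> A) (lvl X (Suc i)) \<and> (\<forall>B. bd (\<lambda>_. 1) (\<beta> A) B = z A B)"
    by (intro bchoice ballI)
  then obtain \<beta> where "\<forall>A\<in>lvl X i. supp (\<beta> A) (lvl X (Suc i)) \<and> (\<forall>B. bd (\<lambda>_. 1) (\<beta> A) B = z A B)" ..
  then have \<beta>: "\<And>A. A \<in> lvl X i \<Longrightarrow> supp (\<beta> A) (lvl X (Suc i))"
    "\<And>A B. A \<in> lvl X i \<Longrightarrow> bd (\<lambda>_. 1) (\<beta> A) B = z A B" by simp_all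
  define b where "b C = (\<Sum>A\<in>lvl X i. u A * \<iota> (\<beta> A C))" for C
  have "supp b (lvl X (Suc i))"
    unfolding b_def by (rule supp_sum, rule suppI) (simp add: suppD[OF \<beta>(1)] zero)
  moreover have "bd (\<lambda>_. 1) b C = u C" for C
  proof -
    have "bd (\<lambda>_. 1) b C = (\<Sum>A\<in>lvl X i. u A * \<iota> (z A C))"
      unfolding b_def bd_sum bd_scale bd_\<iota> using \<beta>(2) by (intro sum.cong) auto
    also have "\<dots> = (\<Sum>A\<in>lvl X i. u A * delta A C) -
        (\<Sum>A\<in>lvl X i. \<Sum>B\<in>lvl X (i - 1). u A * \<iota> (bd (\<lambda>_. 1) (delta A) B) * \<iota> (g B C))"
      unfolding z_def diff sum mult \<iota>_delta
      by (simp add: right_diff_distrib sum_subtractf sum_distrib_left mult_ac)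
    also have "(\<Sum>A\<in>lvl X i. u A * delta A C) = u C"
      by (rule expand_delta[OF fin u, symmetric])
    also have "(\<Sum>A\<in>lvl X i. \<Sum>B\<in>lvl X (i - 1). u A * \<iota> (bd (\<lambda>_. 1) (delta A) B) * \<iota> (g B C))
        = (\<Sum>B\<in>lvl X (i - 1). (\<Sum>A\<in>lvl X i. u A * \<iota> (bd (\<lambda>_. 1) (delta A) B)) * \<iota> (g B C))"
      by (subst sum.swap) (simp add: sum_distrib_right)
    \<comment> \<open>The section terms regroup into the boundary of u, which is a cycle.\<close>
    also have "\<dots> = 0"
    proof (rule sum.neutral, rule ballI)
      fix B
      have "(\<Sum>A\<in>lvl X i. u A * \<iota> (bd (\<lambda>_. 1) (delta A) B)) = (\<Sum>A\<in>lvl X i. u A * bd (\<lambda>_. 1) (delta A) B)"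
        unfolding bd_\<iota>[symmetric] \<iota>_delta ..
      also have "\<dots> = bd (\<lambda>_. 1) u B"
        by (rule bd_expand[OF fin u, symmetric])
      finally have "(\<Sum>A\<in>lvl X i. u A * \<iota> (bd (\<lambda>_. 1) (delta A) B)) = bd (\<lambda>_. 1) u B" .
      then show "(\<Sum>A\<in>lvl X i. u A * \<iota> (bd (\<lambda>_. 1) (delta A) B)) * \<iota> (g B C) = 0"
        by (simp add: cyc)
    qed
    finally show ?thesis by simp
  qed
  ultimately show "\<exists>b. supp b (lvl X (Suc i)) \<and> (\<forall>B. bd (\<lambda>_. 1) b B = u B)" by blast
qed

section \<open>Links of vertices and vanishing weights\<close>

lemma bd_delta: "bd (delta v) u B = (if v \<in> V - B \<and> B \<subseteq> V then osign v B * u (insert v B) else 0)"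
proof (cases "B \<subseteq> V")
  case True
  have "osign x B * delta v x * u (insert x B) = (if x = v then osign v B * u (insert v B) else 0)" for x
    by (simp add: delta_def)
  then have "bd (delta v) u B = (\<Sum>x\<in>V - B. if x = v then osign v B * u (insert v B) else 0)"
    unfolding bd_def using True by simp
  then show ?thesis using True by simp
qed (simp add: bd_def)

lemma supp_contract:
  assumes "cpx X" "supp u (lvl X (Suc i))"
  shows "supp (bd (delta v) u) (lvl (link X {v}) i)"
  unfolding supp_def
proof (intro allI impI)
  fix B assume "bd (delta v) u B \<noteq> 0"
  then have B: "v \<in> V - B" "B \<subseteq> V" "u (insert v B) \<noteq> 0" by (auto simp: bd_delta split: if_splits)
  then have "insert v B \<in> X" "card (insert v B) = Suc i" using assms(2) by (auto simp: supp_def lvl_def)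
  then show "B \<in> lvl (link X {v}) i"
    using B finite_sub[OF B(2)] cpx_down[OF assms(1), of "insert v B" B] by (auto simp: lvl_def link_def)
qed

lemma supp_vmul:
  assumes "cpx X" "supp u (lvl (link X {v}) i)"
  shows "supp (vmul v u) (lvl X (Suc i))"
  unfolding supp_def
proof (intro allI impI)
  fix A assume "vmul v u A \<noteq> 0"
  then have A: "v \<in> A" "A \<subseteq> V" "u (A - {v}) \<noteq> 0" by (auto simp: vmul_def split: if_splits)
  then have "A - {v} \<in> lvl (link X {v}) i" using assms(2) unfolding supp_def by blast
  then have B: "insert v (A - {v}) \<in> X" "card (A - {v}) = i" by (simp_all add: lvl_def link_def)
  have "insert v (A - {v}) = A" using A by blast
  then show "A \<in> lvl X (Suc i)"
    using B card.remove[OF finite_sub[OF A(2)] A(1)] by (simp add: lvl_def)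
qed

lemma vmul_zero [simp]: "vmul v (\<lambda>_. 0) = (\<lambda>_. 0)"
  by (rule HOL.ext) (simp add: vmul_def)

lemma supp_sub: "cpx X \<Longrightarrow> supp u (lvl X i) \<Longrightarrow> \<not> B \<subseteq> V \<Longrightarrow> u B = 0"
  using cpx_sub by (auto simp: supp_def lvl_def)

lemma bd_vmul_eq:
  assumes "v \<in> V" "cpx X" "supp u (lvl X i)"
  shows "bd f (vmul v u) B = f v * u B - vmul v (bd f u) B"
proof (cases "B \<subseteq> V")
  case True
  then show ?thesis using bd_vmul[OF assms(1) True, of f u] by (simp add: eq_diff_eq)
next
  case False
  then show ?thesis using supp_sub[OF assms(2,3) False] by (simp add: bd_def vmul_def)
qed

lemma links_exact_link:
  fixes F :: "'k::field itself"
  assumes "cpx X" "links_exact F X m" 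
  shows "links_exact F (link X {v}) (m - 1)"
  unfolding links_exact_def
proof (intro ballI allI impI)
  fix U i assume U: "U \<in> link X {v}" and i: "i + card U < m - 1"
  have "insert v U \<in> X" "v \<notin> U" "finite U" using U cpx_fin[OF assms(1)] by (auto simp: link_def)
  moreover have "i + card (insert v U) < m" using i calculation by simp
  ultimately show "exact (\<lambda>_. 1 :: 'k) (link (link X {v}) U) i"
    using assms U by (simp add: link_link links_exact_def)
qed

text \<open>Scaling the basis chain of A by the product of the weights over A is a diagonal change
  of basis that conjugates the weighted boundary into the unweighted one.\<close>

lemma exact_rescale:
  fixes f :: "'a \<Rightarrow> 'k::field"
  assumes X: "cpx X" and ex: "exact (\<lambda>_. 1 :: 'k) X i" and nz: "\<And>v. v \<in> V \<Longrightarrow> f v \<noteq> 0"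
  shows "exact f X i"
proof (rule exactI)
  fix u :: "'a set \<Rightarrow> 'k"
  assume u: "supp u (lvl X i)" and cyc: "\<And>B. bd f u B = 0"
  define P where "P A = (\<Prod>v\<in>A. f v)" for A
  have P: "P (insert v B) = f v * P B" if "v \<in> V - B" "B \<subseteq> V" for v B
    using that finite_sub[OF that(2)] by (simp add: P_def)
  have Pnz: "P B \<noteq> 0" if "B \<subseteq> V" for B
    using that nz finite_sub[OF that] by (auto simp: P_def)
  have "bd (\<lambda>_. 1) (\<lambda>A. P A * u A) B = P B * bd f u B" for B
    unfolding bd_def by (auto simp: sum_distrib_left P mult_ac intro!: sum.cong)
  then have "bd (\<lambda>_. 1) (\<lambda>A. P A * u A) B = 0" for B using cyc by simp
  moreover have "supp (\<lambda>A. P A * u A) (lvl X i)" using u by (auto simp: supp_def)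
  ultimately obtain b where b: "supp b (lvl X (Suc i))" "\<And>B. bd (\<lambda>_. 1) b B = P B * u B"
    using exactE[OF ex, of "\<lambda>A. P A * u A"] by auto
  have "bd f (\<lambda>A. b A / P A) B = u B" for B
  proof (cases "B \<subseteq> V")
    case True
    have "bd f (\<lambda>A. b A / P A) B = bd (\<lambda>_. 1) b B / P B"
      unfolding bd_def using True
      by (auto simp: sum_divide_distrib P nz Pnz intro!: sum.cong)
    then show ?thesis using b(2) Pnz[OF True] by simp
  next
    case False
    then show ?thesis using supp_sub[OF X u False] by (simp add: bd_def)
  qed
  moreover have "supp (\<lambda>A. b A / P A) (lvl X (Suc i))" using b(1) by (auto simp: supp_def)
  ultimately show "\<exists>b. supp b (lvl X (Suc i)) \<and> (\<forall>B. bd f b B = u B)" by blast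
qed

text \<open>Every zero weight costs one unit of depth. Giving one such vertex v the weight 1 adds
  contraction by v to the operator, and chains in the link of v do not see the change. The induction
  hypothesis is applied to X once, and to the link twice: to repair the contraction of the cycle and
  that of its filling.\<close>

lemma exact_weights:
  fixes f :: "'a \<Rightarrow> 'k::field"
  assumes "cpx X" "links_exact TYPE('k) X m" "i + card {v\<in>V. f v = 0} < m"
  shows "exact f X i"
  using assms
proof (induction "card {v\<in>V. f v = 0}" arbitrary: X m i f)
  case 0
  show ?case
  proof (cases "{} \<in> X")
    case True
    then have "exact (\<lambda>_. 1 :: 'k) X i"
      using 0(3,4) unfolding links_exact_def by (metis add_0_right card.empty 0(1) link_empty)
    then show ?thesis using exact_rescale[OF 0(2)] 0(1) by auto
  next
    case False
    then have X: "X = {}" using cpx_down[OF 0(2)] by blast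
    show ?thesis
    proof (rule exactI)
      fix u :: "'a set \<Rightarrow> 'k" assume "supp u (lvl X i)"
      then have "u = (\<lambda>_. 0)" by (auto simp: supp_def lvl_def X)
      then show "\<exists>b. supp b (lvl X (Suc i)) \<and> (\<forall>B. bd f b B = u B)"
        by (intro exI[of _ "\<lambda>_. 0"]) simp
    qed
  qed
next
  case (Suc t)
  then have "{v\<in>V. f v = 0} \<noteq> {}" by (metis Zero_not_Suc card.empty)
  then obtain v where v: "v \<in> V" "f v = 0" by auto
  note X = \<open>cpx X\<close>
  define L where "L = link X {v}"
  define f' where "f' = f(v := 1)"
  define \<iota> where "\<iota> = bd (delta v :: 'a \<Rightarrow> 'k)"
  have L: "cpx L" using X cpx_link L_def by blast
  have "{w\<in>V. f' w = 0} = {w\<in>V. f w = 0} - {v}" by (auto simp: f'_def)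
  then have t: "card {w\<in>V. f' w = 0} = t" using Suc(2) v by simp
  have exX: "exact f' X j" if "j + t < m" for j
    using Suc(1)[OF t[symmetric] X Suc(4)] that t by blast
  have exL': "exact f' L j" if "Suc (j + t) < m" for j
    using Suc(1)[OF t[symmetric] L links_exact_link[OF X Suc(4), of v, folded L_def]] that t by simp
  have bdL: "bd f' w B = bd f w B" if "supp w (lvl L j)" for w :: "'a set \<Rightarrow> 'k" and j B
  proof -
    have "w (insert v B) = 0" using that by (auto simp: supp_def L_def lvl_def link_def)
    then show ?thesis unfolding bd_def f'_def by (auto intro!: sum.cong)
  qed
  have exL: "\<exists>b. supp b (lvl L (Suc j)) \<and> (\<forall>B. bd f b B = w B)"
    if "Suc (j + t) < m" "supp w (lvl L j)" "\<And>B. bd f w B = 0" for j and w :: "'a set \<Rightarrow> 'k"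
  proof -
    have "bd f' w B = 0" for B using that(3) bdL[OF that(2)] by simp
    from exactE[OF exL'[OF that(1)] that(2) this]
    obtain b where b: "supp b (lvl L (Suc j))" "\<And>B. bd f' b B = w B" by auto
    then show ?thesis using bdL[OF b(1)] by (intro exI[of _ b]) simp
  qed
  have f': "f' x = f x + delta v x" for x using v by (auto simp: f'_def delta_def)
  have bdf': "bd f' w B = bd f w B + \<iota> w B" for w B
    unfolding f' \<iota>_def by (rule bd_fun_add)
  show ?case
  proof (rule exactI)
    fix u :: "'a set \<Rightarrow> 'k"
    assume u: "supp u (lvl X i)" and cyc: "\<And>B. bd f u B = 0"
    have it: "i + t < m - 1" using Suc(2) Suc(5) by simp
    define u1 where "u1 = \<iota> u"
    have cyc1: "bd f u1 B = 0" for B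
      proof -
      have "bd f u = (\<lambda>_. 0)" by (rule HOL.ext) (rule cyc)
      then show ?thesis unfolding u1_def \<iota>_def bd_anticomm[of f] by simp
    qed
    have "\<exists>b1. supp b1 (lvl L i) \<and> (\<forall>B. bd f b1 B = u1 B)"
    proof (cases i)
      case 0
      then have "u1 = (\<lambda>_. 0)" using bd_level_0[OF X] u by (simp add: u1_def \<iota>_def)
      then show ?thesis by (intro exI[of _ "\<lambda>_. 0"]) simp
    next
      case (Suc j)
      have "supp u1 (lvl L j)" unfolding u1_def \<iota>_def L_def using supp_contract[OF X] u Suc by simp
      moreover have "Suc (j + t) < m" using it Suc by simp
      ultimately show ?thesis using exL[of j u1] cyc1 Suc by simp
    qed
    then obtain b1 where b1: "supp b1 (lvl L i)" "\<And>B. bd f b1 B = u1 B" by blast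
    have u1': "bd f b1 = u1" using b1(2) by blast
    have bv: "bd f (vmul v b1) B = - vmul v u1 B" for B
      using bd_vmul_eq[OF v(1) L b1(1), of f B] v(2) u1' by simp
    \<comment> \<open>Since \<open>u1\<close> bounds in the link, removing \<open>vmul v u1\<close>
      changes u by a boundary. It also kills the contraction by v, so the result is a cycle for the
      new weights too.\<close>
    define u0 where "u0 = (\<lambda>B. u B - vmul v u1 B)"
    have L1: "supp (vmul v b1) (lvl X (Suc i))" using supp_vmul[OF X] b1(1) by (simp add: L_def)
    have "supp (\<lambda>B. - bd f (vmul v b1) B) (lvl X i)"
      using supp_bd[OF X L1, of f] by (simp add: supp_def)
    then have u0: "supp u0 (lvl X i)" unfolding u0_def using u bv by (intro supp_diff) auto
    have u0f: "bd f u0 B = 0" for B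
    proof -
      have "bd f u0 B = bd f u B - bd f (\<lambda>B. - bd f (vmul v b1) B) B"
        unfolding u0_def bd_diff[of f u] bv by simp
      then show ?thesis by (simp add: cyc bd_uminus)
    qed
    have iu0: "\<iota> u0 B = 0" for B
    proof -
      have "\<iota> (vmul v u1) B = u1 B - vmul v (\<iota> u1) B"
      proof (cases i)
        case 0
        then have "u1 = (\<lambda>_. 0)" using bd_level_0[OF X] u by (simp add: u1_def \<iota>_def)
        then show ?thesis by (simp add: \<iota>_def)
      next
        case (Suc j)
        have "supp u1 (lvl X j)" unfolding u1_def \<iota>_def using supp_bd[OF X u] Suc by simp
        then show ?thesis using bd_vmul_eq[OF v(1) X, of u1 j "delta v" B] by (simp add: \<iota>_def delta_def)
      qed
      also have "\<dots> = u1 B" unfolding u1_def \<iota>_def by (simp add: vmul_def)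
      finally show ?thesis unfolding u0_def \<iota>_def bd_diff by (simp add: u1_def \<iota>_def)
    qed
    have "bd f' u0 B = 0" for B by (simp add: bdf' u0f iu0)
    moreover have "i + t < m" using it by simp
    ultimately obtain b where b: "supp b (lvl X (Suc i))" "\<And>B. bd f' b B = u0 B"
      using exactE[OF exX u0] it by auto
    \<comment> \<open>A filling for the new weights misses one for f by its contraction at v. This
      defect is a cycle in the link and is filled there.\<close>
    have "supp (\<iota> b) (lvl L i)" unfolding \<iota>_def L_def by (rule supp_contract[OF X b(1)])
    moreover have "bd f (\<iota> b) B = 0" for B
    proof -
      have "bd f b = (\<lambda>B. u0 B - \<iota> b B)" using b(2) bdf'[of b] by (auto simp: fun_eq_iff algebra_simps)
      then have "\<iota> (bd f b) B = 0" using iu0 by (simp add: \<iota>_def bd_diff)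
      then show ?thesis using bd_anticomm[of f "delta v" b B] by (simp add: \<iota>_def)
    qed
    moreover have "Suc (i + t) < m" using it by simp
    ultimately obtain b2 where b2: "supp b2 (lvl L (Suc i))" "\<And>B. bd f b2 B = \<iota> b B"
      using exL[of i "\<iota> b"] by auto
    have b2X: "supp b2 (lvl X (Suc i))"
      using b2(1) by (rule supp_mono) (use link_subset[of X "{v}"] in \<open>auto simp: lvl_def L_def\<close>)
    have "bd f (\<lambda>B. (b B + b2 B) - vmul v b1 B) B = u B" for B
      unfolding bd_diff bd_add b2(2) bv using b(2)[of B] bdf'[of b B] by (simp add: u0_def algebra_simps)
    then show "\<exists>b. supp b (lvl X (Suc i)) \<and> (\<forall>B. bd f b B = u B)"
      using supp_diff[OF supp_add[OF b(1) b2X] L1] by blast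
  qed
qed

end

section \<open>Chains with polynomial coefficients\<close>

text \<open>\<open>hp p\<close> consists of the functions that are sums of products of \<open>p\<close> linear forms and a constant,
  i.e. the homogeneous polynomial functions of degree \<open>p\<close>.\<close>

definition lin :: "('k::field poly \<Rightarrow> 'k) \<Rightarrow> bool" where
  "lin l \<longleftrightarrow> (\<forall>x y. l (x + y) = l x + l y) \<and> (\<forall>c x. l (smult c x) = c * l x)"

definition linmap :: "('k::field poly \<Rightarrow> 'k poly) \<Rightarrow> bool" where
  "linmap T \<longleftrightarrow> (\<forall>x y. T (x + y) = T x + T y) \<and> (\<forall>c x. T (smult c x) = smult c (T x))"

inductive hp :: "nat \<Rightarrow> ('k::field poly \<Rightarrow> 'k) \<Rightarrow> bool" where
  hp_const: "hp 0 (\<lambda>_. c)"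
| hp_zero: "hp p (\<lambda>_. 0)"
| hp_add: "hp p f \<Longrightarrow> hp p g \<Longrightarrow> hp p (\<lambda>q. f q + g q)"
| hp_mult: "lin l \<Longrightarrow> hp p f \<Longrightarrow> hp (Suc p) (\<lambda>q. l q * f q)"

lemma lin_poly: "lin (\<lambda>q. poly q a)"
  by (simp add: lin_def)

lemma lin_coeff: "lin (\<lambda>q. coeff q j)"
  by (simp add: lin_def)

lemma lin_zero: "lin l \<Longrightarrow> l 0 = 0"
  unfolding lin_def by (metis mult_zero_left smult_0_left)

lemma lin_diff_smult: "lin l \<Longrightarrow> l (x - smult c y) = l x - c * l y"
  unfolding lin_def by (metis (no_types, opaque_lifting) add_diff_cancel diff_add_cancel)

lemma lin_comp: "lin l \<Longrightarrow> linmap T \<Longrightarrow> lin (\<lambda>q. l (T q))"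
  by (simp add: lin_def linmap_def)

lemma hp_scale: "hp p f \<Longrightarrow> hp p (\<lambda>q. c * f q)"
proof (induction rule: hp.induct)
  case (hp_const c') then show ?case by (rule hp.hp_const)
next
  case (hp_zero p) then show ?case by (simp add: hp.hp_zero)
next
  case (hp_add p f g)
  then show ?case using hp.hp_add[OF hp_add.IH] by (simp add: distrib_left)
next
  case (hp_mult l p f)
  then show ?case using hp.hp_mult[OF hp_mult.hyps(1) hp_mult.IH] by (simp add: mult.left_commute)
qed

lemma hp_diff: "hp p f \<Longrightarrow> hp p g \<Longrightarrow> hp p (\<lambda>q. f q - g q)"
  using hp_add[of p f "\<lambda>q. -1 * g q"] hp_scale[of p g "-1"] by simp

lemma hp_sum: "(\<And>i. i \<in> I \<Longrightarrow> hp p (f i)) \<Longrightarrow> hp p (\<lambda>q. \<Sum>i\<in>I. f i q)"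
proof (induction I rule: infinite_finite_induct)
  case (insert x F)
  then show ?case using hp_add[of p "f x" "\<lambda>q. \<Sum>i\<in>F. f i q"] by simp
qed (simp_all add: hp_zero)

lemma hp_comp:
  assumes "linmap T" shows "hp p f \<Longrightarrow> hp p (\<lambda>q. f (T q))"
proof (induction rule: hp.induct)
  case (hp_mult l p f)
  then show ?case using hp.hp_mult[OF lin_comp[OF hp_mult.hyps(1) assms] hp_mult.IH] by simp
qed (rule hp.intros; assumption)+

lemma hp_prod:
  assumes "finite A" "\<And>v. v \<in> A \<Longrightarrow> lin (l v)" "hp p f"
  shows "hp (card A + p) (\<lambda>q. (\<Prod>v\<in>A. l v q) * f q)"
  using assms(1,2)
proof (induction A)
  case empty
  then show ?case using assms(3) by simp
next
  case (insert v A)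
  then have "hp (Suc (card A + p)) (\<lambda>q. l v q * ((\<Prod>v\<in>A. l v q) * f q))"
    by (intro hp_mult) auto
  then show ?case using insert by (simp add: mult.assoc)
qed

lemma hp_at_0: "hp p f \<Longrightarrow> p \<noteq> 0 \<Longrightarrow> f 0 = 0"
  by (induction rule: hp.induct) (auto simp: lin_zero)

lemma hp_0_const: "hp p f \<Longrightarrow> p = 0 \<Longrightarrow> f q = f q'"
proof (induction rule: hp.induct)
  case (hp_add p f g)
  then show ?case by (simp only:)
qed simp_all

text \<open>The map q \<mapsto> \<open>q - smult (l q) q0\<close> projects onto the hyperplane l =
  0, so a homogeneous function vanishing there is divisible by l. In degree 0 the difference is
  zero, which \<open>p - 1\<close> cannot express; hence the separate clause g = 0.\<close>

lemma hp_divide: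
  assumes l: "lin l" "l q0 = 1"
  shows "hp p f \<Longrightarrow> \<exists>g. hp (p - 1) g \<and> (p = 0 \<longrightarrow> g = (\<lambda>_. 0)) \<and> (\<forall>q. f q - f (q - smult (l q) q0) = l q * g q)"
proof (induction rule: hp.induct)
  case (hp_const c)
  show ?case by (intro exI[of _ "\<lambda>_. 0"]) (simp add: hp.hp_zero)
next
  case (hp_zero p)
  show ?case by (intro exI[of _ "\<lambda>_. 0"]) (simp add: hp.hp_zero)
next
  case (hp_add p f g)
  then obtain f' g' where "hp (p - 1) f'" "p = 0 \<longrightarrow> f' = (\<lambda>_. 0)" "\<forall>q. f q - f (q - smult (l q) q0) = l q * f' q"
    and "hp (p - 1) g'" "p = 0 \<longrightarrow> g' = (\<lambda>_. 0)" "\<forall>q. g q - g (q - smult (l q) q0) = l q * g' q"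
    by auto
  moreover from this have "f q + g q - (f (q - smult (l q) q0) + g (q - smult (l q) q0)) = l q * (f' q + g' q)" for q
    unfolding add_diff_add by (simp add: distrib_left)
  ultimately show ?case
    by (intro exI[of _ "\<lambda>q. f' q + g' q"]) (simp add: hp.hp_add)
next
  case (hp_mult l' p f)
  then obtain g where g: "hp (p - 1) g" "p = 0 \<longrightarrow> g = (\<lambda>_. 0)" "\<And>q. f q - f (q - smult (l q) q0) = l q * g q"
    by auto
  have T: "linmap (\<lambda>q. q - smult (l q) q0)"
    using l(1) by (simp add: linmap_def lin_def smult_add_left smult_diff_right)
  have 1: "hp p (\<lambda>q. l' q * g q)"
    using hp.hp_mult[OF hp_mult.hyps(1) g(1)] g(2) by (cases p) (simp_all add: hp.hp_zero)
  have 2: "hp p (\<lambda>q. l' q0 * f (q - smult (l q) q0))"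
    by (rule hp_scale[OF hp_comp[OF T hp_mult.hyps(2)]])
  have "l' q * f q - l' (q - smult (l q) q0) * f (q - smult (l q) q0)
      = l q * (l' q * g q + l' q0 * f (q - smult (l q) q0))" for q
  proof -
    have "l' q * f q - l' (q - smult (l q) q0) * f (q - smult (l q) q0)
      = l' q * (f q - f (q - smult (l q) q0)) + l q * (l' q0 * f (q - smult (l q) q0))"
      unfolding lin_diff_smult[OF hp_mult.hyps(1)] by (simp add: algebra_simps)
    then show ?thesis unfolding g(3) by (simp add: algebra_simps)
  qed
  then show ?case
    using hp.hp_add[OF 1 2] by (intro exI[of _ "\<lambda>q. l' q * g q + l' q0 * f (q - smult (l q) q0)"]) simp
qed

lemma lin_line: "lin l \<Longrightarrow> l (q + smult t q0) = poly [:l q, l q0:] t"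
  by (simp add: lin_def)

lemma hp_line: "hp p f \<Longrightarrow> \<exists>r. \<forall>t. f (q + smult t q0) = poly r t"
proof (induction rule: hp.induct)
  case (hp_const c)
  show ?case by (intro exI[of _ "[:c:]"]) simp
next
  case (hp_zero p)
  show ?case by (intro exI[of _ 0]) simp
next
  case (hp_add p f g)
  then obtain r s where "\<forall>t. f (q + smult t q0) = poly r t" "\<forall>t. g (q + smult t q0) = poly s t" by auto
  then show ?case by (intro exI[of _ "r + s"]) simp
next
  case (hp_mult l p f)
  then obtain r where "\<forall>t. f (q + smult t q0) = poly r t" by auto
  then show ?case
    by (intro exI[of _ "[:l q, l q0:] * r"]) (simp only: lin_line[OF hp_mult.hyps(1)] poly_mult simp_thms)
qed

text \<open>The point q may itself lie on l = 0. On the line through q in direction q0 everything is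
  a univariate polynomial, and over an infinite field one with only zero values is zero.\<close>

lemma hp_cancel:
  assumes inf: "infinite (UNIV :: 'k::field set)" and l: "lin l" "l q0 = 1" and f: "hp p f"
    and z: "\<And>t :: 'k. l (q + smult t q0) * f (q + smult t q0) = 0"
  shows "f q = 0"
proof -
  obtain r where r: "\<And>t. f (q + smult t q0) = poly r t" using hp_line[OF f] by blast
  have "poly ([:l q, l q0:] * r) t = 0" for t
    using z[of t] unfolding lin_line[OF l(1)] r poly_mult .
  then have "{t. poly ([:l q, l q0:] * r) t = 0} = UNIV" by simp
  then have "[:l q, l q0:] * r = 0" using poly_roots_finite[of "[:l q, l q0:] * r"] inf by metis
  moreover have "[:l q, l q0:] \<noteq> 0" using l(2) by simp
  ultimately have "r = 0" by (simp only: mult_eq_0_iff simp_thms)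
  then show ?thesis using r[of 0] by simp
qed

section \<open>Polynomials of bounded degree as parameters\<close>

definition pdeg :: "nat \<Rightarrow> 'k::field poly set" where
  "pdeg J = {q. \<forall>k\<ge>J. coeff q k = 0}"

lemma pdeg_0: "q \<in> pdeg 0 \<Longrightarrow> q = 0"
  by (simp add: pdeg_def poly_eq_iff)

lemma pdeg_diff_smult: "q \<in> pdeg J \<Longrightarrow> q' \<in> pdeg J \<Longrightarrow> q - smult c q' \<in> pdeg J"
  by (simp add: pdeg_def)

lemma pdeg_add_smult: "q \<in> pdeg J \<Longrightarrow> q' \<in> pdeg J \<Longrightarrow> q + smult c q' \<in> pdeg J"
  by (simp add: pdeg_def)

lemma pdeg_Suc_iff: "q \<in> pdeg J \<longleftrightarrow> q \<in> pdeg (Suc J) \<and> coeff q J = 0"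
  unfolding pdeg_def by (auto simp: Suc_le_eq) (metis le_neq_implies_less)

lemma pdeg_degree: "q \<in> pdeg J \<longleftrightarrow> q = 0 \<or> degree q < J"
proof
  assume q: "q \<in> pdeg J"
  show "q = 0 \<or> degree q < J"
  proof (rule ccontr)
    assume *: "\<not> (q = 0 \<or> degree q < J)"
    then have "coeff q (degree q) = 0" using q by (simp add: pdeg_def)
    then show False using * by simp
  qed
next
  assume "q = 0 \<or> degree q < J"
  then show "q \<in> pdeg J" by (auto simp: pdeg_def coeff_eq_0)
qed

lemma pdeg_linear_factor:
  "(q * [:- a, 1:] \<in> pdeg (Suc J)) = (q \<in> pdeg J)"
proof (cases "q = 0")
  case False
  have "degree (q * [:- a, 1:]) = degree q + 1"
    using False by (subst degree_mult_eq) auto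
  moreover have "q * [:- a, 1:] \<noteq> 0" using False by (intro no_zero_divisors) auto
  ultimately show ?thesis using False unfolding pdeg_degree by simp
qed (simp add: pdeg_def)

lemma monom_pdeg: "t < J \<Longrightarrow> monom 1 t \<in> pdeg J"
  by (simp add: pdeg_def)

section \<open>Boundary equations depending polynomially on the weights\<close>

locale poly_chains = ground V for V :: "'a::linorder set" +
  fixes \<alpha> :: "'a \<Rightarrow> 'k::field" and X :: "'a set set" and m :: nat
  assumes inj_\<alpha>: "inj_on \<alpha> V" and inf_k: "infinite (UNIV :: 'k set)" and X: "cpx X"
    and exX: "\<And>f :: 'a \<Rightarrow> 'k. \<And>i. i + card {v\<in>V. f v = 0} < m \<Longrightarrow> exact f X i"
begin

definition \<omega> :: "('a \<Rightarrow> 'k) \<Rightarrow> 'k poly \<Rightarrow> 'a \<Rightarrow> 'k" where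
  "\<omega> c q v = c v * poly q (\<alpha> v)"

definition pch :: "nat \<Rightarrow> nat \<Rightarrow> ('k poly \<Rightarrow> 'a set \<Rightarrow> 'k) \<Rightarrow> bool" where
  "pch i p x \<longleftrightarrow> (\<forall>A. hp p (\<lambda>q. x q A)) \<and> (\<forall>q. supp (x q) (lvl X i))"

text \<open>The equations are imposed only for q of degree below J, whereas \<open>pch\<close>
  constrains x for every q. Lowering J is therefore restriction to a hyperplane.\<close>

definition cyc :: "nat \<Rightarrow> ('a \<Rightarrow> 'k) \<Rightarrow> ('k poly \<Rightarrow> 'a set \<Rightarrow> 'k) \<Rightarrow> bool" where
  "cyc J c x \<longleftrightarrow> (\<forall>q\<in>pdeg J. \<forall>B. bd (\<omega> c q) (x q) B = 0)"

abbreviation zeros :: "('a \<Rightarrow> 'k) \<Rightarrow> nat" where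
  "zeros c \<equiv> card {v\<in>V. c v = 0}"

lemma pchI: "(\<And>A. hp p (\<lambda>q. x q A)) \<Longrightarrow> (\<And>q A. A \<notin> lvl X i \<Longrightarrow> x q A = 0) \<Longrightarrow> pch i p x"
  unfolding pch_def by (simp add: suppI)

lemma pch_hp: "pch i p x \<Longrightarrow> hp p (\<lambda>q. x q A)"
  by (simp add: pch_def)

lemma pch_0: "pch i p x \<Longrightarrow> A \<notin> lvl X i \<Longrightarrow> x q A = 0"
  using suppD[of "x q" "lvl X i" A] by (simp add: pch_def)

lemma pch_supp: "pch i p x \<Longrightarrow> supp (x q) (lvl X i)"
  by (simp add: pch_def)

lemma pch_zero: "pch i p (\<lambda>_ _. 0)"
  by (rule pchI) (simp_all add: hp_zero)

lemma pch_add: "pch i p x \<Longrightarrow> pch i p y \<Longrightarrow> pch i p (\<lambda>q A. x q A + y q A)"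
  by (rule pchI) (simp_all add: hp_add pch_hp pch_0)

lemma pch_diff: "pch i p x \<Longrightarrow> pch i p y \<Longrightarrow> pch i p (\<lambda>q A. x q A - y q A)"
  by (rule pchI) (simp_all add: hp_diff pch_hp pch_0)

lemma pch_mult: "lin l \<Longrightarrow> pch i p x \<Longrightarrow> pch i (Suc p) (\<lambda>q A. l q * x q A)"
  by (rule pchI) (simp_all add: hp_mult pch_hp pch_0)

lemma pch_prod:
  assumes "finite R" "\<And>v. v \<in> R \<Longrightarrow> lin (l v)" "pch i p x"
  shows "pch i (card R + p) (\<lambda>q A. (\<Prod>v\<in>R. l v q) * x q A)"
proof (rule pchI)
  show "hp (card R + p) (\<lambda>q. (\<Prod>v\<in>R. l v q) * x q A)" for A
    using hp_prod[OF assms(1,2) pch_hp[OF assms(3)]] by simp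
qed (simp add: pch_0[OF assms(3)])

lemma pch_comp:
  assumes "linmap T" "pch i p x"
  shows "pch i p (\<lambda>q. x (T q))"
proof (rule pchI)
  show "hp p (\<lambda>q. x (T q) A)" for A
    by (rule hp_comp[OF assms(1) pch_hp[OF assms(2)]])
qed (rule pch_0[OF assms(2)])

lemma pch_bd:
  assumes "pch (Suc i) p b"
  shows "pch i (Suc p) (\<lambda>q. bd (\<omega> c q) (b q))"
  unfolding pch_def
proof (intro conjI allI)
  fix A
  show "hp (Suc p) (\<lambda>q. bd (\<omega> c q) (b q) A)"
  proof (cases "A \<subseteq> V")
    case True
    have "hp (Suc p) (\<lambda>q. \<Sum>v\<in>V - A. poly q (\<alpha> v) * ((osign v A * c v) * b q (insert v A)))"
      by (intro hp_sum hp_mult hp_scale lin_poly pch_hp[OF assms])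
    moreover have "(\<lambda>q. bd (\<omega> c q) (b q) A) =
        (\<lambda>q. \<Sum>v\<in>V - A. poly q (\<alpha> v) * ((osign v A * c v) * b q (insert v A)))"
      using True unfolding bd_def \<omega>_def by (simp add: mult_ac)
    ultimately show ?thesis by simp
  next
    case False
    then show ?thesis by (simp add: bd_def hp_zero)
  qed
next
  fix q
  show "supp (bd (\<omega> c q) (b q)) (lvl X i)"
    using supp_bd[OF X pch_supp[OF assms]] by simp
qed

lemma pch_divide:
  assumes l: "lin l" "l q0 = 1" "q0 \<in> pdeg J" and x: "pch i (Suc p) x"
    and z: "\<And>q A. q \<in> pdeg J \<Longrightarrow> l q = 0 \<Longrightarrow> x q A = 0"
  shows "\<exists>x'. pch i p x' \<and> (\<forall>q\<in>pdeg J. \<forall>A. x q A = l q * x' q A)"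
proof -
  have "\<exists>g. hp p g \<and> (\<forall>q. x q A - x (q - smult (l q) q0) A = l q * g q)" for A
    using hp_divide[OF l(1,2) pch_hp[OF x, of A]] by auto
  then have "\<exists>g. \<forall>A. hp p (g A) \<and> (\<forall>q. x q A - x (q - smult (l q) q0) A = l q * g A q)"
    by (intro choice allI)
  then obtain g where g: "\<And>A. hp p (g A)" "\<And>A q. x q A - x (q - smult (l q) q0) A = l q * g A q"
    by auto
  define x' where "x' q A = (if A \<in> lvl X i then g A q else 0)" for q A
  have "pch i p x'"
  proof (rule pchI)
    fix A show "hp p (\<lambda>q. x' q A)" using g(1) by (cases "A \<in> lvl X i") (simp_all add: x'_def hp_zero)
  qed (simp add: x'_def)
  moreover have "x q A = l q * x' q A" if q: "q \<in> pdeg J" for q A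
  proof (cases "A \<in> lvl X i")
    case True
    have "l (q - smult (l q) q0) = 0" using l by (simp add: lin_diff_smult)
    then have "x (q - smult (l q) q0) A = 0" by (rule z[OF pdeg_diff_smult[OF q l(3)]])
    then show ?thesis using g(2)[of q A] True by (simp add: x'_def)
  next
    case False
    then show ?thesis using pch_0[OF x] by (simp add: x'_def)
  qed
  ultimately show ?thesis by blast
qed

lemma pch_cancel:
  assumes l: "lin l" "l q0 = 1" "q0 \<in> pdeg J" and y: "pch i p y"
    and z: "\<And>q. q \<in> pdeg J \<Longrightarrow> l q * y q B = 0" and q: "q \<in> pdeg J"
  shows "y q B = 0"
  by (rule hp_cancel[OF inf_k l(1,2) pch_hp[OF y]]) (rule z[OF pdeg_add_smult[OF q l(3)]])

text \<open>The operator is linear in q, so a filling of degree p answers a chain of degree p + 1.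
  This is vanishing of the homology of a graded complex, one degree at a time.\<close>

definition solvable :: "nat \<Rightarrow> ('a \<Rightarrow> 'k) \<Rightarrow> nat \<Rightarrow> nat \<Rightarrow> ('k poly \<Rightarrow> 'a set \<Rightarrow> 'k) \<Rightarrow> bool" where
  "solvable J c i p x \<longleftrightarrow> (\<exists>b. pch (Suc i) p b \<and> (\<forall>q\<in>pdeg J. \<forall>B. bd (\<omega> c q) (b q) B = x q B))"

text \<open>If x agrees with a boundary on the hyperplane l = 0, the difference is divisible by l,
  and the quotient is again a cycle because l can be cancelled.\<close>

lemma surj_step:
  assumes l: "lin l" "l q0 = 1" "q0 \<in> pdeg J" and x: "pch i (Suc p) x" "cyc J c x"
    and b: "pch (Suc i) p b" "\<And>q B. q \<in> pdeg J \<Longrightarrow> l q = 0 \<Longrightarrow> bd (\<omega> c q) (b q) B = x q B"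
  shows "\<exists>x'. pch i p x' \<and> cyc J c x' \<and> (\<forall>q\<in>pdeg J. \<forall>B. x q B = l q * x' q B + bd (\<omega> c q) (b q) B)"
proof -
  define y where "y q A = x q A - bd (\<omega> c q) (b q) A" for q A
  have y: "pch i (Suc p) y" unfolding y_def by (rule pch_diff[OF x(1) pch_bd[OF b(1)]])
  have "y q A = 0" if "q \<in> pdeg J" "l q = 0" for q A using b(2)[OF that] by (simp add: y_def)
  then obtain x' where x': "pch i p x'" "\<And>q A. q \<in> pdeg J \<Longrightarrow> y q A = l q * x' q A"
    using pch_divide[OF l y] by auto
  have "cyc J c x'"
    unfolding cyc_def
  proof (intro ballI allI)
    fix q :: "'k poly" and B assume q: "q \<in> pdeg J"
    have "l q * bd (\<omega> c q) (x' q) B = 0" if q: "q \<in> pdeg J" for q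
    proof -
      have "y q = (\<lambda>A. l q * x' q A)" using x'(2)[OF q] by (rule HOL.ext)
      then have "l q * bd (\<omega> c q) (x' q) B = bd (\<omega> c q) (y q) B" by (simp add: bd_scale)
      also have "\<dots> = bd (\<omega> c q) (x q) B" unfolding y_def bd_diff by simp
      finally show ?thesis using x(2) q by (simp add: cyc_def)
    qed
    \<comment> \<open>Cancelling needs a homogeneous degree; for chains on the empty face the
      boundary is simply zero.\<close>
    moreover obtain p' where "hp p' (\<lambda>q. bd (\<omega> c q) (x' q) B)"
    proof (cases i)
      case 0
      have "bd (\<omega> c q) (x' q) B = 0" for q
        using bd_level_0[OF X pch_supp[OF x'(1), unfolded 0]] by simp
      then show ?thesis using that[of 0] by (simp add: hp_zero)
    next
      case (Suc j)
      then have "pch j (Suc p) (\<lambda>q. bd (\<omega> c q) (x' q))" using pch_bd x'(1) by simp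
      then show ?thesis using that pch_hp by blast
    qed
    ultimately show "bd (\<omega> c q) (x' q) B = 0"
      using hp_cancel[OF inf_k l(1,2), of p' "\<lambda>q. bd (\<omega> c q) (x' q) B" q] pdeg_add_smult[OF q l(3)] by simp
  qed
  moreover have "x q B = l q * x' q B + bd (\<omega> c q) (b q) B" if "q \<in> pdeg J" for q B
    using x'(2)[OF that, of B] by (simp add: y_def algebra_simps)
  ultimately show ?thesis using x'(1) by blast
qed

lemma linmap_factor: "linmap (\<lambda>q. q * [:- a, 1:])"
  by (simp add: linmap_def distrib_right del: mult_pCons_right)

lemma linmap_div: "linmap (\<lambda>q. q div [:- a, 1:])"
  by (simp add: linmap_def poly_div_add_left div_smult_left)

text \<open>A polynomial vanishing at \<alpha> v has the factor t - \<alpha> v, which is absorbed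
  into the weights and, \<alpha> being injective, is zero at v alone. One unit of J is traded for
  one zero weight, and the induction hypothesis solves the equation on the hyperplane.\<close>

lemma vertex_step:
  assumes IH: "\<And>c i p x. i + J + zeros c \<le> m \<Longrightarrow> pch i (Suc p) x \<Longrightarrow> cyc J c x \<Longrightarrow> solvable J c i p x"
    and i: "i + Suc J + zeros c \<le> m" and v: "v \<in> V" "c v \<noteq> 0"
    and x: "pch i (Suc p) x" "cyc (Suc J) c x"
  shows "\<exists>x' b. pch i p x' \<and> cyc (Suc J) c x' \<and> pch (Suc i) p b \<and>
    (\<forall>q\<in>pdeg (Suc J). \<forall>B. x q B = poly q (\<alpha> v) * x' q B + bd (\<omega> c q) (b q) B)"
proof -
  define T :: "'k poly \<Rightarrow> 'k poly" where "T q = q * [:- \<alpha> v, 1:]" for q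
  define c' where "c' w = c w * (\<alpha> w - \<alpha> v)" for w
  have wT: "\<omega> c (T q) = \<omega> c' q" for q
    by (rule HOL.ext) (simp add: \<omega>_def T_def c'_def algebra_simps)
  have "{w\<in>V. c' w = 0} = insert v {w\<in>V. c w = 0}"
    using v inj_\<alpha> by (auto simp: c'_def inj_on_def)
  then have "zeros c' = Suc (zeros c)" using v by simp
  then have i': "i + J + zeros c' \<le> m" using i by simp
  have TJ: "T q \<in> pdeg (Suc J) \<longleftrightarrow> q \<in> pdeg J" for q
    unfolding T_def by (rule pdeg_linear_factor)
  have "pch i (Suc p) (\<lambda>q. x (T q))" unfolding T_def by (rule pch_comp[OF linmap_factor x(1)])
  moreover have "cyc J c' (\<lambda>q. x (T q))"
    unfolding cyc_def
  proof (intro ballI allI)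
    fix q :: "'k poly" and B assume "q \<in> pdeg J"
    then have "T q \<in> pdeg (Suc J)" using TJ by simp
    then show "bd (\<omega> c' q) (x (T q)) B = 0" using x(2) unfolding cyc_def wT[symmetric] by blast
  qed
  ultimately have "solvable J c' i p (\<lambda>q. x (T q))" by (rule IH[OF i'])
  then obtain b' where b': "pch (Suc i) p b'" "\<And>q B. q \<in> pdeg J \<Longrightarrow> bd (\<omega> c' q) (b' q) B = x (T q) B"
    unfolding solvable_def by blast
  \<comment> \<open>Polynomial division by the factor is linear on all polynomials, so b stays
    homogeneous; only its values at multiples of the factor matter.\<close>
  define b where "b q = b' (q div [:- \<alpha> v, 1:])" for q
  have b: "pch (Suc i) p b" unfolding b_def by (rule pch_comp[OF linmap_div b'(1)])
  have "bd (\<omega> c q) (b q) B = x q B" if q: "q \<in> pdeg (Suc J)" "poly q (\<alpha> v) = 0" for q B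
  proof -
    obtain r where r: "q = [:- \<alpha> v, 1:] * r" using q(2) unfolding poly_eq_0_iff_dvd by (rule dvdE)
    then have qT: "q = T r" by (simp add: T_def mult.commute)
    have "q div [:- \<alpha> v, 1:] = r" unfolding r by (rule nonzero_mult_div_cancel_left) simp
    then have "bd (\<omega> c q) (b q) B = bd (\<omega> c' r) (b' r) B" using wT[of r] by (simp add: b_def qT[symmetric])
    also have "\<dots> = x q B" using b'(2)[of r B] TJ[of r] q(1) qT by simp
    finally show ?thesis .
  qed
  moreover have "1 \<in> pdeg (Suc J)" by (simp add: pdeg_def)
  ultimately show ?thesis
    using surj_step[where l="\<lambda>q. poly q (\<alpha> v)" and ?q0.0=1, OF lin_poly _ _ x b] b by auto
qed

end

context poly_chains
begin

text \<open>Every split-off factor lowers the polynomial degree of the remaining cycle by one, so x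
  has to start in degree \<open>card R + p\<close>.\<close>

lemma vertices_step:
  assumes step: "\<And>v p x. v \<in> V \<Longrightarrow> pch i (Suc p) x \<Longrightarrow> cyc J c x \<Longrightarrow>
      \<exists>x' b. pch i p x' \<and> cyc J c x' \<and> pch (Suc i) p b \<and>
        (\<forall>q\<in>pdeg J. \<forall>B. x q B = l v q * x' q B + bd (\<omega> c q) (b q) B)"
    and l: "\<And>v. v \<in> V \<Longrightarrow> lin (l v)" and R: "R \<subseteq> V"
    and x: "pch i (card R + p) x" "cyc J c x"
  shows "\<exists>x' b. pch i p x' \<and> cyc J c x' \<and> pch (Suc i) (card R + p - 1) b \<and>
    (\<forall>q\<in>pdeg J. \<forall>B. x q B = (\<Prod>v\<in>R. l v q) * x' q B + bd (\<omega> c q) (b q) B)"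
proof -
  have "finite R" using R by (rule finite_sub)
  then show ?thesis using R x
  proof (induction R arbitrary: p x)
    case empty
    then show ?case by (intro exI[of _ x] exI[of _ "\<lambda>_ _. 0"]) (simp add: pch_zero)
  next
    case (insert v R)
    have "pch i (card R + Suc p) x" using insert.prems insert.hyps by simp
    then obtain x1 b1 where x1: "pch i (Suc p) x1" "cyc J c x1" and b1: "pch (Suc i) (card R + p) b1"
      and e1: "\<forall>q\<in>pdeg J. \<forall>B. x q B = (\<Prod>v\<in>R. l v q) * x1 q B + bd (\<omega> c q) (b1 q) B"
      using insert.IH[of "Suc p" x] insert.prems by auto
    have v: "v \<in> V" using insert.prems by simp
    obtain x2 b2 where x2: "pch i p x2" "cyc J c x2" and b2: "pch (Suc i) p b2"
      and e2: "\<forall>q\<in>pdeg J. \<forall>B. x1 q B = l v q * x2 q B + bd (\<omega> c q) (b2 q) B"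
      using step[OF v x1] by blast
    define b where "b q A = (\<Prod>v\<in>R. l v q) * b2 q A + b1 q A" for q A
    have "pch (Suc i) (card R + p) b"
      unfolding b_def using insert.hyps insert.prems l by (intro pch_add pch_prod b2 b1) auto
    then have "pch (Suc i) (card (insert v R) + p - 1) b" using insert.hyps by simp
    moreover have "x q B = (\<Prod>v\<in>insert v R. l v q) * x2 q B + bd (\<omega> c q) (b q) B" if "q \<in> pdeg J" for q B
    proof -
      have "x q B = (\<Prod>v\<in>R. l v q) * (l v q * x2 q B + bd (\<omega> c q) (b2 q) B) + bd (\<omega> c q) (b1 q) B"
        using e1 e2 that by simp
      then show ?thesis
        unfolding b_def bd_add bd_scale using insert.hyps by (simp add: algebra_simps)
    qed
    ultimately show ?case using x2 by blast
  qed
qed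

text \<open>Substituting \<open>e\<^sub>A \<mapsto> \<Prod>\<^sub>v\<^sub>\<in>\<^sub>A l\<^sub>v \<cdot> e\<^sub>A\<close> removes the indeterminates from the weights, so the
  product of all \<open>l\<^sub>v\<close> annihilates the homology.\<close>

lemma product_kills:
  assumes i: "i + zeros c < m" and l: "\<And>v. v \<in> V \<Longrightarrow> lin (l v)"
    and lc: "\<And>v q. v \<in> V \<Longrightarrow> c v * l v q = \<omega> c q v"
    and x: "pch i p x" "cyc J c x"
  shows "\<exists>b. pch (Suc i) (card V + p - 1) b \<and>
    (\<forall>q\<in>pdeg J. \<forall>B. bd (\<omega> c q) (b q) B = (\<Prod>v\<in>V. l v q) * x q B)"
proof -
  have ex: "exact c X i" by (rule exX[OF i])
  obtain g where g: "\<And>B. supp (g B) (lvl X (Suc i))"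
    "\<And>u. supp u (lvl X (Suc i)) \<Longrightarrow> bd c (\<lambda>A. \<Sum>B\<in>lvl X i. bd c u B * g B A) = bd c u"
    using ex_section[OF X, where f=c and i=i] by blast
  define y where "y q A = (\<Prod>v\<in>A. l v q) * x q A" for q A
  define b1 where "b1 q A = (\<Sum>B\<in>lvl X i. y q B * g B A)" for q A
  \<comment> \<open>The section of the constant operator fills y by \<open>b1\<close>. The
    complementary product undoes the substitution, which costs the product over all of V, and it
    makes the degree the same for all A.\<close>
  define b where "b q A = (\<Prod>v\<in>V - A. l v q) * b1 q A" for q A
  have subV: "A \<subseteq> V" if "A \<in> lvl X j" for A j using that cpx_sub[OF X] by (simp add: lvl_def)
  have y0: "y q A = 0" if "A \<notin> lvl X i" for q A using pch_0[OF x(1) that] by (simp add: y_def)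
  have hy: "hp (i + p) (\<lambda>q. y q A)" if "A \<in> lvl X i" for A
  proof -
    have "card A = i" using that by (simp add: lvl_def)
    moreover have "lin (l v)" if "v \<in> A" for v using subV[OF \<open>A \<in> lvl X i\<close>] that l by blast
    ultimately show ?thesis
      using hp_prod[OF finite_sub[OF subV[OF that]] _ pch_hp[OF x(1)], where l=l] by (simp add: y_def)
  qed
  have hb1: "hp (i + p) (\<lambda>q. b1 q A)" for A
  proof -
    have "hp (i + p) (\<lambda>q. \<Sum>B\<in>lvl X i. g B A * y q B)"
      by (intro hp_sum hp_scale hy)
    then show ?thesis by (simp add: b1_def mult.commute)
  qed
  have b10: "b1 q A = 0" if "A \<notin> lvl X (Suc i)" for q A
    using suppD[OF g(1) that] by (simp add: b1_def)
  have "pch (Suc i) (card V + p - 1) b"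
  proof (rule pchI)
    fix A
    show "hp (card V + p - 1) (\<lambda>q. b q A)"
    proof (cases "A \<in> lvl X (Suc i)")
      case True
      then have A: "card A = Suc i" "A \<subseteq> V" using subV by (simp_all add: lvl_def)
      have "card A \<le> card V" using A by (intro card_mono) simp_all
      then have "card (V - A) + (i + p) = card V + p - 1"
        using A finite_sub[OF A(2)] by (simp add: card_Diff_subset)
      then show ?thesis
        using hp_prod[of "V - A" l, OF _ _ hb1[of A]] l by (simp add: b_def)
    next
      case False
      then show ?thesis using b10 by (simp add: b_def hp_zero)
    qed
  qed (simp add: b_def b10)
  moreover have "bd (\<omega> c q) (b q) B = (\<Prod>v\<in>V. l v q) * x q B" if q: "q \<in> pdeg J" for q B
  proof (cases "B \<subseteq> V")
    case True
    have "bd c (y q) C = 0" for C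
    proof (cases "C \<subseteq> V")
      case True
      have "bd c (y q) C = (\<Sum>v\<in>V - C. (\<Prod>v\<in>C. l v q) * (osign v C * \<omega> c q v * x q (insert v C)))"
        unfolding bd_def y_def using True finite_sub[OF True]
        by (auto simp: mult_ac simp flip: lc intro!: sum.cong)
      also have "\<dots> = (\<Prod>v\<in>C. l v q) * bd (\<omega> c q) (x q) C"
        using True by (simp add: bd_def sum_distrib_left)
      finally show ?thesis using x(2) q by (simp add: cyc_def)
    qed (simp add: bd_def)
    moreover have sy: "supp (y q) (lvl X i)" using y0 by (rule suppI)
    ultimately obtain b0 where b0: "supp b0 (lvl X (Suc i))" "\<And>B. bd c b0 B = y q B"
      using exactE[OF ex] by metis
    have "bd c (b1 q) B = y q B"
      using fun_cong[OF g(2)[OF b0(1)], of B] by (simp add: b0(2) b1_def[abs_def])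
    moreover have "bd (\<omega> c q) (b q) B = (\<Prod>v\<in>V - B. l v q) * bd c (b1 q) B"
    proof -
      have "osign v B * \<omega> c q v * b q (insert v B) = (\<Prod>v\<in>V - B. l v q) * (osign v B * c v * b1 q (insert v B))"
        if "v \<in> V - B" for v
      proof -
        have "V - B = insert v (V - insert v B)" using that by auto
        then have "(\<Prod>v\<in>V - B. l v q) = l v q * (\<Prod>v\<in>V - insert v B. l v q)"
          by (metis Diff_iff finV finite_Diff insertI1 prod.insert)
        then show ?thesis using lc[of v q, symmetric] that by (simp add: b_def mult_ac)
      qed
      then have "(\<Sum>v\<in>V - B. osign v B * \<omega> c q v * b q (insert v B))
          = (\<Sum>v\<in>V - B. (\<Prod>v\<in>V - B. l v q) * (osign v B * c v * b1 q (insert v B)))"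
        by (rule sum.cong[OF refl])
      then show ?thesis using True by (simp add: bd_def sum_distrib_left)
    qed
    moreover have "(\<Prod>v\<in>V. l v q) = (\<Prod>v\<in>V - B. l v q) * (\<Prod>v\<in>B. l v q)"
      by (rule prod.subset_diff[OF True finV])
    ultimately show ?thesis by (simp add: y_def mult.assoc)
  next
    case False
    then have "B \<notin> lvl X i" using subV by blast
    then show ?thesis using pch_0[OF x(1)] False by (simp add: bd_def)
  qed
  ultimately show ?thesis by blast
qed

text \<open>A filling b of the multiple of x is a cycle where the coefficient vanishes, that is for
  parameters of degree below J. There it bounds by the induction hypothesis, one level up. After
  subtracting that boundary it is divisible by the coefficient, and the quotient fills x.\<close>

lemma coeff_injective:
  assumes IH: "\<And>c i p x. i + J + zeros c \<le> m \<Longrightarrow> pch i (Suc p) x \<Longrightarrow> cyc J c x \<Longrightarrow> solvable J c i p x"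
    and i: "i + Suc J + zeros c \<le> m" and x: "pch i (Suc p) x"
    and s: "solvable (Suc J) c i (Suc p) (\<lambda>q A. coeff q J * x q A)"
  shows "solvable (Suc J) c i p x"
proof -
  obtain b where b: "pch (Suc i) (Suc p) b" "\<And>q B. q \<in> pdeg (Suc J) \<Longrightarrow> bd (\<omega> c q) (b q) B = coeff q J * x q B"
    using s unfolding solvable_def by blast
  have "cyc J c b"
    unfolding cyc_def
  proof (intro ballI allI)
    fix q :: "'k poly" and B assume "q \<in> pdeg J"
    then have "q \<in> pdeg (Suc J)" "coeff q J = 0" using pdeg_Suc_iff[of q J] by simp_all
    then show "bd (\<omega> c q) (b q) B = 0" using b(2) by simp
  qed
  then have "solvable J c (Suc i) p b" using i by (intro IH b) simp_all
  then obtain b2 where b2: "pch (Suc (Suc i)) p b2" "\<And>q B. q \<in> pdeg J \<Longrightarrow> bd (\<omega> c q) (b2 q) B = b q B"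
    unfolding solvable_def by blast
  define w where "w q A = b q A - bd (\<omega> c q) (b2 q) A" for q A
  have w: "pch (Suc i) (Suc p) w" unfolding w_def by (rule pch_diff[OF b(1) pch_bd[OF b2(1)]])
  have J1: "monom 1 J \<in> pdeg (Suc J)" by (rule monom_pdeg) simp
  have J2: "coeff (monom 1 J) J = (1::'k)" by simp
  have "w q A = 0" if "q \<in> pdeg (Suc J)" "coeff q J = 0" for q A
    using that b2(2)[of q A] pdeg_Suc_iff[of q J] by (simp add: w_def)
  then obtain b3 where b3: "pch (Suc i) p b3" "\<And>q A. q \<in> pdeg (Suc J) \<Longrightarrow> w q A = coeff q J * b3 q A"
    using pch_divide[OF lin_coeff J2 J1 w] by auto
  define y where "y q A = x q A - bd (\<omega> c q) (b3 q) A" for q A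
  have y: "pch i (Suc p) y" unfolding y_def by (rule pch_diff[OF x pch_bd[OF b3(1)]])
  have y0: "coeff q J * y q B = 0" if q: "q \<in> pdeg (Suc J)" for q B
  proof -
    have "w q = (\<lambda>A. coeff q J * b3 q A)" using b3(2)[OF q] by (rule HOL.ext)
    then have "coeff q J * bd (\<omega> c q) (b3 q) B = bd (\<omega> c q) (w q) B" by (simp add: bd_scale)
    also have "\<dots> = bd (\<omega> c q) (b q) B" unfolding w_def bd_diff by simp
    also have "\<dots> = coeff q J * x q B" using b(2)[OF q] .
    finally show ?thesis unfolding y_def right_diff_distrib by (simp only: diff_self)
  qed
  have "y q B = 0" if "q \<in> pdeg (Suc J)" for q B
    by (rule pch_cancel[OF lin_coeff J2 J1 y y0 that])
  then show ?thesis
    unfolding solvable_def using b3(1) by (intro exI[of _ b3]) (simp add: y_def)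
qed

lemma cyc_scale: "cyc J c x \<Longrightarrow> cyc J c (\<lambda>q A. l q * x q A)"
  unfolding cyc_def bd_scale by simp

text \<open>In polynomial degree above \<open>card V\<close> every cycle is, up to a boundary, a
  multiple of the product of all \<open>l v\<close>, and that product annihilates homology. The
  power \<open>card V\<close> of the top coefficient lifts x to such a degree, and injectivity
  brings the filling back.\<close>

lemma poly_chains_solvable:
  "i + J + zeros c \<le> m \<Longrightarrow> pch i (Suc p) x \<Longrightarrow> cyc J c x \<Longrightarrow> solvable J c i p x"
proof (induction J arbitrary: c i p x)
  case 0
  have "x q B = 0" if "q \<in> pdeg 0" for q B
    using hp_at_0[OF pch_hp[OF 0(2)]] pdeg_0[OF that] by simp
  then show ?case unfolding solvable_def by (intro exI[of _ "\<lambda>_ _. 0"]) (simp add: pch_zero)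
next
  case (Suc J)
  note IH = Suc.IH and i = Suc.prems(1)
  have i': "i + zeros c < m" using i by simp
  show ?case
  proof (cases "\<exists>v0\<in>V. c v0 \<noteq> 0")
    \<comment> \<open>If all weights are zero, the only boundary is 0, and exactness for c forces x
      = 0.\<close>
    case False
    then have z: "bd c u B = 0" for u :: "'a set \<Rightarrow> 'k" and B by (simp add: bd_def)
    have "x q B = 0" for q B
    proof -
      from exactE[OF exX[OF i'] pch_supp[OF Suc.prems(2)] z]
      obtain b where "supp b (lvl X (Suc i)) \<and> (\<forall>B. bd c b B = x q B)" ..
      then have "bd c b B = x q B" by simp
      then show ?thesis using z[of b B] by simp
    qed
    then show ?thesis unfolding solvable_def by (intro exI[of _ "\<lambda>_ _. 0"]) (simp add: pch_zero)
  next
    case True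
    then obtain v0 where v0: "v0 \<in> V" "c v0 \<noteq> 0" by blast
    \<comment> \<open>\<open>vertex_step\<close> asks for a nonzero weight, so a vertex of weight
      zero borrows the evaluation at \<open>v0\<close>; the identity
      \<open>c v * l v q = \<omega> c q v\<close> then reads 0 = 0.\<close>
    define \<tau> where "\<tau> v = (if c v = 0 then v0 else v)" for v
    define l where "l v q = poly q (\<alpha> (\<tau> v))" for v q
    have \<tau>: "\<tau> v \<in> V" "c (\<tau> v) \<noteq> 0" if "v \<in> V" for v using that v0 by (simp_all add: \<tau>_def)
    have l: "lin (l v)" for v using lin_poly unfolding l_def .
    have lc: "c v * l v q = \<omega> c q v" for v q by (simp add: l_def \<omega>_def \<tau>_def)
    have vanish: "solvable (Suc J) c i (card V + p) z"
      if z: "pch i (card V + Suc p) z" "cyc (Suc J) c z" for z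
    proof -
      have "\<exists>x' b. pch i p x' \<and> cyc (Suc J) c x' \<and> pch (Suc i) p b \<and>
        (\<forall>q\<in>pdeg (Suc J). \<forall>B. x q B = l v q * x' q B + bd (\<omega> c q) (b q) B)"
        if "v \<in> V" "pch i (Suc p) x" "cyc (Suc J) c x" for v p x
        unfolding l_def
      proof (rule vertex_step[where J=J])
        show "solvable J c i p x" if "i + J + zeros c \<le> m" "pch i (Suc p) x" "cyc J c x" for c i p x
          using that by (rule IH)
      qed (use i \<tau>[OF that(1)] that in simp_all)
      from vertices_step[where l=l, OF this l subset_refl z]
      have "\<exists>x' b. pch i (Suc p) x' \<and> cyc (Suc J) c x' \<and> pch (Suc i) (card V + p) b \<and>
        (\<forall>q\<in>pdeg (Suc J). \<forall>B. z q B = (\<Prod>v\<in>V. l v q) * x' q B + bd (\<omega> c q) (b q) B)"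
        unfolding add_Suc_right diff_Suc_1 .
      then obtain x' b where x': "pch i (Suc p) x'" "cyc (Suc J) c x'" and b: "pch (Suc i) (card V + p) b"
        and e: "\<forall>q\<in>pdeg (Suc J). \<forall>B. z q B = (\<Prod>v\<in>V. l v q) * x' q B + bd (\<omega> c q) (b q) B"
        by blast
      obtain b' where b': "pch (Suc i) (card V + p) b'"
        "\<forall>q\<in>pdeg (Suc J). \<forall>B. bd (\<omega> c q) (b' q) B = (\<Prod>v\<in>V. l v q) * x' q B"
        using product_kills[OF i' l lc x'] unfolding add_Suc_right diff_Suc_1 by blast
      show ?thesis
        unfolding solvable_def
        by (rule exI[of _ "\<lambda>q A. b' q A + b q A"]) (use pch_add[OF b'(1) b] b'(2) e in \<open>simp add: bd_add\<close>)
    qed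
    have pc: "pch i (k + Suc p) (\<lambda>q A. coeff q J ^ k * x q A)" for k
    proof (induction k)
      case (Suc k)
      have "pch i (Suc (k + Suc p)) (\<lambda>q A. coeff q J * (coeff q J ^ k * x q A))"
        by (rule pch_mult[OF lin_coeff Suc])
      then show ?case unfolding power_Suc mult.assoc add_Suc .
    next
      case 0
      show ?case using Suc.prems(2) by simp
    qed
    have descend: "solvable (Suc J) c i (k + p) (\<lambda>q A. coeff q J ^ k * x q A) \<Longrightarrow> solvable (Suc J) c i p x" for k
    proof (induction k)
      case (Suc k)
      have "solvable (Suc J) c i (k + p) (\<lambda>q A. coeff q J ^ k * x q A)"
      proof (rule coeff_injective[where J=J])
        show "solvable J c i p x" if "i + J + zeros c \<le> m" "pch i (Suc p) x" "cyc J c x" for c i p x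
          using that by (rule IH)
        show "i + Suc J + zeros c \<le> m" by (rule i)
        show "pch i (Suc (k + p)) (\<lambda>q A. coeff q J ^ k * x q A)" using pc[of k] unfolding add_Suc_right .
        show "solvable (Suc J) c i (Suc (k + p)) (\<lambda>q A. coeff q J * (coeff q J ^ k * x q A))"
          using Suc.prems unfolding power_Suc mult.assoc add_Suc .
      qed
      then show ?case by (rule Suc.IH)
    qed simp
    show ?thesis
    proof (rule descend)
      show "solvable (Suc J) c i (card V + p) (\<lambda>q A. coeff q J ^ card V * x q A)"
        by (rule vanish[OF pc[of "card V"]]) (rule cyc_scale[OF Suc.prems(3)])
    qed
  qed
qed

text \<open>The chain \<open>coeff q j * u\<close> is linear in q and a cycle for all weights of
  degree at most j. Its filling has degree 0, hence does not depend on q, and evaluation at the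
  monomials separates the operators again.\<close>

lemma iterated_exact:
  assumes i: "i + Suc j + zeros c \<le> m" and u: "supp u (lvl X i)"
    and cycu: "\<And>t B. t \<le> j \<Longrightarrow> bd (\<lambda>v. c v * \<alpha> v ^ t) u B = 0"
  shows "\<exists>b. supp b (lvl X (Suc i)) \<and> (\<forall>t B. t < j \<longrightarrow> bd (\<lambda>v. c v * \<alpha> v ^ t) b B = 0) \<and>
    (\<forall>B. bd (\<lambda>v. c v * \<alpha> v ^ j) b B = u B)"
proof -
  define x where "x q A = coeff q j * u A" for q A
  have "pch i (Suc 0) x"
  proof (rule pchI)
    show "hp (Suc 0) (\<lambda>q. x q A)" for A unfolding x_def by (rule hp_mult[OF lin_coeff hp_const])
  qed (simp add: x_def suppD[OF u])
  moreover have "cyc (Suc j) c x"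
    unfolding cyc_def
  proof (intro ballI allI)
    fix q :: "'k poly" and B assume q: "q \<in> pdeg (Suc j)"
    have "degree q \<le> j" using q by (auto simp: pdeg_degree)
    then have "poly q a = (\<Sum>t\<le>j. coeff q t * a ^ t)" for a :: 'k
      unfolding poly_altdef by (intro sum.mono_neutral_left) (auto simp: coeff_eq_0 not_le)
    then have "\<omega> c q = (\<lambda>v. \<Sum>t\<le>j. coeff q t * (c v * \<alpha> v ^ t))"
      by (simp add: fun_eq_iff \<omega>_def sum_distrib_left mult_ac)
    then have "bd (\<omega> c q) u B = (\<Sum>t\<le>j. coeff q t * bd (\<lambda>v. c v * \<alpha> v ^ t) u B)"
      by (simp add: bd_fun_sum bd_fun_scale)
    also have "\<dots> = 0" using cycu by simp
    finally show "bd (\<omega> c q) (x q) B = 0" unfolding x_def bd_scale by simp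
  qed
  ultimately have "solvable (Suc j) c i 0 x" using i by (intro poly_chains_solvable) simp_all
  then obtain b where b: "pch (Suc i) 0 b" "\<And>q B. q \<in> pdeg (Suc j) \<Longrightarrow> bd (\<omega> c q) (b q) B = x q B"
    unfolding solvable_def by blast
  have const: "b q = b 0" for q
    by (rule HOL.ext) (rule hp_0_const[OF pch_hp[OF b(1)] refl])
  have "bd (\<lambda>v. c v * \<alpha> v ^ t) (b 0) B = (if t = j then u B else 0)" if "t \<le> j" for t B
  proof -
    have m: "monom 1 t \<in> pdeg (Suc j)" using that by (intro monom_pdeg) simp
    moreover have "\<omega> c (monom 1 t) = (\<lambda>v. c v * \<alpha> v ^ t)" by (simp add: fun_eq_iff \<omega>_def poly_monom)
    ultimately show ?thesis using b(2)[OF m, of B] const[of "monom 1 t"] by (cases "t = j") (simp_all add: x_def)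
  qed
  then show ?thesis using pch_supp[OF b(1), of 0] by (intro exI[of _ "b 0"]) simp
qed

end

section \<open>Initial families\<close>

text \<open>The order in which the smallest element at which two sets differ decides, with the set containing it
  being the larger one, is encoded by binary expansion.\<close>

definition wt :: "nat \<Rightarrow> nat set \<Rightarrow> nat" where
  "wt n S = (\<Sum>i\<in>S. 2 ^ (n - 1 - i))"

lemma inj_on_reverse: "(S :: nat set) \<subseteq> {..<n} \<Longrightarrow> inj_on (\<lambda>i. n - 1 - i) S"
proof (rule inj_onI)
  fix x y assume *: "S \<subseteq> {..<n}" "x \<in> S" "y \<in> S" "n - 1 - x = n - 1 - y"
  then have "x < n" "y < n" by auto
  then show "x = y" using *(4) by linarith
qed

lemma wt_image:
  assumes "S \<subseteq> {..<n}"
  shows "wt n S = set_encode ((\<lambda>i. n - 1 - i) ` S)"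
proof -
  have "inj_on (\<lambda>i. n - 1 - i) S" using assms by (rule inj_on_reverse)
  then show ?thesis by (simp add: wt_def set_encode_def sum.reindex)
qed

lemma wt_eq_iff:
  assumes "S \<subseteq> {..<n}" "T \<subseteq> {..<n}"
  shows "wt n S = wt n T \<longleftrightarrow> S = T"
proof -
  have inj: "inj_on (\<lambda>i. n - 1 - i) {..<n}" by (rule inj_on_reverse) simp
  have "finite S" "finite T" using assms by (auto intro: finite_subset)
  then have "wt n S = wt n T \<longleftrightarrow> (\<lambda>i. n - 1 - i) ` S = (\<lambda>i. n - 1 - i) ` T"
    by (simp add: wt_image[OF assms(1)] wt_image[OF assms(2)] set_encode_eq)
  then show ?thesis using inj_on_image_eq_iff[OF inj assms] by simp
qed

lemma wt_insert: "finite S \<Longrightarrow> i \<notin> S \<Longrightarrow> wt n (insert i S) = 2 ^ (n - 1 - i) + wt n S"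
  by (simp add: wt_def)

lemma wt_Un: "finite S \<Longrightarrow> finite T \<Longrightarrow> S \<inter> T = {} \<Longrightarrow> wt n (S \<union> T) = wt n S + wt n T"
  by (simp add: wt_def sum.union_disjoint)

text \<open>The powers of two below \<open>2 ^ (n - 1 - j)\<close> sum to one less than it, so all
  elements beyond j together weigh less than j alone.\<close>

lemma wt_low:
  assumes "S \<subseteq> {..<n}" "\<And>s. s \<in> S \<Longrightarrow> j < s"
  shows "wt n S < 2 ^ (n - 1 - j)"
proof -
  have inj: "inj_on (\<lambda>i. n - 1 - i) S" using assms(1) by (rule inj_on_reverse)
  have "wt n S = (\<Sum>k\<in>(\<lambda>i. n - 1 - i) ` S. 2 ^ k)" using inj by (simp add: wt_def sum.reindex)
  also have "\<dots> \<le> (\<Sum>k\<in>{0..<n - 1 - j}. 2 ^ k)"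
  proof (rule sum_mono2)
    show "(\<lambda>i. n - 1 - i) ` S \<subseteq> {0..<n - 1 - j}"
    proof
      fix k assume "k \<in> (\<lambda>i. n - 1 - i) ` S"
      then obtain s where s: "s \<in> S" "k = n - 1 - s" by blast
      have "j < s" "s < n" using s(1) assms by auto
      then show "k \<in> {0..<n - 1 - j}" using s(2) by simp
    qed
  qed simp_all
  also have "\<dots> = 2 ^ (n - 1 - j) - 1" by (rule sum_power2)
  finally have "wt n S \<le> 2 ^ (n - 1 - j) - 1" .
  moreover have "(0::nat) < 2 ^ (n - 1 - j)" by simp
  ultimately show ?thesis by linarith
qed

lemma wt_high:
  assumes "finite T" "t \<in> T" "t \<le> j"
  shows "2 ^ (n - 1 - j) \<le> wt n T"
proof -
  have "(2::nat) ^ (n - 1 - j) \<le> 2 ^ (n - 1 - t)" using assms(3) by (intro power_increasing) simp_all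
  also have "\<dots> \<le> wt n T" unfolding wt_def using assms by (intro member_le_sum) simp_all
  finally show ?thesis .
qed

context ground
begin

text \<open>\<open>crd \<phi> S u\<close> pairs \<open>u\<close> with the exterior product of the linear forms \<open>\<phi> i\<close>, \<open>i \<in> S\<close>. If the forms
  are independent, these are the coordinates of \<open>u\<close> in the dual basis, and \<open>ini\<close> collects the leading index
  sets of the chains supported on a family.\<close>

primrec cf :: "(nat \<Rightarrow> 'a \<Rightarrow> 'k::field) \<Rightarrow> nat list \<Rightarrow> ('a set \<Rightarrow> 'k) \<Rightarrow> 'k" where
  "cf \<phi> [] u = u {}"
| "cf \<phi> (i # is) u = cf \<phi> is (bd (\<phi> i) u)"

definition crd :: "(nat \<Rightarrow> 'a \<Rightarrow> 'k::field) \<Rightarrow> nat set \<Rightarrow> ('a set \<Rightarrow> 'k) \<Rightarrow> 'k" where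
  "crd \<phi> S = cf \<phi> (sorted_list_of_set S)"

lemma cf_zero [simp]: "cf \<phi> xs (\<lambda>_. 0) = 0"
  by (induction xs) simp_all

lemma cf_scale: "cf \<phi> xs (\<lambda>A. c * u A) = c * cf \<phi> xs u"
proof (induction xs arbitrary: u)
  case (Cons x xs)
  have "bd (\<phi> x) (\<lambda>A. c * u A) = (\<lambda>A. c * bd (\<phi> x) u A)" by (rule HOL.ext) (rule bd_scale)
  then show ?case using Cons by simp
qed simp

lemma cf_add: "cf \<phi> xs (\<lambda>A. u A + w A) = cf \<phi> xs u + cf \<phi> xs w"
proof (induction xs arbitrary: u w)
  case (Cons x xs)
  have "bd (\<phi> x) (\<lambda>A. u A + w A) = (\<lambda>A. bd (\<phi> x) u A + bd (\<phi> x) w A)" by (rule HOL.ext) (rule bd_add)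
  then show ?case using Cons by simp
qed simp

lemma cf_sum: "cf \<phi> xs (\<lambda>A. \<Sum>i\<in>I. c i * w i A) = (\<Sum>i\<in>I. c i * cf \<phi> xs (w i))"
  by (induction I rule: infinite_finite_induct) (simp_all add: cf_add cf_scale)

lemma cf_expand: "finite X \<Longrightarrow> supp u X \<Longrightarrow> cf \<phi> xs u = (\<Sum>A\<in>X. u A * cf \<phi> xs (delta A))"
proof -
  assume "finite X" "supp u X"
  then have "u = (\<lambda>A. \<Sum>B\<in>X. u B * delta B A)" using expand_delta by blast
  then have "cf \<phi> xs u = cf \<phi> xs (\<lambda>A. \<Sum>B\<in>X. u B * delta B A)" by (rule arg_cong)
  then show ?thesis unfolding cf_sum .
qed

lemma cf_swap: "cf \<phi> (x # y # xs) u = - cf \<phi> (y # x # xs) u"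
proof -
  have "bd (\<phi> y) (bd (\<phi> x) u) = (\<lambda>B. -1 * bd (\<phi> x) (bd (\<phi> y) u) B)"
    by (rule HOL.ext, subst bd_anticomm) simp
  then have "cf \<phi> (x # y # xs) u = -1 * cf \<phi> xs (bd (\<phi> x) (bd (\<phi> y) u))"
    unfolding cf.simps by (simp only: cf_scale)
  then show ?thesis by simp
qed

lemma cf_member: "x \<in> set xs \<Longrightarrow> cf \<phi> (x # xs) u = 0"
proof (induction xs arbitrary: u)
  case (Cons y ys)
  show ?case
  proof (cases "x = y")
    case False
    then have "cf \<phi> (x # ys) (bd (\<phi> y) u) = 0" using Cons by simp
    then show ?thesis using cf_swap[of \<phi> x y ys u] by simp
  qed simp
qed simp

text \<open>Sorting costs a sign, which is kept as an unspecified nonzero factor since only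
  vanishing of coordinates will matter.\<close>

lemma cf_insort: "\<exists>\<epsilon>. \<epsilon> \<noteq> 0 \<and> (\<forall>u. cf \<phi> (x # xs) u = \<epsilon> * cf \<phi> (insort x xs) u)"
proof (induction xs)
  case (Cons y ys)
  show ?case
  proof (cases "x \<le> y")
    case False
    obtain \<epsilon> where \<epsilon>: "\<epsilon> \<noteq> 0" "\<And>u. cf \<phi> (x # ys) u = \<epsilon> * cf \<phi> (insort x ys) u" using Cons by blast
    have "cf \<phi> (x # y # ys) u = - \<epsilon> * cf \<phi> (insort x (y # ys)) u" for u
      using \<epsilon>(2)[of "bd (\<phi> y) u"] False unfolding cf_swap[of \<phi> x y] by simp
    then show ?thesis using \<epsilon>(1) by (intro exI[of _ "- \<epsilon>"]) simp
  qed (intro exI[of _ 1], simp)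
qed (intro exI[of _ 1], simp)

lemma crd_empty: "crd \<phi> {} u = u {}"
  by (simp add: crd_def)

lemma crd_bd_member: "finite T \<Longrightarrow> t \<in> T \<Longrightarrow> crd \<phi> T (bd (\<phi> t) u) = 0"
  using cf_member[of t "sorted_list_of_set T" \<phi> u] by (simp add: crd_def)

lemma crd_bd:
  assumes "finite T" "t \<notin> T"
  shows "\<exists>\<epsilon>. \<epsilon> \<noteq> 0 \<and> crd \<phi> T (bd (\<phi> t) u) = \<epsilon> * crd \<phi> (insert t T) u"
proof -
  obtain \<epsilon> where "\<epsilon> \<noteq> 0" "cf \<phi> (t # sorted_list_of_set T) u = \<epsilon> * cf \<phi> (insort t (sorted_list_of_set T)) u"
    using cf_insort by blast
  then show ?thesis using assms by (intro exI[of _ \<epsilon>]) (simp add: crd_def)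
qed

lemma crd_bd_eq_0: "finite T \<Longrightarrow> (t \<notin> T \<Longrightarrow> crd \<phi> (insert t T) u = 0) \<Longrightarrow> crd \<phi> T (bd (\<phi> t) u) = 0"
proof (cases "t \<in> T")
  case False
  assume *: "finite T" "t \<notin> T \<Longrightarrow> crd \<phi> (insert t T) u = 0"
  obtain \<epsilon> where "crd \<phi> T (bd (\<phi> t) u) = \<epsilon> * crd \<phi> (insert t T) u"
    using crd_bd[OF *(1) False, of \<phi> u] by blast
  then show ?thesis using *(2)[OF False] by simp
qed (simp add: crd_bd_member)

lemma crd_eq_0_of_bd: "finite T \<Longrightarrow> t \<in> T \<Longrightarrow> crd \<phi> (T - {t}) (bd (\<phi> t) u) = 0 \<Longrightarrow> crd \<phi> T u = 0"
  using crd_bd[of "T - {t}" t \<phi> u] by (auto simp: insert_absorb)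

lemma crd_insert_min:
  assumes "finite T" "\<And>s. s \<in> T \<Longrightarrow> t < s"
  shows "crd \<phi> (insert t T) u = crd \<phi> T (bd (\<phi> t) u)"
proof -
  have "t \<notin> T" using assms(2) by blast
  moreover have "insort t (sorted_list_of_set T) = t # sorted_list_of_set T"
    using assms by (intro insort_is_Cons) (auto intro: less_imp_le)
  ultimately show ?thesis using assms(1) by (simp add: crd_def)
qed

lemma cpx_Pow: "cpx (Pow V)"
  by (auto simp: cpx_def)

lemma cf_degree: "supp u (lvl (Pow V) i) \<Longrightarrow> length xs \<noteq> i \<Longrightarrow> cf \<phi> xs u = 0"
proof (induction xs arbitrary: u i)
  case Nil
  then show ?case by (auto simp: supp_def lvl_def)
next
  case (Cons x xs)
  show ?case
  proof (cases i)
    case 0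
    then have "bd (\<phi> x) u = (\<lambda>_. 0)" using Cons.prems(1) by (intro bd_level_0[OF cpx_Pow]) simp
    then show ?thesis by simp
  next
    case (Suc j)
    then have "supp (bd (\<phi> x) u) (lvl (Pow V) j)" using supp_bd[OF cpx_Pow Cons.prems(1)] by simp
    then show ?thesis using Cons.IH[of "bd (\<phi> x) u" j] Cons.prems(2) Suc by simp
  qed
qed

lemma crd_degree: "supp u (lvl (Pow V) i) \<Longrightarrow> finite S \<Longrightarrow> card S \<noteq> i \<Longrightarrow> crd \<phi> S u = 0"
  unfolding crd_def by (rule cf_degree) simp_all

section \<open>Grading involution and exterior products of chains\<close>

definition bar :: "('a set \<Rightarrow> 'k::field) \<Rightarrow> 'a set \<Rightarrow> 'k" where
  "bar u A = (-1) ^ card A * u A"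

lemma bar_bar [simp]: "bar (bar u) = u"
  by (rule HOL.ext) (simp add: bar_def flip: mult.assoc power_add mult_2)

lemma bd_bar: "bd f (bar u) = (\<lambda>B. - bar (bd f u) B)"
proof
  fix B
  show "bd f (bar u) B = - bar (bd f u) B"
  proof (cases "B \<subseteq> V")
    case True
    have "osign v B * f v * bar u (insert v B) = - ((-1) ^ card B * (osign v B * f v * u (insert v B)))"
      if "v \<in> V - B" for v
      using that finite_sub[OF True] by (simp add: bar_def)
    then have "bd f (bar u) B = (\<Sum>v\<in>V - B. - ((-1) ^ card B * (osign v B * f v * u (insert v B))))"
      using True by (simp add: bd_def)
    also have "\<dots> = - bar (bd f u) B"
      using True by (simp add: bar_def bd_def sum_negf sum_distrib_left)
    finally show ?thesis .
  qed (simp add: bd_def bar_def)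
qed

lemma bar_vmul: "bar (vmul v u) = (\<lambda>A. - vmul v (bar u) A)"
proof
  fix A
  show "bar (vmul v u) A = - vmul v (bar u) A"
  proof (cases "v \<in> A \<and> A \<subseteq> V")
    case True
    have "(-1) ^ card A = - ((-1) ^ card (A - {v}) :: 'b)"
      using True by (subst card.remove[OF finite_sub, of A v]) simp_all
    then show ?thesis using True by (simp only: bar_def vmul_def) simp
  qed (auto simp: bar_def vmul_def)
qed

lemma cf_bar: "cf \<phi> xs (bar u) = (-1) ^ length xs * cf \<phi> xs u"
proof (induction xs arbitrary: u)
  case (Cons x xs)
  have 1: "bd (\<phi> x) (bar u) = (\<lambda>B. -1 * bar (bd (\<phi> x) u) B)" unfolding bd_bar by simp
  have "cf \<phi> (x # xs) (bar u) = -1 * cf \<phi> xs (bar (bd (\<phi> x) u))"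
    unfolding cf.simps 1 cf_scale ..
  then show ?case unfolding Cons by simp
qed (simp add: bar_def)

lemma supp_bar: "supp u X \<Longrightarrow> supp (bar u) X"
  by (auto simp: supp_def bar_def)

lemma supp_bd_Pow: "supp (bd f u) (Pow V)"
  by (rule suppI) (auto simp: bd_def)

lemma bd_vmul_fun:
  assumes "v \<in> V" "supp u (Pow V)"
  shows "bd f (vmul v u) = (\<lambda>B. f v * u B - vmul v (bd f u) B)"
proof
  fix B
  show "bd f (vmul v u) B = f v * u B - vmul v (bd f u) B"
  proof (cases "B \<subseteq> V")
    case True
    then show ?thesis using bd_vmul[OF assms(1) True, of f u] by (simp add: eq_diff_eq)
  next
    case False
    then show ?thesis using suppD[OF assms(2)] by (simp add: bd_def vmul_def)
  qed
qed

text \<open>\<open>pr\<close> is the coordinate of the exterior product of two chains; it is computed from the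
  Leibniz rule, which avoids constructing the product itself.\<close>

primrec pr :: "(nat \<Rightarrow> 'a \<Rightarrow> 'k::field) \<Rightarrow> nat list \<Rightarrow> ('a set \<Rightarrow> 'k) \<Rightarrow> ('a set \<Rightarrow> 'k) \<Rightarrow> 'k" where
  "pr \<phi> [] u w = u {} * w {}"
| "pr \<phi> (i # is) u w = pr \<phi> is (bd (\<phi> i) u) w + pr \<phi> is (bar u) (bd (\<phi> i) w)"

lemma pr_lin_left: "pr \<phi> xs (\<lambda>A. a * u A + b * u' A) w = a * pr \<phi> xs u w + b * pr \<phi> xs u' w"
proof (induction xs arbitrary: u u' w)
  case (Cons x xs)
  have 1: "bd (\<phi> x) (\<lambda>A. a * u A + b * u' A) = (\<lambda>A. a * bd (\<phi> x) u A + b * bd (\<phi> x) u' A)"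
    by (rule HOL.ext) (simp only: bd_add bd_scale)
  have 2: "bar (\<lambda>A. a * u A + b * u' A) = (\<lambda>A. a * bar u A + b * bar u' A)"
    by (rule HOL.ext) (simp add: bar_def algebra_simps)
  show ?case unfolding pr.simps 1 2 Cons by (simp add: algebra_simps)
qed (simp add: algebra_simps)

lemma pr_lin_right: "pr \<phi> xs u (\<lambda>A. a * w A + b * w' A) = a * pr \<phi> xs u w + b * pr \<phi> xs u w'"
proof (induction xs arbitrary: u w w')
  case (Cons x xs)
  have 1: "bd (\<phi> x) (\<lambda>A. a * w A + b * w' A) = (\<lambda>A. a * bd (\<phi> x) w A + b * bd (\<phi> x) w' A)"
    by (rule HOL.ext) (simp only: bd_add bd_scale)
  show ?case unfolding pr.simps 1 Cons by (simp add: algebra_simps)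
qed (simp add: algebra_simps)

lemma pr_zero_left: "pr \<phi> xs (\<lambda>_. 0) w = 0"
  using pr_lin_left[of \<phi> xs 0 "\<lambda>_. 0" 0 "\<lambda>_. 0" w] by simp

lemma pr_zero_right: "pr \<phi> xs u (\<lambda>_. 0) = 0"
  using pr_lin_right[of \<phi> xs u 0 "\<lambda>_. 0" 0 "\<lambda>_. 0"] by simp

lemma pr_uminus_left: "pr \<phi> xs (\<lambda>A. - u A) w = - pr \<phi> xs u w"
  using pr_lin_left[of \<phi> xs "-1" u 0 "\<lambda>_. 0" w] by simp

lemma pr_sum_left: "pr \<phi> xs (\<lambda>A. \<Sum>i\<in>I. c i * x i A) w = (\<Sum>i\<in>I. c i * pr \<phi> xs (x i) w)"
proof (induction I rule: infinite_finite_induct)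
  case (insert i I)
  then show ?case using pr_lin_left[of \<phi> xs "c i" "x i" 1 "\<lambda>A. \<Sum>i\<in>I. c i * x i A" w] by simp
qed (simp_all add: pr_zero_left)

lemma pr_sum_right: "pr \<phi> xs w (\<lambda>A. \<Sum>i\<in>I. c i * x i A) = (\<Sum>i\<in>I. c i * pr \<phi> xs w (x i))"
proof (induction I rule: infinite_finite_induct)
  case (insert i I)
  then show ?case using pr_lin_right[of \<phi> xs w "c i" "x i" 1 "\<lambda>A. \<Sum>i\<in>I. c i * x i A"] by simp
qed (simp_all add: pr_zero_right)

text \<open>A basis vector moves across the product, passing u at the cost of the grading involution
  \<open>bar\<close>. The induction runs along the contracting forms and uses only the Leibniz
  rule.\<close>

lemma pr_vmul:
  assumes v: "v \<in> V"
  shows "supp u (Pow V) \<Longrightarrow> supp w (Pow V) \<Longrightarrow> pr \<phi> xs u (vmul v w) = pr \<phi> xs (vmul v (bar u)) w"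
proof (induction xs arbitrary: u w)
  case (Cons x xs)
  note u = Cons.prems(1) and w = Cons.prems(2)
  have a: "bd (\<phi> x) (vmul v w) = (\<lambda>B. \<phi> x v * w B + (-1) * vmul v (bd (\<phi> x) w) B)"
    unfolding bd_vmul_fun[OF v w] by simp
  have b: "bd (\<phi> x) (vmul v (bar u)) = (\<lambda>B. \<phi> x v * bar u B + 1 * vmul v (bar (bd (\<phi> x) u)) B)"
    unfolding bd_vmul_fun[OF v supp_bar[OF u]] bd_bar by (simp add: vmul_def fun_eq_iff)
  have c: "bar (vmul v (bar u)) = (\<lambda>A. - vmul v u A)"
    unfolding bar_vmul by simp
  have 1: "pr \<phi> xs (bd (\<phi> x) u) (vmul v w) = pr \<phi> xs (vmul v (bar (bd (\<phi> x) u))) w"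
    by (rule Cons.IH[OF supp_bd_Pow w])
  have 2: "pr \<phi> xs (bar u) (vmul v (bd (\<phi> x) w)) = pr \<phi> xs (vmul v u) (bd (\<phi> x) w)"
    using Cons.IH[OF supp_bar[OF u] supp_bd_Pow] by simp
  show ?case
    unfolding pr.simps a b c pr_lin_left pr_lin_right pr_uminus_left 1 2 by simp
qed (simp add: vmul_def)

lemma vmul_vmul: "vmul v (vmul v u) = (\<lambda>_. 0)"
  by (rule HOL.ext) (simp add: vmul_def)

lemma supp_vmul_Pow: "supp (vmul v u) (Pow V)"
  by (rule suppI) (simp add: vmul_def)

text \<open>Moving the second copy of v next to the first produces the square of a basis
  vector.\<close>

lemma pr_common:
  assumes "v \<in> V" "supp u (Pow V)" "supp w (Pow V)"
  shows "pr \<phi> xs (vmul v u) (vmul v w) = 0"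
proof -
  have "vmul v (bar (vmul v u)) = (\<lambda>_. 0)"
  proof -
    have "vmul v (\<lambda>A. - vmul v (bar u) A) = (\<lambda>A. - vmul v (vmul v (bar u)) A)"
      by (rule HOL.ext) (simp add: vmul_def)
    then show ?thesis unfolding bar_vmul vmul_vmul by simp
  qed
  then show ?thesis
    using pr_vmul[OF assms(1) supp_vmul_Pow assms(3), of \<phi> xs v u] by (simp add: pr_zero_left)
qed

text \<open>The summand \<open>0 * 0\<close> stands for \<open>b * u' A\<close> with b and u' zero;
  it gives the right-hand side the shape that \<open>pr_lin_left\<close> and
  \<open>pr_lin_right\<close> rewrite.\<close>

lemma delta_vmul:
  assumes "v \<in> A" "A \<subseteq> V"
  shows "delta A = (\<lambda>C. osign v A * vmul v (delta (A - {v})) C + 0 * 0)"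
proof
  fix C
  show "delta A C = osign v A * vmul v (delta (A - {v})) C + 0 * 0"
  proof (cases "C = A")
    case True
    then show ?thesis using assms by (simp add: vmul_def delta_def)
  next
    case False
    have "v \<in> C \<Longrightarrow> C - {v} \<noteq> A - {v}" using False assms(1) by blast
    then show ?thesis using False by (simp add: vmul_def delta_def)
  qed
qed

lemma pr_delta:
  fixes \<phi> :: "nat \<Rightarrow> 'a \<Rightarrow> 'k::field"
  assumes "A \<subseteq> V" "B \<subseteq> V" "A \<inter> B \<noteq> {}"
  shows "pr \<phi> xs (delta A) (delta B) = 0"
proof -
  obtain v where v: "v \<in> A" "v \<in> B" using assms(3) by blast
  have s: "supp (delta (D - {v}) :: 'a set \<Rightarrow> 'k) (Pow V)" if "D \<subseteq> V" for D
    using that by (intro supp_delta) blast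
  show ?thesis
    unfolding delta_vmul[OF v(1) assms(1)] delta_vmul[OF v(2) assms(2)] pr_lin_left pr_lin_right
    using pr_common[OF _ s[OF assms(1)] s[OF assms(2)]] v assms by (simp add: subset_iff)
qed

lemma pr_cross:
  assumes "\<And>A B. A \<in> XX \<Longrightarrow> B \<in> YY \<Longrightarrow> A \<inter> B \<noteq> {}" "XX \<subseteq> Pow V" "YY \<subseteq> Pow V" "supp u XX" "supp w YY"
  shows "pr \<phi> xs u w = 0"
proof -
  have f: "finite XX" "finite YY" using assms(2,3) by (auto intro: finite_subset[of _ "Pow V"])
  have u: "u = (\<lambda>A. \<Sum>B\<in>XX. u B * delta B A)" using expand_delta[OF f(1) assms(4)] by (rule HOL.ext)
  have w: "w = (\<lambda>A. \<Sum>B\<in>YY. w B * delta B A)" using expand_delta[OF f(2) assms(5)] by (rule HOL.ext)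
  have "pr \<phi> xs u w = (\<Sum>A\<in>XX. u A * (\<Sum>B\<in>YY. w B * pr \<phi> xs (delta A) (delta B)))"
    by (subst u, subst w, unfold pr_sum_left pr_sum_right) (rule refl)
  also have "\<dots> = 0"
  proof (intro sum.neutral ballI)
    fix A assume A: "A \<in> XX"
    have "(\<Sum>B\<in>YY. w B * pr \<phi> xs (delta A) (delta B)) = 0"
    proof (intro sum.neutral ballI)
      fix B assume "B \<in> YY"
      then show "w B * pr \<phi> xs (delta A) (delta B) = 0"
        using pr_delta[of A B \<phi> xs] assms(1)[OF A, of B] A assms(2,3) by (simp add: subset_iff)
    qed
    then show "u A * (\<Sum>B\<in>YY. w B * pr \<phi> xs (delta A) (delta B)) = 0" by simp
  qed
  finally show ?thesis .
qed

text \<open>Laplace expansion: every contracting form hits one of the two factors, and S records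
  those hitting the left one. Of the signs only nonvanishing is kept.\<close>

lemma pr_laplace:
  "distinct xs \<Longrightarrow> \<exists>\<epsilon>. (\<forall>S. \<epsilon> S \<noteq> 0) \<and> (\<forall>u w. pr \<phi> xs u w =
    (\<Sum>S\<in>Pow (set xs). \<epsilon> S * cf \<phi> (filter (\<lambda>i. i \<in> S) xs) u * cf \<phi> (filter (\<lambda>i. i \<notin> S) xs) w))"
proof (induction xs)
  case Nil
  show ?case by (intro exI[of _ "\<lambda>_. 1"]) simp
next
  case (Cons x xs)
  then obtain \<epsilon> where \<epsilon>: "\<And>S. \<epsilon> S \<noteq> 0" "\<And>u w. pr \<phi> xs u w =
    (\<Sum>S\<in>Pow (set xs). \<epsilon> S * cf \<phi> (filter (\<lambda>i. i \<in> S) xs) u * cf \<phi> (filter (\<lambda>i. i \<notin> S) xs) w)"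
    by auto
  have x: "x \<notin> set xs" using Cons.prems by simp
  define \<epsilon>' where "\<epsilon>' S = (if x \<in> S then \<epsilon> (S - {x}) else \<epsilon> S * (-1) ^ length (filter (\<lambda>i. i \<in> S) xs))" for S
  have "pr \<phi> (x # xs) u w = (\<Sum>S\<in>Pow (set (x # xs)). \<epsilon>' S * cf \<phi> (filter (\<lambda>i. i \<in> S) (x # xs)) u
      * cf \<phi> (filter (\<lambda>i. i \<notin> S) (x # xs)) w)" for u w
  proof -
    define F where "F S = \<epsilon>' S * cf \<phi> (filter (\<lambda>i. i \<in> S) (x # xs)) u * cf \<phi> (filter (\<lambda>i. i \<notin> S) (x # xs)) w" for S
    have inj: "inj_on (insert x) (Pow (set xs))"
    proof (rule inj_onI)
      fix S T assume "S \<in> Pow (set xs)" "T \<in> Pow (set xs)" "insert x S = insert x T"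
      moreover from this x have "x \<notin> S" "x \<notin> T" by blast+
      ultimately show "S = T" by (simp add: insert_ident)
    qed
    have "(\<Sum>S\<in>Pow (set (x # xs)). F S) = (\<Sum>S\<in>Pow (set xs). F S) + (\<Sum>S\<in>insert x ` Pow (set xs). F S)"
      unfolding list.set(2) Pow_insert using x by (intro sum.union_disjoint) auto
    also have "(\<Sum>S\<in>insert x ` Pow (set xs). F S) = (\<Sum>S\<in>Pow (set xs). F (insert x S))"
      by (rule sum.reindex_cong[OF inj]) simp_all
    also have "(\<Sum>S\<in>Pow (set xs). F (insert x S)) = pr \<phi> xs (bd (\<phi> x) u) w"
      unfolding \<epsilon>(2)
    proof (rule sum.cong[OF refl])
      fix S assume S: "S \<in> Pow (set xs)"
      have "filter (\<lambda>i. i \<in> insert x S) xs = filter (\<lambda>i. i \<in> S) xs" "filter (\<lambda>i. i \<notin> insert x S) xs = filter (\<lambda>i. i \<notin> S) xs"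
        using x by (auto intro!: filter_cong)
      moreover have "insert x S - {x} = S" using S x by blast
      ultimately show "F (insert x S) = \<epsilon> S * cf \<phi> (filter (\<lambda>i. i \<in> S) xs) (bd (\<phi> x) u) * cf \<phi> (filter (\<lambda>i. i \<notin> S) xs) w"
        by (simp add: F_def \<epsilon>'_def)
    qed
    also have "(\<Sum>S\<in>Pow (set xs). F S) = pr \<phi> xs (bar u) (bd (\<phi> x) w)"
      unfolding \<epsilon>(2)
    proof (rule sum.cong[OF refl])
      fix S assume S: "S \<in> Pow (set xs)"
      have "x \<notin> S" using S x by blast
      then show "F S = \<epsilon> S * cf \<phi> (filter (\<lambda>i. i \<in> S) xs) (bar u) * cf \<phi> (filter (\<lambda>i. i \<notin> S) xs) (bd (\<phi> x) w)"
        by (simp add: F_def \<epsilon>'_def cf_bar)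
    qed
    finally show ?thesis by (simp add: F_def add.commute)
  qed
  moreover have "\<epsilon>' S \<noteq> 0" for S using \<epsilon>(1) by (simp add: \<epsilon>'_def)
  ultimately show ?case by blast
qed

definition ini :: "nat \<Rightarrow> (nat \<Rightarrow> 'a \<Rightarrow> 'k::field) \<Rightarrow> 'a set set \<Rightarrow> nat set set" where
  "ini n \<phi> XX = {S. S \<subseteq> {..<n} \<and> (\<exists>u. supp u XX \<and> crd \<phi> S u \<noteq> 0 \<and>
     (\<forall>T\<subseteq>{..<n}. wt n S < wt n T \<longrightarrow> crd \<phi> T u = 0))}"

lemma iniI: "S \<subseteq> {..<n} \<Longrightarrow> supp u XX \<Longrightarrow> crd \<phi> S u \<noteq> 0 \<Longrightarrow>
    (\<And>T. T \<subseteq> {..<n} \<Longrightarrow> wt n S < wt n T \<Longrightarrow> crd \<phi> T u = 0) \<Longrightarrow> S \<in> ini n \<phi> XX"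
  unfolding ini_def by blast

lemma iniE:
  assumes "S \<in> ini n \<phi> XX"
  obtains u where "S \<subseteq> {..<n}" "supp u XX" "crd \<phi> S u \<noteq> 0"
    "\<And>T. T \<subseteq> {..<n} \<Longrightarrow> wt n S < wt n T \<Longrightarrow> crd \<phi> T u = 0"
  using assms unfolding ini_def by blast

lemma ini_mono: "XX \<subseteq> YY \<Longrightarrow> ini n \<phi> XX \<subseteq> ini n \<phi> YY"
  unfolding ini_def by (auto intro: supp_mono)

lemma ini_sub: "S \<in> ini n \<phi> XX \<Longrightarrow> S \<subseteq> {..<n}"
  by (simp add: ini_def)

lemma ini_fin: "S \<in> ini n \<phi> XX \<Longrightarrow> finite S"
  using finite_subset[OF ini_sub] by simp

lemma finite_ini: "finite (ini n \<phi> XX)"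
  by (rule finite_subset[of _ "Pow {..<n}"]) (auto simp: ini_def)

lemma ini_card:
  assumes "XX \<subseteq> lvl (Pow V) i" "S \<in> ini n \<phi> XX"
  shows "card S = i"
proof (rule ccontr)
  assume *: "card S \<noteq> i"
  obtain u where u: "supp u XX" "crd \<phi> S u \<noteq> 0" using iniE[OF assms(2)] by blast
  have "crd \<phi> S u = 0" by (rule crd_degree[OF supp_mono[OF u(1) assms(1)] ini_fin[OF assms(2)] *])
  with u(2) show False ..
qed

text \<open>Chains on the two families have product zero, as members share vertices. If S and T were
  disjoint, the product of their leading chains would have a single nonzero term at the union:
  weights add up, so any other splitting has a part heavier than S or T, whose coordinate
  vanishes.\<close>

lemma ini_cross:
  assumes "\<And>A B. A \<in> XX \<Longrightarrow> B \<in> YY \<Longrightarrow> A \<inter> B \<noteq> {}" "XX \<subseteq> Pow V" "YY \<subseteq> Pow V"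
    and S: "S \<in> ini n \<phi> XX" and T: "T \<in> ini n \<phi> YY"
  shows "S \<inter> T \<noteq> {}"
proof
  assume dis: "S \<inter> T = {}"
  obtain u where u: "S \<subseteq> {..<n}" "supp u XX" "crd \<phi> S u \<noteq> 0"
    "\<And>S'. S' \<subseteq> {..<n} \<Longrightarrow> wt n S < wt n S' \<Longrightarrow> crd \<phi> S' u = 0" using iniE[OF S] by blast
  obtain w where w: "T \<subseteq> {..<n}" "supp w YY" "crd \<phi> T w \<noteq> 0"
    "\<And>S'. S' \<subseteq> {..<n} \<Longrightarrow> wt n T < wt n S' \<Longrightarrow> crd \<phi> S' w = 0" using iniE[OF T] by blast
  define R where "R = S \<union> T"
  define xs where "xs = sorted_list_of_set R"
  have fin: "finite S" "finite T" "finite R" using u(1) w(1) finite_subset[of _ "{..<n}"] by (simp_all add: R_def)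
  have xs: "distinct xs" "set xs = R" using fin by (simp_all add: xs_def)
  have fil: "filter P xs = sorted_list_of_set {i\<in>R. P i}" for P
  proof (rule sorted_distinct_set_unique)
    show "sorted (filter P xs)" unfolding xs_def by (rule sorted_wrt_filter) simp
  qed (use fin in \<open>simp_all add: xs_def\<close>)
  obtain \<epsilon> where \<epsilon>: "\<And>S. \<epsilon> S \<noteq> 0" "pr \<phi> xs u w =
    (\<Sum>S\<in>Pow (set xs). \<epsilon> S * cf \<phi> (filter (\<lambda>i. i \<in> S) xs) u * cf \<phi> (filter (\<lambda>i. i \<notin> S) xs) w)"
    using pr_laplace[OF xs(1), of \<phi>] by blast
  define F where "F S' = \<epsilon> S' * crd \<phi> S' u * crd \<phi> (R - S') w" for S'
  have "pr \<phi> xs u w = (\<Sum>S'\<in>Pow R. F S')"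
    unfolding \<epsilon>(2) xs(2)
  proof (rule sum.cong[OF refl])
    fix S' assume "S' \<in> Pow R"
    then have "{i\<in>R. i \<in> S'} = S'" "{i\<in>R. i \<notin> S'} = R - S'" by blast+
    then show "\<epsilon> S' * cf \<phi> (filter (\<lambda>i. i \<in> S') xs) u * cf \<phi> (filter (\<lambda>i. i \<notin> S') xs) w = F S'"
      unfolding fil by (simp add: F_def crd_def)
  qed
  also have "\<dots> = (\<Sum>S'\<in>{S}. F S')"
  proof (rule sum.mono_neutral_right)
    show "\<forall>S'\<in>Pow R - {S}. F S' = 0"
    proof
      fix S' assume S': "S' \<in> Pow R - {S}"
      then have f: "finite S'" "S' \<subseteq> {..<n}" "R - S' \<subseteq> {..<n}" "finite (R - S')"
        using u(1) w(1) fin finite_subset[of S' R] by (auto simp: R_def)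
      have "S' \<union> (R - S') = R" using S' by blast
      then have "wt n S' + wt n (R - S') = wt n S + wt n T"
        using wt_Un[OF f(1,4), of n] wt_Un[OF fin(1,2) dis, of n] by (simp add: R_def)
      moreover have "wt n S' \<noteq> wt n S" using wt_eq_iff[OF f(2) u(1)] S' by simp
      ultimately have "wt n S < wt n S' \<or> wt n T < wt n (R - S')" by linarith
      then show "F S' = 0" using u(4)[OF f(2)] w(4)[OF f(3)] by (auto simp: F_def)
    qed
  qed (use fin in \<open>auto simp: R_def\<close>)
  also have "\<dots> = \<epsilon> S * crd \<phi> S u * crd \<phi> T w"
  proof -
    have "R - S = T" using dis by (auto simp: R_def)
    then show ?thesis by (simp add: F_def)
  qed
  finally have "pr \<phi> xs u w \<noteq> 0" using \<epsilon>(1) u(3) w(3) by simp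
  then show False using pr_cross[OF assms(1-3) u(2) w(2)] by simp
qed

section \<open>Removing and inserting a least index\<close>

lemma supp_lvl_Pow: "cpx X \<Longrightarrow> supp u (lvl X i) \<Longrightarrow> supp u (lvl (Pow V) i)"
  by (rule supp_mono) (auto simp: lvl_def cpx_def)

text \<open>A leading chain of S contracted by form j leads at \<open>S - {j}\<close>: adding j to
  sets without it raises all weights by the same power of two and so keeps their order.\<close>

lemma ini_remove_min:
  assumes X: "cpx X" and S: "S \<in> ini n \<phi> (lvl X (Suc i))" and j: "j \<in> S" "\<And>s. s \<in> S \<Longrightarrow> j \<le> s"
  shows "S - {j} \<in> ini n \<phi> (lvl X i)"
proof -
  obtain u where u: "S \<subseteq> {..<n}" "supp u (lvl X (Suc i))" "crd \<phi> S u \<noteq> 0"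
    "\<And>T. T \<subseteq> {..<n} \<Longrightarrow> wt n S < wt n T \<Longrightarrow> crd \<phi> T u = 0" using iniE[OF S] by blast
  have fin: "finite (S - {j})" using u(1) finite_subset[of S "{..<n}"] by simp
  have Sj: "insert j (S - {j}) = S" using j(1) by blast
  show ?thesis
  proof (rule iniI)
    show "S - {j} \<subseteq> {..<n}" using u(1) by blast
    show "supp (bd (\<phi> j) u) (lvl X i)" using supp_bd[OF X u(2)] by simp
    have "j < s" if "s \<in> S - {j}" for s using j(2)[of s] that by auto
    then show "crd \<phi> (S - {j}) (bd (\<phi> j) u) \<noteq> 0"
      using crd_insert_min[OF fin, of j \<phi> u] u(3) Sj by simp
  next
    fix T assume T: "T \<subseteq> {..<n}" "wt n (S - {j}) < wt n T"
    then have finT: "finite T" using finite_subset[of T "{..<n}"] by simp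
    show "crd \<phi> T (bd (\<phi> j) u) = 0"
    proof (rule crd_bd_eq_0[OF finT])
      assume "j \<notin> T"
      then have "wt n S < wt n (insert j T)"
        using T(2) wt_insert[OF finT, of j n] wt_insert[OF fin, of j n] Sj by simp
      then show "crd \<phi> (insert j T) u = 0" using T(1) u(1) j(1) by (intro u(4)) auto
    qed
  qed
qed

text \<open>The first \<open>n\<close> forms span all linear forms on \<open>V\<close>.\<close>

definition separating :: "nat \<Rightarrow> (nat \<Rightarrow> 'a \<Rightarrow> 'k::field) \<Rightarrow> bool" where
  "separating n \<phi> \<longleftrightarrow> (\<forall>v\<in>V. \<exists>c. \<forall>x\<in>V. delta v x = (\<Sum>l<n. c l * \<phi> l x))"

text \<open>By induction all contractions by the forms vanish. The forms span the
  \<open>delta v\<close>, and contraction by \<open>delta v\<close> reads off the coefficients at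
  the faces through v.\<close>

lemma crd_injective:
  assumes sep: "separating n \<phi>"
  shows "supp u (lvl (Pow V) i) \<Longrightarrow> (\<And>T. T \<subseteq> {..<n} \<Longrightarrow> crd \<phi> T u = 0) \<Longrightarrow> u A = 0"
proof (induction i arbitrary: u A)
  case 0
  show ?case
  proof (cases "A = {}")
    case True
    then show ?thesis using 0(2)[of "{}"] by (simp add: crd_empty)
  next
    case False
    then have "A \<notin> lvl (Pow V) 0" using finite_sub by (auto simp: lvl_def)
    then show ?thesis by (rule suppD[OF 0(1)])
  qed
next
  case (Suc i)
  have bd0: "bd (\<phi> l) u B = 0" if "l < n" for l B
  proof (rule Suc.IH)
    show "supp (bd (\<phi> l) u) (lvl (Pow V) i)" using supp_bd[OF cpx_Pow Suc.prems(1)] by simp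
    fix T assume T: "T \<subseteq> {..<n}"
    then have "finite T" by (rule finite_subset) simp
    then show "crd \<phi> T (bd (\<phi> l) u) = 0"
      by (rule crd_bd_eq_0) (use T that in \<open>simp add: Suc.prems(2)\<close>)
  qed
  show ?case
  proof (rule ccontr)
    assume nz: "u A \<noteq> 0"
    then have A: "A \<subseteq> V" "card A = Suc i" using Suc.prems(1) by (auto simp: supp_def lvl_def)
    then have "A \<noteq> {}" by auto
    then obtain v where v: "v \<in> A" by blast
    then have "v \<in> V" using A by blast
    then obtain c where c: "\<forall>x\<in>V. delta v x = (\<Sum>l<n. c l * \<phi> l x)" using sep unfolding separating_def by blast
    have "bd (delta v) u (A - {v}) = bd (\<lambda>x. \<Sum>l<n. c l * \<phi> l x) u (A - {v})"
      by (rule bd_cong) (use c in simp_all)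
    also have "\<dots> = 0" unfolding bd_fun_sum bd_fun_scale using bd0 by simp
    finally have "osign v (A - {v}) * u A = 0"
      using v A(1) \<open>v \<in> V\<close> by (auto simp: bd_delta insert_absorb split: if_splits)
    then show False using nz by simp
  qed
qed

text \<open>This isolates what is used of the moment curve, the conclusion of
  \<open>iterated_exact\<close>, so that it can be required of a complex, its links and its
  deletions alike.\<close>

definition iterated_exact_wrt :: "(nat \<Rightarrow> 'a \<Rightarrow> 'k::field) \<Rightarrow> 'a set set \<Rightarrow> nat \<Rightarrow> bool" where
  "iterated_exact_wrt \<phi> X M \<longleftrightarrow> (\<forall>i j u. i + Suc j \<le> M \<longrightarrow> supp u (lvl X i) \<longrightarrow> (\<forall>t\<le>j. \<forall>B. bd (\<phi> t) u B = 0) \<longrightarrow>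
     (\<exists>b. supp b (lvl X (Suc i)) \<and> (\<forall>t<j. \<forall>B. bd (\<phi> t) b B = 0) \<and> (\<forall>B. bd (\<phi> j) b B = u B)))"

text \<open>Sets with an index at most j are heavier than S, so a leading chain u of S is killed by
  the forms 0 to j. The chain b from iterated exactness leads at \<open>insert j S\<close>: its
  coordinates at sets with an index below j vanish, and those at sets with least element j are
  coordinates of u.\<close>

lemma ini_insert_separating:
  assumes X: "cpx X" and sep: "separating n \<phi>" and ex: "iterated_exact_wrt \<phi> X M"
    and S: "S \<in> ini n \<phi> (lvl X i)" "\<And>s. s \<in> S \<Longrightarrow> j < s" and ij: "i + Suc j \<le> M" "j < n"
  shows "insert j S \<in> ini n \<phi> (lvl X (Suc i))"
proof -
  obtain u where u: "S \<subseteq> {..<n}" "supp u (lvl X i)" "crd \<phi> S u \<noteq> 0"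
    "\<And>T. T \<subseteq> {..<n} \<Longrightarrow> wt n S < wt n T \<Longrightarrow> crd \<phi> T u = 0" using iniE[OF S(1)] by blast
  have finS: "finite S" using u(1) finite_subset[of S "{..<n}"] by simp
  have low: "wt n S < 2 ^ (n - 1 - j)" using wt_low[OF u(1) S(2)] .
  have bd0: "bd (\<phi> t) u B = 0" if t: "t \<le> j" for t B
  proof (rule crd_injective[OF sep])
    show "supp (bd (\<phi> t) u) (lvl (Pow V) (i - 1))"
      by (rule supp_lvl_Pow[OF X supp_bd[OF X u(2)]])
    fix T assume T: "T \<subseteq> {..<n}"
    then have finT: "finite T" using finite_subset[of T "{..<n}"] by simp
    show "crd \<phi> T (bd (\<phi> t) u) = 0"
    proof (rule crd_bd_eq_0[OF finT])
      have "2 ^ (n - 1 - j) \<le> wt n (insert t T)" by (rule wt_high[of _ t]) (use finT t in simp_all)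
      then show "crd \<phi> (insert t T) u = 0" using low T t ij by (intro u(4)) auto
    qed
  qed
  obtain b where b: "supp b (lvl X (Suc i))" "\<And>t B. t < j \<Longrightarrow> bd (\<phi> t) b B = 0" "\<And>B. bd (\<phi> j) b B = u B"
    using ex[unfolded iterated_exact_wrt_def, rule_format, OF ij(1) u(2) bd0] by auto
  have bj: "bd (\<phi> j) b = u" using b(3) by (rule HOL.ext)
  have bt: "bd (\<phi> t) b = (\<lambda>_. 0)" if "t < j" for t using b(2)[OF that] by (rule HOL.ext)
  show ?thesis
  proof (rule iniI)
    show "insert j S \<subseteq> {..<n}" using u(1) ij by simp
    show "supp b (lvl X (Suc i))" by (rule b(1))
    show "crd \<phi> (insert j S) b \<noteq> 0" using crd_insert_min[OF finS S(2), of \<phi> b] bj u(3) by simp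
  next
    fix T assume T: "T \<subseteq> {..<n}" "wt n (insert j S) < wt n T"
    then have finT: "finite T" using finite_subset[of T "{..<n}"] by simp
    have jS: "j \<notin> S" using S(2) by blast
    show "crd \<phi> T b = 0"
    proof (cases "\<exists>t\<in>T. t < j")
      case True
      then obtain t where t: "t \<in> T" "t < j" by blast
      show ?thesis
        by (rule crd_eq_0_of_bd[OF finT t(1)]) (simp add: bt[OF t(2)] crd_def)
    next
      case False
      show ?thesis
      proof (cases "j \<in> T")
        case True
        have "T = insert j (T - {j})" using True by blast
        then have "wt n T = 2 ^ (n - 1 - j) + wt n (T - {j})"
          using wt_insert[of "T - {j}" j n] finT by simp
        then have "wt n S < wt n (T - {j})" using T(2) wt_insert[OF finS jS, of n] by simp
        then have "crd \<phi> (T - {j}) u = 0" using T(1) by (intro u(4)) auto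
        then show ?thesis by (intro crd_eq_0_of_bd[OF finT True]) (simp add: bj)
      next
        case jT: False
        have "j < t" if "t \<in> T" for t using that False jT by (metis linorder_neqE_nat)
        then have "wt n T < 2 ^ (n - 1 - j)" by (rule wt_low[OF T(1)])
        then show ?thesis using T(2) wt_insert[OF finS jS, of n] by simp
      qed
    qed
  qed
qed

end

section \<open>Generic coordinates\<close>

definition dot :: "'b set \<Rightarrow> ('b \<Rightarrow> 'k::field) \<Rightarrow> ('b \<Rightarrow> 'k) \<Rightarrow> 'k" where
  "dot X u p = (\<Sum>A\<in>X. u A * p A)"

definition vec :: "'b set \<Rightarrow> ('b \<Rightarrow> 'k::field) \<Rightarrow> 'b \<Rightarrow> 'k" where
  "vec X p A = (if A \<in> X then p A else 0)"

definition indep :: "'s set \<Rightarrow> 'b set \<Rightarrow> ('s \<Rightarrow> 'b \<Rightarrow> 'k::field) \<Rightarrow> bool" where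
  "indep R X p \<longleftrightarrow> (\<forall>c. (\<forall>A\<in>X. (\<Sum>t\<in>R. c t * p t A) = 0) \<longrightarrow> (\<forall>t\<in>R. c t = 0))"

lemma dot_diff_scale: "dot X (\<lambda>A. u A - c * w A) p = dot X u p - c * dot X w p"
  by (simp add: dot_def left_diff_distrib sum_subtractf sum_distrib_left mult.assoc)

lemma dot_diff_scale_right: "dot X u (\<lambda>A. p A - c * q A) = dot X u p - c * dot X u q"
  by (simp add: dot_def right_diff_distrib sum_subtractf sum_distrib_left mult_ac)

lemma dot_sum: "dot X u (\<lambda>A. \<Sum>t\<in>R. c t * p t A) = (\<Sum>t\<in>R. c t * dot X u (p t))"
  unfolding dot_def sum_distrib_left by (subst sum.swap) (simp add: mult_ac)

lemma dot_delta: "finite X \<Longrightarrow> A \<in> X \<Longrightarrow> dot X u (delta A) = u A"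
proof -
  assume X: "finite X" "A \<in> X"
  have "dot X u (delta A) = (\<Sum>B\<in>X. if B = A then u A else 0)"
    unfolding dot_def by (rule sum.cong) (simp_all add: delta_def)
  then show ?thesis using X by simp
qed

lemma dot_delta_left: "finite X \<Longrightarrow> A \<in> X \<Longrightarrow> dot X (delta A) u = u A"
  using dot_delta[of X A u] by (simp add: dot_def mult.commute)

lemma span_image_mono: "x \<in> fvs.span (f ` A) \<Longrightarrow> A \<subseteq> B \<Longrightarrow> x \<in> fvs.span (f ` B)"
  by (rule subsetD[OF fvs.span_mono[OF image_mono]])

lemma vec_in_span:
  fixes p :: "'s \<Rightarrow> 'b \<Rightarrow> 'k::field"
  assumes X: "finite X"
  shows "finite T \<Longrightarrow> (\<And>u. (\<forall>t\<in>T. dot X u (p t) = 0) \<Longrightarrow> dot X u s = 0) \<Longrightarrow>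
    vec X s \<in> fvs.span ((\<lambda>t. vec X (p t)) ` T)"
proof (induction T arbitrary: s rule: finite_induct)
  case empty
  have "s A = 0" if "A \<in> X" for A
    using empty[of "delta A"] dot_delta_left[OF X that, of s] by simp
  then have "vec X s = 0" by (simp add: vec_def fun_eq_iff)
  then show ?case by (simp only: fvs.span_zero)
next
  case (insert t T)
  show ?case
  proof (cases "\<exists>u0. (\<forall>t'\<in>T. dot X u0 (p t') = 0) \<and> dot X u0 (p t) \<noteq> 0")
    case True
    then obtain u0 where u0: "\<forall>t'\<in>T. dot X u0 (p t') = 0" "dot X u0 (p t) \<noteq> 0" by blast
    define a where "a = dot X u0 s / dot X u0 (p t)"
    have "vec X (\<lambda>A. s A - a * p t A) \<in> fvs.span ((\<lambda>t. vec X (p t)) ` T)"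
    proof (rule insert.IH)
      fix u assume u: "\<forall>t'\<in>T. dot X u (p t') = 0"
      define b where "b = dot X u (p t) / dot X u0 (p t)"
      have "\<forall>t'\<in>insert t T. dot X (\<lambda>A. u A - b * u0 A) (p t') = 0"
        unfolding dot_diff_scale using u u0 by (simp add: b_def)
      then have "dot X (\<lambda>A. u A - b * u0 A) s = 0" by (rule insert.prems)
      then have "dot X u s = b * dot X u0 s" by (simp add: dot_diff_scale)
      then show "dot X u (\<lambda>A. s A - a * p t A) = 0"
        unfolding dot_diff_scale_right using u0(2) by (simp add: a_def b_def)
    qed
    then have 1: "vec X (\<lambda>A. s A - a * p t A) \<in> fvs.span ((\<lambda>t. vec X (p t)) ` insert t T)"
      by (rule subsetD[OF fvs.span_mono, rotated]) blast
    have 2: "(\<lambda>A. a * vec X (p t) A) \<in> fvs.span ((\<lambda>t. vec X (p t)) ` insert t T)"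
      by (intro fvs.span_scale fvs.span_base) simp
    have "vec X s = vec X (\<lambda>A. s A - a * p t A) + (\<lambda>A. a * vec X (p t) A)"
      by (rule HOL.ext) (simp add: vec_def)
    then show ?thesis using fvs.span_add[OF 1 2] by (simp only:)
  next
    case False
    have "vec X s \<in> fvs.span ((\<lambda>t. vec X (p t)) ` T)"
    proof (rule insert.IH)
      fix u assume u: "\<forall>t\<in>T. dot X u (p t) = 0"
      then have "dot X u (p t) = 0" using False by blast
      then show "dot X u s = 0" using u by (intro insert.prems) simp
    qed
    then show ?thesis by (rule subsetD[OF fvs.span_mono, rotated]) blast
  qed
qed

lemma indep_card_le:
  assumes R: "finite R" and ind: "indep R X p" and B: "finite B"
    and sp: "\<And>t. t \<in> R \<Longrightarrow> vec X (p t) \<in> fvs.span B"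
  shows "card R \<le> card B"
proof -
  define v where "v t = vec X (p t)" for t
  have inj: "inj_on v R"
  proof (rule inj_onI, rule ccontr)
    fix s t assume st: "s \<in> R" "t \<in> R" "v s = v t" "s \<noteq> t"
    define c where "c r = (if r = s then 1 else if r = t then -1 else 0 :: 'c)" for r
    have "(\<Sum>r\<in>R. c r * p r A) = 0" if "A \<in> X" for A
    proof -
      have "(\<Sum>r\<in>R. c r * p r A) = (\<Sum>r\<in>{s, t}. c r * p r A)"
        using R st by (intro sum.mono_neutral_right) (auto simp: c_def)
      also have "\<dots> = p s A - p t A" using st(4) by (simp add: c_def)
      also have "\<dots> = 0" using fun_cong[OF st(3), of A] that by (simp add: v_def vec_def)
      finally show ?thesis .
    qed
    then have "c s = 0" using ind st(1) unfolding indep_def by blast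
    then show False by (simp add: c_def)
  qed
  have "fvs.independent (v ` R)"
  proof (rule fvs.independent_if_scalars_zero)
    show "finite (v ` R)" using R by simp
    fix f x assume s: "(\<Sum>x\<in>v ` R. (\<lambda>A. f x * x A)) = 0" and x: "x \<in> v ` R"
    have "(\<Sum>t\<in>R. f (v t) * p t A) = 0" if "A \<in> X" for A
    proof -
      have "(\<Sum>t\<in>R. f (v t) * p t A) = (\<Sum>t\<in>R. f (v t) * v t A)"
        using that by (simp add: v_def vec_def)
      also have "\<dots> = (\<Sum>x\<in>v ` R. f x * x A)" by (simp add: sum.reindex[OF inj])
      also have "\<dots> = 0" using fun_cong[OF s, of A] by (simp add: sum_apply_fun)
      finally show ?thesis .
    qed
    then have "\<forall>t\<in>R. f (v t) = 0" using ind[unfolded indep_def, rule_format, of "\<lambda>t. f (v t)"] by blast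
    then show "f x = 0" using x by blast
  qed
  moreover have "v ` R \<subseteq> fvs.span B" using sp by (auto simp: v_def)
  ultimately have "card (v ` R) \<le> card B" using fvs.independent_span_bound[OF B] by blast
  then show ?thesis using card_image[OF inj] by simp
qed

lemma indep_subset:
  assumes "finite R" "indep R X p" "Q \<subseteq> R"
  shows "indep Q X p"
  unfolding indep_def
proof (intro allI impI)
  fix c assume c: "\<forall>A\<in>X. (\<Sum>t\<in>Q. c t * p t A) = 0"
  define c' where "c' t = (if t \<in> Q then c t else 0)" for t
  have "(\<Sum>t\<in>R. c' t * p t A) = 0" if "A \<in> X" for A
  proof -
    have "(\<Sum>t\<in>Q. c' t * p t A) = (\<Sum>t\<in>R. c' t * p t A)"
      using assms by (intro sum.mono_neutral_left) (auto simp: c'_def)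
    moreover have "(\<Sum>t\<in>Q. c' t * p t A) = (\<Sum>t\<in>Q. c t * p t A)"
      by (rule sum.cong) (simp_all add: c'_def)
    ultimately show ?thesis using c that by simp
  qed
  then have "\<forall>t\<in>R. c' t = 0" using assms(2)[unfolded indep_def, rule_format, of c'] by blast
  then have "c' t = 0" if "t \<in> Q" for t using assms(3) that by blast
  then show "\<forall>t\<in>Q. c t = 0" by (simp add: c'_def)
qed

text \<open>Elimination of one row by a pivot entry shows that independence is a Zariski-open condition.\<close>

lemma indep_generic:
  fixes P :: "'s \<Rightarrow> 'b \<Rightarrow> 'k::field poly"
  shows "finite R \<Longrightarrow> indep R X (\<lambda>t A. poly (P t A) x0) \<Longrightarrow> finite {x. \<not> indep R X (\<lambda>t A. poly (P t A) x)}"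
proof (induction R arbitrary: P rule: finite_induct)
  case empty
  then show ?case by (simp add: indep_def)
next
  case (insert r R)
  have "\<exists>A\<in>X. poly (P r A) x0 \<noteq> 0"
  proof (rule ccontr)
    assume "\<not> ?thesis"
    then have "\<forall>A\<in>X. (\<Sum>t\<in>insert r R. delta r t * poly (P t A) x0) = 0"
      using insert.hyps by (auto simp: delta_def intro!: sum.neutral)
    then have "delta r r = (0 :: 'k)" using insert.prems[unfolded indep_def, rule_format, of "delta r" r] by blast
    then show False by (simp add: delta_def)
  qed
  then obtain A where A: "A \<in> X" "poly (P r A) x0 \<noteq> 0" by blast
  define d where "d = P r A"
  \<comment> \<open>Elimination without division: multiplying by the pivot d keeps the entries
    polynomial. The exceptional parameters are those of the smaller system and the roots of
    d.\<close>
  define P' where "P' s B = d * P s B - P s A * P r B" for s B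
  have sumP': "(\<Sum>s\<in>R. c s * poly (P' s B) x) =
      (\<Sum>s\<in>R. (c s * poly d x) * poly (P s B) x) - (\<Sum>s\<in>R. c s * poly (P s A) x) * poly (P r B) x" for c B x
    by (simp add: P'_def right_diff_distrib sum_subtractf sum_distrib_left mult_ac)
  have "indep R X (\<lambda>t A. poly (P' t A) x0)"
    unfolding indep_def
  proof (intro allI impI)
    fix c assume c: "\<forall>B\<in>X. (\<Sum>t\<in>R. c t * poly (P' t B) x0) = 0"
    define c' where "c' t = (if t = r then - (\<Sum>s\<in>R. c s * poly (P s A) x0) else c t * poly d x0)" for t
    have "(\<Sum>t\<in>insert r R. c' t * poly (P t B) x0) = 0" if "B \<in> X" for B
    proof -
      have "(\<Sum>t\<in>R. c' t * poly (P t B) x0) = (\<Sum>s\<in>R. (c s * poly d x0) * poly (P s B) x0)"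
        using insert.hyps by (intro sum.cong) (auto simp: c'_def)
      then have "(\<Sum>t\<in>insert r R. c' t * poly (P t B) x0) = (\<Sum>s\<in>R. c s * poly (P' s B) x0)"
        unfolding sumP' using insert.hyps by (simp add: c'_def)
      then show ?thesis using c that by simp
    qed
    then have z: "\<forall>t\<in>insert r R. c' t = 0" using insert.prems[unfolded indep_def, rule_format, of c'] by blast
    show "\<forall>t\<in>R. c t = 0"
    proof
      fix t assume t: "t \<in> R"
      then have "t \<noteq> r" using insert.hyps by blast
      have "c' t = 0" using z t by blast
      then have "c t * poly d x0 = 0" using \<open>t \<noteq> r\<close> by (simp add: c'_def)
      then show "c t = 0" using A(2) by (simp add: d_def)
    qed
  qed
  then have fin: "finite {x. \<not> indep R X (\<lambda>t A. poly (P' t A) x)}" by (rule insert.IH)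
  have "d \<noteq> 0" using A(2) by (auto simp: d_def)
  then have "finite ({x. \<not> indep R X (\<lambda>t A. poly (P' t A) x)} \<union> {x. poly d x = 0})"
    using fin poly_roots_finite by blast
  moreover have "indep (insert r R) X (\<lambda>t A. poly (P t A) x)"
    if x: "indep R X (\<lambda>t A. poly (P' t A) x)" "poly d x \<noteq> 0" for x
    unfolding indep_def
  proof (intro allI impI)
    fix c assume c: "\<forall>B\<in>X. (\<Sum>t\<in>insert r R. c t * poly (P t B) x) = 0"
    have e: "(\<Sum>t\<in>R. c t * poly (P t B) x) = - c r * poly (P r B) x" if "B \<in> X" for B
      using c that insert.hyps by (simp add: eq_neg_iff_add_eq_0 add.commute)
    have "(\<Sum>s\<in>R. c s * poly (P' s B) x) = 0" if "B \<in> X" for B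
    proof -
      have "(\<Sum>s\<in>R. (c s * poly d x) * poly (P s B) x) = poly d x * (\<Sum>s\<in>R. c s * poly (P s B) x)"
        by (simp add: sum_distrib_left mult_ac)
      then show ?thesis unfolding sumP' e[OF A(1)] e[OF that] by (simp add: d_def)
    qed
    then have z: "\<forall>t\<in>R. c t = 0" using x(1)[unfolded indep_def, rule_format, of c] by blast
    then have "c r * poly d x = 0" using e[OF A(1)] by (simp add: d_def)
    then show "\<forall>t\<in>insert r R. c t = 0" using z x(2) by simp
  qed
  then have "{x. \<not> indep (insert r R) X (\<lambda>t A. poly (P t A) x)} \<subseteq>
      {x. \<not> indep R X (\<lambda>t A. poly (P' t A) x)} \<union> {x. poly d x = 0}" by blast
  ultimately show ?case by (rule rev_finite_subset)
qed

definition ispoly :: "('k::field \<Rightarrow> 'k) \<Rightarrow> bool" where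
  "ispoly f \<longleftrightarrow> (\<exists>q. \<forall>x. f x = poly q x)"

lemma ispoly_const: "ispoly (\<lambda>_. c)"
  unfolding ispoly_def by (intro exI[of _ "[:c:]"]) simp

lemma ispoly_id: "ispoly (\<lambda>x. x)"
  unfolding ispoly_def by (intro exI[of _ "[:0, 1:]"]) simp

lemma ispoly_add: "ispoly f \<Longrightarrow> ispoly g \<Longrightarrow> ispoly (\<lambda>x. f x + g x)"
  unfolding ispoly_def by (elim exE, rule_tac x = "q + qa" in exI) simp

lemma ispoly_mult: "ispoly f \<Longrightarrow> ispoly g \<Longrightarrow> ispoly (\<lambda>x. f x * g x)"
  unfolding ispoly_def by (elim exE, rule_tac x = "q * qa" in exI) simp

lemma ispoly_sum: "(\<And>i. i \<in> I \<Longrightarrow> ispoly (f i)) \<Longrightarrow> ispoly (\<lambda>x. \<Sum>i\<in>I. f i x)"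
  by (induction I rule: infinite_finite_induct) (simp_all add: ispoly_const ispoly_add)

lemma wt_less: "S \<subseteq> {..<n} \<Longrightarrow> wt n S < 2 ^ n"
proof -
  assume S: "S \<subseteq> {..<n}"
  have "wt n S \<le> wt n {..<n}" unfolding wt_def using S by (intro sum_mono2) simp_all
  also have "\<dots> = (\<Sum>i<n. 2 ^ i)"
    unfolding wt_def by (rule sum.reindex_bij_witness[of _ "\<lambda>i. n - 1 - i" "\<lambda>i. n - 1 - i"]) auto
  also have "\<dots> < 2 ^ n" by (simp add: sum_power2 lessThan_atLeast0)
  finally show ?thesis .
qed

context ground
begin

section \<open>Counts of initial sets as ranks\<close>

definition row :: "(nat \<Rightarrow> 'a \<Rightarrow> 'k::field) \<Rightarrow> nat set \<Rightarrow> 'a set \<Rightarrow> 'k" where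
  "row \<phi> T A = crd \<phi> T (delta A)"

text \<open>By \<open>row_in_span\<close> and \<open>indep_ini\<close> this is the rank of the rows
  of weight at least \<theta> on the columns XX; a rank can only drop at special
  coordinates.\<close>

definition cnt :: "nat \<Rightarrow> (nat \<Rightarrow> 'a \<Rightarrow> 'k::field) \<Rightarrow> 'a set set \<Rightarrow> nat \<Rightarrow> nat" where
  "cnt n \<phi> XX \<theta> = card {S \<in> ini n \<phi> XX. \<theta> \<le> wt n S}"

lemma crd_dot: "finite XX \<Longrightarrow> supp u XX \<Longrightarrow> crd \<phi> T u = dot XX u (row \<phi> T)"
  unfolding dot_def row_def crd_def by (rule cf_expand)

lemma dot_crd: "finite XX \<Longrightarrow> dot XX u (row \<phi> T) = crd \<phi> T (vec XX u)"
proof -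
  assume XX: "finite XX"
  have "crd \<phi> T (vec XX u) = dot XX (vec XX u) (row \<phi> T)"
    by (rule crd_dot[OF XX]) (simp add: supp_def vec_def)
  also have "\<dots> = dot XX u (row \<phi> T)" by (simp add: dot_def vec_def)
  finally show ?thesis by simp
qed

lemma finite_XX: "XX \<subseteq> Pow V \<Longrightarrow> finite XX"
  by (rule finite_subset[of _ "Pow V"]) simp_all

text \<open>If T is not initial, its row vanishes wherever all heavier rows do and is a combination
  of them. Induction from the heaviest sets downwards replaces those by initial rows.\<close>

lemma row_in_span:
  assumes XX: "finite XX"
  shows "T \<subseteq> {..<n} \<Longrightarrow> vec XX (row \<phi> T) \<in>
    fvs.span ((\<lambda>S. vec XX (row \<phi> S)) ` {S \<in> ini n \<phi> XX. wt n T \<le> wt n S})"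
proof (induction "2 ^ n - wt n T" arbitrary: T rule: less_induct)
  case less
  show ?case
  proof (cases "T \<in> ini n \<phi> XX")
    case True
    then show ?thesis by (intro fvs.span_base) simp
  next
    case False
    define E where "E = {T'. T' \<subseteq> {..<n} \<and> wt n T < wt n T'}"
    have "finite E" by (rule finite_subset[of _ "Pow {..<n}"]) (auto simp: E_def)
    moreover have "dot XX u (row \<phi> T) = 0" if u: "\<forall>t\<in>E. dot XX u (row \<phi> t) = 0" for u
    proof (rule ccontr)
      assume *: "dot XX u (row \<phi> T) \<noteq> 0"
      have "T \<in> ini n \<phi> XX"
      proof (rule iniI[OF less.prems])
        show "supp (vec XX u) XX" by (simp add: supp_def vec_def)
        show "crd \<phi> T (vec XX u) \<noteq> 0" using * dot_crd[OF XX] by metis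
        show "crd \<phi> T' (vec XX u) = 0" if "T' \<subseteq> {..<n}" "wt n T < wt n T'" for T'
          using u that unfolding E_def dot_crd[OF XX, symmetric] by blast
      qed
      with False show False ..
    qed
    ultimately have "vec XX (row \<phi> T) \<in> fvs.span ((\<lambda>t. vec XX (row \<phi> t)) ` E)"
      by (rule vec_in_span[OF XX])
    also have "\<dots> \<subseteq> fvs.span ((\<lambda>S. vec XX (row \<phi> S)) ` {S \<in> ini n \<phi> XX. wt n T \<le> wt n S})"
    proof (rule fvs.span_minimal[OF _ fvs.subspace_span], rule image_subsetI)
      fix T' assume T': "T' \<in> E"
      then have "vec XX (row \<phi> T') \<in> fvs.span ((\<lambda>S. vec XX (row \<phi> S)) ` {S \<in> ini n \<phi> XX. wt n T' \<le> wt n S})"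
        using wt_less[of T' n] by (intro less.hyps) (auto simp: E_def)
      moreover have "{S \<in> ini n \<phi> XX. wt n T' \<le> wt n S} \<subseteq> {S \<in> ini n \<phi> XX. wt n T \<le> wt n S}"
        using T' by (auto simp: E_def)
      ultimately show "vec XX (row \<phi> T') \<in> fvs.span ((\<lambda>S. vec XX (row \<phi> S)) ` {S \<in> ini n \<phi> XX. wt n T \<le> wt n S})"
        by (rule span_image_mono)
    qed
    finally show ?thesis .
  qed
qed

lemma indep_rows_le:
  assumes XX: "finite XX" and R: "R \<subseteq> Pow {..<n}" "\<And>T. T \<in> R \<Longrightarrow> \<theta> \<le> wt n T" "indep R XX (row \<phi>)"
  shows "card R \<le> cnt n \<phi> XX \<theta>"
proof -
  let ?B = "{S \<in> ini n \<phi> XX. \<theta> \<le> wt n S}"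
  have fB: "finite ?B" by (simp add: finite_ini)
  have "card R \<le> card ((\<lambda>S. vec XX (row \<phi> S)) ` ?B)"
  proof (rule indep_card_le[OF _ R(3)])
    show "finite R" by (rule finite_subset[OF R(1)]) simp
    show "finite ((\<lambda>S. vec XX (row \<phi> S)) ` ?B)" using fB by simp
    fix T assume T: "T \<in> R"
    have "{S \<in> ini n \<phi> XX. wt n T \<le> wt n S} \<subseteq> ?B" using R(2)[OF T] by auto
    moreover have "vec XX (row \<phi> T) \<in> fvs.span ((\<lambda>S. vec XX (row \<phi> S)) ` {S \<in> ini n \<phi> XX. wt n T \<le> wt n S})"
      using R(1) T by (intro row_in_span[OF XX]) blast
    ultimately show "vec XX (row \<phi> T) \<in> fvs.span ((\<lambda>S. vec XX (row \<phi> S)) ` ?B)"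
      by (rule span_image_mono[rotated])
  qed
  also have "\<dots> \<le> cnt n \<phi> XX \<theta>" unfolding cnt_def using fB by (rule card_image_le)
  finally show ?thesis .
qed

text \<open>Triangularity: a relation is tested on a leading chain of the lightest set with nonzero
  coefficient, on which all heavier rows vanish.\<close>

lemma indep_ini:
  assumes XX: "finite XX"
  shows "indep (ini n \<phi> XX) XX (row \<phi>)"
  unfolding indep_def
proof (intro allI impI ballI, rule ccontr)
  fix c T assume c: "\<forall>A\<in>XX. (\<Sum>t\<in>ini n \<phi> XX. c t * row \<phi> t A) = 0" and T: "T \<in> ini n \<phi> XX" "c T \<noteq> 0"
  define S where "S = arg_min (wt n) (\<lambda>S. S \<in> ini n \<phi> XX \<and> c S \<noteq> 0)"
  have S: "S \<in> ini n \<phi> XX" "c S \<noteq> 0"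
    using arg_min_natI[of "\<lambda>S. S \<in> ini n \<phi> XX \<and> c S \<noteq> 0" T "wt n"] T by (simp_all add: S_def)
  have min: "wt n S \<le> wt n S'" if "S' \<in> ini n \<phi> XX" "c S' \<noteq> 0" for S'
    using arg_min_nat_le[of "\<lambda>S. S \<in> ini n \<phi> XX \<and> c S \<noteq> 0" S' "wt n"] that by (simp add: S_def)
  obtain u where u: "S \<subseteq> {..<n}" "supp u XX" "crd \<phi> S u \<noteq> 0"
    "\<And>T. T \<subseteq> {..<n} \<Longrightarrow> wt n S < wt n T \<Longrightarrow> crd \<phi> T u = 0" using iniE[OF S(1)] by blast
  have "dot XX u (\<lambda>A. \<Sum>t\<in>ini n \<phi> XX. c t * row \<phi> t A) = 0" using c by (simp add: dot_def)
  then have "(\<Sum>t\<in>ini n \<phi> XX. c t * crd \<phi> t u) = 0"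
    unfolding dot_sum crd_dot[OF XX u(2), symmetric] .
  moreover have "(\<Sum>t\<in>{S}. c t * crd \<phi> t u) = (\<Sum>t\<in>ini n \<phi> XX. c t * crd \<phi> t u)"
  proof (rule sum.mono_neutral_left[OF finite_ini])
    show "\<forall>t\<in>ini n \<phi> XX - {S}. c t * crd \<phi> t u = 0"
    proof
      fix t assume t: "t \<in> ini n \<phi> XX - {S}"
      have "t \<subseteq> {..<n}" using t ini_sub by blast
      then have "wt n t \<noteq> wt n S" using wt_eq_iff[of t n S] t u(1) by simp
      then consider "wt n S < wt n t" | "c t = 0" using min[of t] t by force
      then show "c t * crd \<phi> t u = 0" using u(4)[OF \<open>t \<subseteq> {..<n}\<close>] by cases simp_all
    qed
  qed (use S in simp)
  ultimately show False using S(2) u(3) by simp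
qed

lemma card_ini_le:
  assumes XX: "finite XX"
  shows "card (ini n \<phi> XX) \<le> card XX"
proof -
  have "card (ini n \<phi> XX) \<le> card ((\<lambda>A. delta A :: 'a set \<Rightarrow> 'b) ` XX)"
  proof (rule indep_card_le[OF finite_ini indep_ini[OF XX]])
    fix T
    have "vec XX (row \<phi> T) = (\<Sum>A\<in>XX. (\<lambda>B. row \<phi> T A * delta A B))"
    proof
      fix B
      have "vec XX (row \<phi> T) B = (\<Sum>A\<in>XX. vec XX (row \<phi> T) A * delta A B)"
        by (rule expand_delta[OF XX]) (simp add: supp_def vec_def)
      also have "\<dots> = (\<Sum>A\<in>XX. row \<phi> T A * delta A B)" by (simp add: vec_def)
      finally show "vec XX (row \<phi> T) B = (\<Sum>A\<in>XX. (\<lambda>B. row \<phi> T A * delta A B)) B" by (simp add: sum_apply_fun)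
    qed
    then show "vec XX (row \<phi> T) \<in> fvs.span ((\<lambda>A. delta A) ` XX)"
      by (simp only:) (intro fvs.span_sum fvs.span_scale fvs.span_base imageI)
  qed (use XX in simp)
  also have "\<dots> \<le> card XX" by (rule card_image_le[OF XX])
  finally show ?thesis .
qed

text \<open>With separating forms no nonzero chain has all coordinates zero, so the rows have full
  rank.\<close>

lemma card_ini_separating:
  assumes sep: "separating n \<phi>" and XX: "XX \<subseteq> lvl (Pow V) i"
  shows "card (ini n \<phi> XX) = card XX"
proof (rule antisym)
  have fin: "finite XX" by (rule finite_subset[OF XX]) (simp add: lvl_def)
  show "card (ini n \<phi> XX) \<le> card XX" by (rule card_ini_le[OF fin])
  let ?B = "(\<lambda>S. vec XX (row \<phi> S)) ` ini n \<phi> XX"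
  have "card XX \<le> card ?B"
  proof (rule indep_card_le[OF fin])
    show "indep XX XX (delta :: _ \<Rightarrow> _ \<Rightarrow> 'b)"
      unfolding indep_def
    proof (intro allI impI ballI)
      fix c :: "'a set \<Rightarrow> 'b" and A
      assume c: "\<forall>A\<in>XX. (\<Sum>t\<in>XX. c t * delta t A) = 0" and A: "A \<in> XX"
      have "vec XX c A = (\<Sum>t\<in>XX. vec XX c t * delta t A)"
        by (rule expand_delta[OF fin]) (simp add: supp_def vec_def)
      also have "\<dots> = (\<Sum>t\<in>XX. c t * delta t A)" by (simp add: vec_def)
      finally show "c A = 0" using c A by (simp add: vec_def)
    qed
    show "finite ?B" by (simp add: finite_ini)
    fix A assume A: "A \<in> XX"
    have "vec XX (delta A) \<in> fvs.span ((\<lambda>t. vec XX (row \<phi> t)) ` Pow {..<n})"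
    proof (rule vec_in_span[OF fin])
      fix u :: "'a set \<Rightarrow> 'b" assume u: "\<forall>t\<in>Pow {..<n}. dot XX u (row \<phi> t) = 0"
      have "vec XX u A = 0"
      proof (rule crd_injective[OF sep])
        have "supp (vec XX u) XX" by (simp add: supp_def vec_def)
        then show "supp (vec XX u) (lvl (Pow V) i)" by (rule supp_mono[OF _ XX])
        show "crd \<phi> T (vec XX u) = 0" if "T \<subseteq> {..<n}" for T
          using u that unfolding dot_crd[OF fin] by blast
      qed
      then show "dot XX u (delta A) = 0" using dot_delta[OF fin A, of u] A by (simp add: vec_def)
    qed simp
    also have "\<dots> \<subseteq> fvs.span ?B"
    proof (rule fvs.span_minimal[OF _ fvs.subspace_span], rule image_subsetI)
      fix T assume "T \<in> Pow {..<n}"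
      then have "vec XX (row \<phi> T) \<in> fvs.span ((\<lambda>S. vec XX (row \<phi> S)) ` {S \<in> ini n \<phi> XX. wt n T \<le> wt n S})"
        by (intro row_in_span[OF fin]) simp
      moreover have "{S \<in> ini n \<phi> XX. wt n T \<le> wt n S} \<subseteq> ini n \<phi> XX" by blast
      ultimately show "vec XX (row \<phi> T) \<in> fvs.span ?B"
        by (rule span_image_mono)
    qed
    finally show "vec XX (delta A) \<in> fvs.span ?B" .
  qed
  also have "\<dots> \<le> card (ini n \<phi> XX)" by (rule card_image_le[OF finite_ini])
  finally show "card XX \<le> card (ini n \<phi> XX)" .
qed

definition line :: "(nat \<Rightarrow> 'a \<Rightarrow> 'k::field) \<Rightarrow> (nat \<Rightarrow> 'a \<Rightarrow> 'k) \<Rightarrow> 'k \<Rightarrow> nat \<Rightarrow> 'a \<Rightarrow> 'k" where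
  "line \<phi> \<psi> x l v = \<phi> l v + x * \<psi> l v"

lemma ispoly_cf: "(\<And>A. ispoly (\<lambda>x. u x A)) \<Longrightarrow> ispoly (\<lambda>x. cf (line \<phi> \<psi> x) ls (u x))"
proof (induction ls arbitrary: u)
  case (Cons l ls)
  have "ispoly (\<lambda>x. bd (line \<phi> \<psi> x l) (u x) A)" for A
  proof (cases "A \<subseteq> V")
    case True
    have "ispoly (\<lambda>x. \<Sum>v\<in>V - A. osign v A * (\<phi> l v + x * \<psi> l v) * u x (insert v A))"
      by (intro ispoly_sum ispoly_mult ispoly_add ispoly_const ispoly_id Cons.prems)
    then show ?thesis using True by (simp add: bd_def line_def)
  next
    case False
    then show ?thesis by (simp add: bd_def ispoly_const)
  qed
  then show ?case by (simp add: Cons.IH)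
qed simp

text \<open>Along a line the rows are polynomial in the parameter, so independence of the rows that
  are initial at \<open>x0\<close> persists off a finite set.\<close>

lemma cnt_semicontinuous:
  assumes XX: "finite XX"
  shows "finite {x. cnt n (line \<phi> \<psi> x) XX \<theta> < cnt n (line \<phi> \<psi> x0) XX \<theta>}"
proof -
  define R where "R = {S \<in> ini n (line \<phi> \<psi> x0) XX. \<theta> \<le> wt n S}"
  have R: "finite R" "R \<subseteq> Pow {..<n}" "\<And>T. T \<in> R \<Longrightarrow> \<theta> \<le> wt n T"
    by (auto simp: R_def finite_ini dest: ini_sub)
  have ind: "indep R XX (row (line \<phi> \<psi> x0))"
    by (rule indep_subset[OF finite_ini indep_ini[OF XX]]) (auto simp: R_def)
  have "\<exists>q. \<forall>x. row (line \<phi> \<psi> x) T A = poly q x" for T A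
    using ispoly_cf[of "\<lambda>_. delta A" \<phi> \<psi> "sorted_list_of_set T"] ispoly_const
    unfolding row_def crd_def ispoly_def by blast
  then obtain P where P: "\<And>T A x. row (line \<phi> \<psi> x) T A = poly (P T A) x" by metis
  have "indep R XX (\<lambda>T A. poly (P T A) x0)" using ind unfolding P[symmetric] .
  then have fin: "finite {x. \<not> indep R XX (\<lambda>T A. poly (P T A) x)}" by (rule indep_generic[OF R(1)])
  have "indep R XX (\<lambda>T A. poly (P T A) x) \<Longrightarrow> card R \<le> cnt n (line \<phi> \<psi> x) XX \<theta>" for x
    unfolding P[symmetric] by (rule indep_rows_le[OF XX R(2,3)])
  then have "{x. cnt n (line \<phi> \<psi> x) XX \<theta> < cnt n (line \<phi> \<psi> x0) XX \<theta>} \<subseteq> {x. \<not> indep R XX (\<lambda>T A. poly (P T A) x)}"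
    by (auto simp: R_def cnt_def not_le[symmetric])
  then show ?thesis using fin by (rule finite_subset)
qed

text \<open>Genericity is expressed as maximality of all counts at once, within the given field. As
  all weights are below \<open>2 ^ n\<close>, finitely many thresholds capture the initial
  families.\<close>

definition generic :: "nat \<Rightarrow> (nat \<Rightarrow> 'a \<Rightarrow> 'k::field) \<Rightarrow> bool" where
  "generic n \<phi> \<longleftrightarrow> (\<forall>(\<psi> :: nat \<Rightarrow> 'a \<Rightarrow> 'k) XX \<theta>. XX \<subseteq> Pow V \<longrightarrow> \<theta> \<le> 2 ^ n \<longrightarrow> cnt n \<psi> XX \<theta> \<le> cnt n \<phi> XX \<theta>)"

lemma genericD: "generic n (\<phi> :: nat \<Rightarrow> 'a \<Rightarrow> 'k::field) \<Longrightarrow> XX \<subseteq> Pow V \<Longrightarrow> \<theta> \<le> 2 ^ n \<Longrightarrow> cnt n (\<psi> :: nat \<Rightarrow> 'a \<Rightarrow> 'k) XX \<theta> \<le> cnt n \<phi> XX \<theta>"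
  unfolding generic_def by blast

lemma cnt_bound: "cnt n \<phi> XX \<theta> \<le> 2 ^ n"
proof -
  have "cnt n \<phi> XX \<theta> \<le> card (Pow {..<n})"
    unfolding cnt_def by (rule card_mono) (auto simp: ini_def)
  then show ?thesis by (simp add: card_Pow)
qed

text \<open>Some coordinates maximise the sum of all counts. On the line joining them to a rival,
  almost every point does at least as well as both ends in each count, so a rival better in one
  count would allow a larger sum.\<close>

lemma ex_generic:
  assumes inf: "infinite (UNIV :: 'k::field set)"
  shows "\<exists>\<phi> :: nat \<Rightarrow> 'a \<Rightarrow> 'k. generic n \<phi>"
proof -
  define I where "I = Pow (Pow V) \<times> {..(2::nat) ^ n}"
  have finI: "finite I" by (simp add: I_def)
  define \<mu> where "\<mu> \<phi> = (\<Sum>i\<in>I. cnt n \<phi> (fst i) (snd i))" for \<phi> :: "nat \<Rightarrow> 'a \<Rightarrow> 'k"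
  have "\<mu> \<phi> \<le> (\<Sum>i\<in>I. 2 ^ n)" for \<phi>
    unfolding \<mu>_def by (rule sum_mono) (rule cnt_bound)
  then have "\<forall>\<phi>. True \<longrightarrow> \<mu> \<phi> < Suc (\<Sum>i\<in>I. 2 ^ n)" by (simp only: less_Suc_eq_le simp_thms)
  from ex_has_greatest_nat[of "\<lambda>_. True" undefined, OF TrueI this]
  obtain \<phi> where "True \<and> (\<forall>\<psi>. True \<longrightarrow> \<mu> \<psi> \<le> \<mu> \<phi>)" ..
  then have \<phi>: "\<And>\<psi>. \<mu> \<psi> \<le> \<mu> \<phi>" by simp
  have "cnt n \<psi> XX \<theta> \<le> cnt n \<phi> XX \<theta>" if "XX \<subseteq> Pow V" "\<theta> \<le> 2 ^ n" for \<psi> :: "nat \<Rightarrow> 'a \<Rightarrow> 'k" and XX \<theta>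
  proof -
    define L where "L = line \<phi> (\<lambda>l v. \<psi> l v - \<phi> l v)"
    define bad where "bad x0 = (\<Union>i\<in>I. {x. cnt n (L x) (fst i) (snd i) < cnt n (L x0) (fst i) (snd i)})" for x0
    have fin: "finite (bad x0)" for x0
      unfolding bad_def L_def
    proof (rule finite_UN_I[OF finI])
      fix i assume "i \<in> I"
      then have "finite (fst i)" by (intro finite_XX) (auto simp: I_def)
      then show "finite {x. cnt n (line \<phi> (\<lambda>l v. \<psi> l v - \<phi> l v) x) (fst i) (snd i) <
          cnt n (line \<phi> (\<lambda>l v. \<psi> l v - \<phi> l v) x0) (fst i) (snd i)}"
        by (rule cnt_semicontinuous)
    qed
    have "finite (bad 0 \<union> bad 1)" using fin by blast
    from ex_new_if_finite[OF inf this] obtain x where x: "x \<notin> bad 0 \<union> bad 1" ..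
    have L0: "L 0 = \<phi>" by (simp add: L_def line_def fun_eq_iff)
    have L1: "L 1 = \<psi>" by (simp add: L_def line_def fun_eq_iff)
    have ge: "cnt n \<phi> (fst i) (snd i) \<le> cnt n (L x) (fst i) (snd i)"
      "cnt n \<psi> (fst i) (snd i) \<le> cnt n (L x) (fst i) (snd i)" if "i \<in> I" for i
      using x that L0 L1 unfolding bad_def by (auto simp: not_less)
    have i: "(XX, \<theta>) \<in> I" using that by (simp add: I_def)
    have "\<not> cnt n \<phi> XX \<theta> < cnt n (L x) XX \<theta>"
    proof
      assume "cnt n \<phi> XX \<theta> < cnt n (L x) XX \<theta>"
      then have "\<mu> \<phi> < \<mu> (L x)"
        unfolding \<mu>_def using ge(1) by (intro sum_strict_mono_ex1[OF finI] ballI bexI[OF _ i]) simp_all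
      then show False using \<phi>[of "L x"] by simp
    qed
    then show ?thesis using ge(2)[OF i] by simp
  qed
  then show ?thesis unfolding generic_def by blast
qed

lemma generic_card:
  fixes \<phi> \<psi> :: "nat \<Rightarrow> 'a \<Rightarrow> 'k::field"
  assumes "generic n \<phi>" "separating n \<psi>" "XX \<subseteq> lvl (Pow V) i"
  shows "card (ini n \<phi> XX) = card XX"
proof (rule antisym)
  have XX: "XX \<subseteq> Pow V" using assms(3) by (auto simp: lvl_def)
  show "card (ini n \<phi> XX) \<le> card XX" by (rule card_ini_le[OF finite_XX[OF XX]])
  have "card XX = cnt n \<psi> XX 0" using card_ini_separating[OF assms(2,3)] by (simp add: cnt_def)
  also have "\<dots> \<le> cnt n \<phi> XX 0" by (rule genericD[OF assms(1) XX]) simp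
  also have "\<dots> = card (ini n \<phi> XX)" by (simp add: cnt_def)
  finally show "card XX \<le> card (ini n \<phi> XX)" .
qed

text \<open>Distinct index sets have distinct weights, so the members are exactly the jumps of the
  count.\<close>

lemma ini_eq_of_cnt:
  fixes \<phi> \<psi> :: "nat \<Rightarrow> 'a \<Rightarrow> 'k::field"
  assumes "\<And>\<theta>. \<theta> \<le> 2 ^ n \<Longrightarrow> cnt n \<phi> XX \<theta> = cnt n \<psi> XX \<theta>"
  shows "ini n \<phi> XX = ini n \<psi> XX"
proof -
  have *: "S \<in> ini n f XX \<longleftrightarrow> cnt n f XX (wt n S) = Suc (cnt n f XX (Suc (wt n S)))"
    if S: "S \<subseteq> {..<n}" for S and f :: "nat \<Rightarrow> 'a \<Rightarrow> 'k"
  proof -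
    have "wt n S \<le> wt n T \<longleftrightarrow> T = S \<or> Suc (wt n S) \<le> wt n T" if "T \<in> ini n f XX" for T
    proof (cases "T = S")
      case False
      then have "wt n T \<noteq> wt n S" using wt_eq_iff[OF ini_sub[OF that] S] by blast
      then show ?thesis using False by linarith
    qed simp
    then have eq: "{T \<in> ini n f XX. wt n S \<le> wt n T} = {T \<in> ini n f XX. T = S} \<union> {T \<in> ini n f XX. Suc (wt n S) \<le> wt n T}"
      by blast
    have fin: "finite {T \<in> ini n f XX. Suc (wt n S) \<le> wt n T}" "finite {T \<in> ini n f XX. T = S}"
      by (simp_all add: finite_ini)
    have "{T \<in> ini n f XX. T = S} \<inter> {T \<in> ini n f XX. Suc (wt n S) \<le> wt n T} = {}" by auto
    then have c: "cnt n f XX (wt n S) = card {T \<in> ini n f XX. T = S} + cnt n f XX (Suc (wt n S))"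
      unfolding cnt_def eq by (rule card_Un_disjoint[OF fin(2,1)])
    show ?thesis
    proof (cases "S \<in> ini n f XX")
      case True
      then have "{T \<in> ini n f XX. T = S} = {S}" by blast
      then show ?thesis using c True by simp
    next
      case False
      then have "{T \<in> ini n f XX. T = S} = {}" by blast
      then have "cnt n f XX (wt n S) = cnt n f XX (Suc (wt n S))" using c by (simp only: card.empty)
      then show ?thesis using False by simp
    qed
  qed
  show ?thesis
  proof (rule set_eqI)
    fix S
    show "S \<in> ini n \<phi> XX \<longleftrightarrow> S \<in> ini n \<psi> XX"
    proof (cases "S \<subseteq> {..<n}")
      case True
      have "cnt n \<phi> XX (wt n S) = cnt n \<psi> XX (wt n S)" "cnt n \<phi> XX (Suc (wt n S)) = cnt n \<psi> XX (Suc (wt n S))"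
        using wt_less[OF True] by (simp_all add: assms)
      then show ?thesis unfolding *[OF True] by (simp only:)
    next
      case False
      then show ?thesis using ini_sub[of S n \<phi> XX] ini_sub[of S n \<psi> XX] by argo
    qed
  qed
qed

section \<open>Shiftedness of generic initial families\<close>

lemma cf_cong: "(\<And>l. l \<in> set xs \<Longrightarrow> \<phi> l = \<psi> l) \<Longrightarrow> cf \<phi> xs u = cf \<psi> xs u"
  by (induction xs arbitrary: u) simp_all

lemma cf_append: "cf \<phi> (xs @ ys) u = cf \<phi> ys (fold (\<lambda>l. bd (\<phi> l)) xs u)"
  by (induction xs arbitrary: u) simp_all

lemma fold_bd_cong: "(\<And>l. l \<in> set xs \<Longrightarrow> \<phi> l = \<psi> l) \<Longrightarrow> fold (\<lambda>l. bd (\<phi> l)) xs u = fold (\<lambda>l. bd (\<psi> l)) xs u"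
  by (induction xs arbitrary: u) simp_all

lemma sorted_list_split:
  assumes "finite T" "j \<in> T"
  shows "sorted_list_of_set T = sorted_list_of_set {t\<in>T. t < j} @ j # sorted_list_of_set {t\<in>T. j < (t::nat)}"
proof (rule sorted_distinct_set_unique)
  show "sorted (sorted_list_of_set {t\<in>T. t < j} @ j # sorted_list_of_set {t\<in>T. j < t})"
    using assms by (auto simp: sorted_append intro: less_imp_le)
  show "distinct (sorted_list_of_set {t\<in>T. t < j} @ j # sorted_list_of_set {t\<in>T. j < t})"
    using assms by auto
  show "set (sorted_list_of_set T) = set (sorted_list_of_set {t\<in>T. t < j} @ j # sorted_list_of_set {t\<in>T. j < t})"
    using assms by (auto simp: not_less)
qed (use assms in simp_all)

text \<open>By multilinearity the coordinate splits; the second term has j + 1 in place of j and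
  vanishes if j + 1 occurs already. No sign appears, since j and j + 1 are neighbours in the sorted
  order.\<close>

lemma crd_replace:
  assumes T: "finite T" "j \<in> T" and \<psi>: "\<And>l. l \<noteq> j \<Longrightarrow> \<psi> l = \<phi> l" "\<And>v. \<psi> j v = \<phi> j v + x * \<phi> (Suc j) v"
  shows "crd \<psi> T u = crd \<phi> T u + (if Suc j \<in> T then 0 else x * crd \<phi> (insert (Suc j) (T - {j})) u)"
proof -
  define as where "as = sorted_list_of_set {t\<in>T. t < j}"
  define bs where "bs = sorted_list_of_set {t\<in>T. j < t}"
  define w where "w = fold (\<lambda>l. bd (\<phi> l)) as u"
  have sT: "sorted_list_of_set T = as @ j # bs" unfolding as_def bs_def by (rule sorted_list_split[OF T])
  have sets: "set as = {t\<in>T. t < j}" "set bs = {t\<in>T. j < t}" using T(1) by (simp_all add: as_def bs_def)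
  have w: "fold (\<lambda>l. bd (\<psi> l)) as u = w"
    unfolding w_def by (rule fold_bd_cong) (rule \<psi>(1), use sets in auto)
  have "crd \<psi> T u = cf \<psi> bs (bd (\<psi> j) w)"
    unfolding crd_def sT cf_append w by simp
  also have "\<dots> = cf \<phi> bs (bd (\<psi> j) w)"
    by (rule cf_cong) (rule \<psi>(1), use sets in auto)
  also have "bd (\<psi> j) w = (\<lambda>A. bd (\<phi> j) w A + x * bd (\<phi> (Suc j)) w A)"
  proof
    fix A
    have "bd (\<psi> j) w A = bd (\<lambda>v. \<phi> j v + x * \<phi> (Suc j) v) w A" by (rule bd_cong) (simp_all add: \<psi>(2))
    then show "bd (\<psi> j) w A = bd (\<phi> j) w A + x * bd (\<phi> (Suc j)) w A" unfolding bd_fun_add bd_fun_scale .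
  qed
  also have "cf \<phi> bs (\<lambda>A. bd (\<phi> j) w A + x * bd (\<phi> (Suc j)) w A) = cf \<phi> bs (bd (\<phi> j) w) + x * cf \<phi> (Suc j # bs) w"
    by (simp add: cf_add cf_scale)
  also have "cf \<phi> bs (bd (\<phi> j) w) = crd \<phi> T u"
    unfolding crd_def sT cf_append w_def by simp
  also have "x * cf \<phi> (Suc j # bs) w = (if Suc j \<in> T then 0 else x * crd \<phi> (insert (Suc j) (T - {j})) u)"
  proof (cases "Suc j \<in> T")
    case True
    then have "Suc j \<in> set bs" using sets by simp
    then have "cf \<phi> (Suc j # bs) w = 0" by (rule cf_member)
    then show ?thesis using True by simp
  next
    case False
    have "finite (insert (Suc j) (T - {j}))" "Suc j \<in> insert (Suc j) (T - {j})" using T(1) by simp_all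
    note sorted_list_split[OF this]
    moreover have "{t \<in> insert (Suc j) (T - {j}). t < Suc j} = {t\<in>T. t < j}"
      by (auto simp: less_Suc_eq)
    moreover have "{t \<in> insert (Suc j) (T - {j}). Suc j < t} = {t\<in>T. j < t}"
      using False by (auto simp: Suc_lessI) (metis Suc_lessI)
    ultimately have "sorted_list_of_set (insert (Suc j) (T - {j})) = as @ Suc j # bs"
      unfolding as_def bs_def by simp
    then show ?thesis using False unfolding crd_def by (simp add: cf_append w_def)
  qed
  finally show ?thesis .
qed

lemma wt_move:
  assumes "finite T" "j \<in> T" "Suc j \<notin> T"
  shows "wt n (insert (Suc j) (T - {j})) + 2 ^ (n - 1 - j) = wt n T + 2 ^ (n - 1 - Suc j)"
proof -
  have "wt n (insert (Suc j) (T - {j})) = 2 ^ (n - 1 - Suc j) + wt n (T - {j})"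
    using assms by (intro wt_insert) simp_all
  moreover have "wt n (insert j (T - {j})) = 2 ^ (n - 1 - j) + wt n (T - {j})"
    using assms by (intro wt_insert) simp_all
  moreover have "insert j (T - {j}) = T" using assms by blast
  ultimately show ?thesis by simp
qed

text \<open>Adding x times form j + 1 to form j keeps the initial family for almost all x: no count
  exceeds the generic one, and by semicontinuity none drops. In the new coordinates the leading
  chain of S has coordinate \<open>x * crd \<phi> S u\<close> at the heavier set with j in place of
  j + 1.\<close>

lemma generic_shifted:
  assumes inf: "infinite (UNIV :: 'k::field set)" and gen: "generic n (\<phi> :: nat \<Rightarrow> 'a \<Rightarrow> 'k)" and XX: "XX \<subseteq> Pow V"
    and S: "S \<in> ini n \<phi> XX" "Suc j \<in> S" "j \<notin> S"
  shows "insert j (S - {Suc j}) \<in> ini n \<phi> XX"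
proof -
  define D where "D l v = (if l = j then \<phi> (Suc j) v else 0)" for l v
  define L where "L = line \<phi> D"
  define bad where "bad = (\<Union>\<theta>\<in>{..2 ^ n}. {x. cnt n (L x) XX \<theta> < cnt n (L 0) XX \<theta>})"
  have "finite bad"
    unfolding bad_def L_def using cnt_semicontinuous[OF finite_XX[OF XX]] by (intro finite_UN_I) simp_all
  then have "finite (insert 0 bad)" by simp
  from ex_new_if_finite[OF inf this] obtain x where "x \<notin> insert 0 bad" ..
  then have x: "x \<noteq> 0" "x \<notin> bad" by simp_all
  have L0: "L 0 = \<phi>" by (simp add: L_def line_def fun_eq_iff)
  define \<psi> where "\<psi> = L x"
  have \<psi>: "\<And>l. l \<noteq> j \<Longrightarrow> \<psi> l = \<phi> l" "\<And>v. \<psi> j v = \<phi> j v + x * \<phi> (Suc j) v"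
    by (simp_all add: \<psi>_def L_def line_def D_def fun_eq_iff)
  have "ini n \<psi> XX = ini n \<phi> XX"
  proof (rule ini_eq_of_cnt, rule antisym)
    fix \<theta> :: nat assume \<theta>: "\<theta> \<le> 2 ^ n"
    show "cnt n \<psi> XX \<theta> \<le> cnt n \<phi> XX \<theta>" by (rule genericD[OF gen XX \<theta>])
    show "cnt n \<phi> XX \<theta> \<le> cnt n \<psi> XX \<theta>" using x(2) \<theta> L0 unfolding bad_def \<psi>_def by (auto simp: not_less)
  qed
  moreover have "insert j (S - {Suc j}) \<in> ini n \<psi> XX"
  proof -
    obtain u where u: "S \<subseteq> {..<n}" "supp u XX" "crd \<phi> S u \<noteq> 0"
      "\<And>T. T \<subseteq> {..<n} \<Longrightarrow> wt n S < wt n T \<Longrightarrow> crd \<phi> T u = 0" using iniE[OF S(1)] by blast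
    define S' where "S' = insert j (S - {Suc j})"
    have finS: "finite S" by (rule ini_fin[OF S(1)])
    have S'sub: "S' \<subseteq> {..<n}" using u(1) S(2) by (auto simp: S'_def)
    have finS': "finite S'" using finS by (simp add: S'_def)
    have S': "j \<in> S'" "Suc j \<notin> S'" "insert (Suc j) (S' - {j}) = S" using S(2,3) by (auto simp: S'_def)
    have pw: "(2::nat) ^ (n - 1 - Suc j) < 2 ^ (n - 1 - j)"
      using u(1) S(2) by (intro power_strict_increasing) auto
    \<comment> \<open>The exchange of j and j + 1 changes all weights by the same amount, so T
      heavier than S' comes from a set heavier than S.\<close>
    have wS: "wt n S + 2 ^ (n - 1 - j) = wt n S' + 2 ^ (n - 1 - Suc j)"
      using wt_move[OF finS' S'(1,2), of n] S'(3) by simp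
    have less: "wt n S < wt n S'" using wS pw by linarith
    have "S' \<in> ini n \<psi> XX"
    proof (rule iniI[OF S'sub u(2)])
      have "crd \<psi> S' u = crd \<phi> S' u + x * crd \<phi> S u"
        using crd_replace[OF finS' S'(1), of \<psi> \<phi> x u] \<psi> S' by simp
      also have "crd \<phi> S' u = 0" by (rule u(4)[OF S'sub less])
      finally show "crd \<psi> S' u \<noteq> 0" using x(1) u(3) by simp
    next
      fix T assume T: "T \<subseteq> {..<n}" "wt n S' < wt n T"
      have finT: "finite T" using finite_subset[OF T(1)] by simp
      have 0: "crd \<phi> T u = 0" using T less by (intro u(4)) simp_all
      show "crd \<psi> T u = 0"
      proof (cases "j \<in> T")
        case False
        have "crd \<psi> T u = crd \<phi> T u"
          unfolding crd_def by (rule cf_cong) (rule \<psi>(1), use False finT in auto)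
        then show ?thesis using 0 by simp
      next
        case True
        have "crd \<phi> (insert (Suc j) (T - {j})) u = 0" if "Suc j \<notin> T"
        proof (rule u(4))
          show "insert (Suc j) (T - {j}) \<subseteq> {..<n}" using T(1) u(1) S(2) by blast
          show "wt n S < wt n (insert (Suc j) (T - {j}))"
            using wt_move[OF finT True that, of n] wS T(2) by linarith
        qed
        then show ?thesis using crd_replace[OF finT True, of \<psi> \<phi> x u] \<psi> 0 by simp
      qed
    qed
    then show ?thesis by (simp add: S'_def)
  qed
  ultimately show ?thesis by simp
qed

section \<open>Transfer of insertion to generic coordinates\<close>

definition tail :: "nat \<Rightarrow> nat set set \<Rightarrow> nat set set" where
  "tail j \<S> = {S\<in>\<S>. \<forall>s\<in>S. j \<le> s}"

text \<open>An initial set has an element below j exactly when its weight is at least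
  \<open>2 ^ (n - j)\<close>. Generic coordinates maximise counts and hence minimise tails.\<close>

lemma card_tail:
  assumes X: "cpx X" and j: "0 < j" "j \<le> n" and card: "card (ini n \<phi> (lvl X i)) = card (lvl X i)"
  shows "card (tail j (ini n \<phi> (lvl X i))) + cnt n \<phi> (lvl X i) (2 ^ (n - j)) = card (lvl X i)"
proof -
  let ?I = "ini n \<phi> (lvl X i)"
  have nj: "n - 1 - (j - 1) = n - j" using j by simp
  have "(\<forall>s\<in>S. j \<le> s) \<longleftrightarrow> \<not> 2 ^ (n - j) \<le> wt n S" if "S \<in> ?I" for S
  proof
    assume "\<forall>s\<in>S. j \<le> s"
    then have "j - 1 < s" if "s \<in> S" for s 
    proof -
      have "j \<le> s" using \<open>\<forall>s\<in>S. j \<le> s\<close> that by blast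
      then show ?thesis using j(1) by linarith
    qed
    then show "\<not> 2 ^ (n - j) \<le> wt n S" using wt_low[OF ini_sub[OF that], of "j - 1"] nj by simp
  next
    assume *: "\<not> 2 ^ (n - j) \<le> wt n S"
    show "\<forall>s\<in>S. j \<le> s"
    proof (rule ballI, rule ccontr)
      fix s assume s: "s \<in> S" "\<not> j \<le> s"
      then have "2 ^ (n - 1 - (j - 1)) \<le> wt n S" by (intro wt_high[OF ini_fin[OF that], of s]) simp_all
      then show False using * nj by simp
    qed
  qed
  then have "tail j ?I = ?I - {S\<in>?I. 2 ^ (n - j) \<le> wt n S}" unfolding tail_def by blast
  then have "card (tail j ?I) = card ?I - cnt n \<phi> (lvl X i) (2 ^ (n - j))"
    unfolding cnt_def by (simp add: card_Diff_subset finite_ini)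
  moreover have "cnt n \<phi> (lvl X i) (2 ^ (n - j)) \<le> card ?I"
    unfolding cnt_def by (rule card_mono) (auto simp: finite_ini)
  ultimately show ?thesis using card by simp
qed

lemma tail_0 [simp]: "tail 0 \<S> = \<S>"
  by (simp add: tail_def)

text \<open>Deleting j is injective on the sets with least element j. The inequality holds in all
  coordinates and insertion of j is its equality case, so insertion can be transferred between
  coordinates by counting.\<close>

lemma tail_step:
  fixes \<phi> :: "nat \<Rightarrow> 'a \<Rightarrow> 'k::field" and n :: nat and X
  defines "A \<equiv> \<lambda>i j. tail j (ini n \<phi> (lvl X i))"
  assumes X: "cpx X"
  shows "card (A (Suc i) j) \<le> card (A (Suc i) (Suc j)) + card (A i (Suc j))"
    and "card (A (Suc i) j) = card (A (Suc i) (Suc j)) + card (A i (Suc j)) \<longleftrightarrow>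
      (\<forall>S\<in>A i (Suc j). insert j S \<in> ini n \<phi> (lvl X (Suc i)))"
proof -
  define E where "E = {S\<in>A (Suc i) j. j \<in> S}"
  have fin: "finite (A i j)" for i j unfolding A_def tail_def by (simp add: finite_ini)
  have "A (Suc i) j = A (Suc i) (Suc j) \<union> E" "A (Suc i) (Suc j) \<inter> E = {}"
    unfolding E_def A_def tail_def by (auto simp: Suc_le_eq le_less)
  then have c: "card (A (Suc i) j) = card (A (Suc i) (Suc j)) + card E"
    using fin[of "Suc i" "Suc j"] fin[of "Suc i" j] by (simp add: card_Un_disjoint)
  have im: "(\<lambda>S. S - {j}) ` E \<subseteq> A i (Suc j)"
  proof (rule image_subsetI)
    fix S assume "S \<in> E"
    then have S: "S \<in> ini n \<phi> (lvl X (Suc i))" "j \<in> S" "\<And>s. s \<in> S \<Longrightarrow> j \<le> s"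
      unfolding E_def A_def tail_def by blast+
    have "S - {j} \<in> ini n \<phi> (lvl X i)" by (rule ini_remove_min[OF X S])
    moreover have "Suc j \<le> s" if "s \<in> S - {j}" for s using S(3)[of s] that by auto
    ultimately show "S - {j} \<in> A i (Suc j)" unfolding A_def tail_def by blast
  qed
  have inj: "inj_on (\<lambda>S. S - {j}) E"
    by (rule inj_onI) (auto simp: E_def)
  have cE: "card ((\<lambda>S. S - {j}) ` E) = card E" by (rule card_image[OF inj])
  have le: "card E \<le> card (A i (Suc j))" using card_mono[OF fin im] cE by simp
  then show "card (A (Suc i) j) \<le> card (A (Suc i) (Suc j)) + card (A i (Suc j))" using c by simp
  have "card E = card (A i (Suc j)) \<longleftrightarrow> (\<lambda>S. S - {j}) ` E = A i (Suc j)"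
  proof
    assume "card E = card (A i (Suc j))"
    then show "(\<lambda>S. S - {j}) ` E = A i (Suc j)" by (intro card_subset_eq[OF fin im]) (simp only: cE)
  next
    assume "(\<lambda>S. S - {j}) ` E = A i (Suc j)"
    with cE show "card E = card (A i (Suc j))" by (simp only:)
  qed
  also have "\<dots> \<longleftrightarrow> (\<forall>S\<in>A i (Suc j). insert j S \<in> ini n \<phi> (lvl X (Suc i)))"
  proof
    assume eq: "(\<lambda>S. S - {j}) ` E = A i (Suc j)"
    show "\<forall>S\<in>A i (Suc j). insert j S \<in> ini n \<phi> (lvl X (Suc i))"
    proof
      fix S assume "S \<in> A i (Suc j)"
      then have "S \<in> (\<lambda>S. S - {j}) ` E" using eq by simp
      then obtain S' where S': "S' \<in> E" "S = S' - {j}" by blast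
      then have "insert j S = S'" by (auto simp: E_def)
      then show "insert j S \<in> ini n \<phi> (lvl X (Suc i))" using S'(1) by (simp add: E_def A_def tail_def)
    qed
  next
    assume *: "\<forall>S\<in>A i (Suc j). insert j S \<in> ini n \<phi> (lvl X (Suc i))"
    have "A i (Suc j) \<subseteq> (\<lambda>S. S - {j}) ` E"
    proof
      fix S assume S: "S \<in> A i (Suc j)"
      have js: "Suc j \<le> s" if "s \<in> S" for s using S that unfolding A_def tail_def by blast
      then have "j \<notin> S" by (metis Suc_n_not_le_n)
      moreover have "insert j S \<in> E" using * S js unfolding E_def A_def tail_def by (auto dest: Suc_leD)
      ultimately show "S \<in> (\<lambda>S. S - {j}) ` E" by (intro image_eqI[of _ _ "insert j S"]) auto
    qed
    then show "(\<lambda>S. S - {j}) ` E = A i (Suc j)" using im by blast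
  qed
  finally show "card (A (Suc i) j) = card (A (Suc i) (Suc j)) + card (A i (Suc j)) \<longleftrightarrow>
      (\<forall>S\<in>A i (Suc j). insert j S \<in> ini n \<phi> (lvl X (Suc i)))" using c by simp
qed

text \<open>A squeeze: generic tail numbers are at most those of \<psi>, and they satisfy as an
  inequality the recursion that \<psi> satisfies with equality in the depth range. As the numbers
  agree for j = 0 and for i = 0, they agree throughout that range, and the generic recursion is an
  equality.\<close>

lemma generic_insert:
  assumes gen: "generic n (\<phi> :: nat \<Rightarrow> 'a \<Rightarrow> 'k::field)" and X: "cpx X"
    and sep: "separating n (\<psi> :: nat \<Rightarrow> 'a \<Rightarrow> 'k)" and ex: "iterated_exact_wrt \<psi> X M"
    and S: "S \<in> ini n \<phi> (lvl X i)" "\<And>s. s \<in> S \<Longrightarrow> j < s" and ij: "i + Suc j \<le> M" "j < n"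
  shows "insert j S \<in> ini n \<phi> (lvl X (Suc i))"
proof -
  define N where "N f i j = card (tail j (ini n f (lvl X i)))" for f :: "nat \<Rightarrow> 'a \<Rightarrow> 'k" and i j
  have sub: "lvl X i \<subseteq> lvl (Pow V) i" "lvl X i \<subseteq> Pow V" for i
    using cpx_sub[OF X] by (auto simp: lvl_def)
  have card\<phi>: "card (ini n \<phi> (lvl X i)) = card (lvl X i)" for i by (rule generic_card[OF gen sep sub(1)])
  have card\<psi>: "card (ini n \<psi> (lvl X i)) = card (lvl X i)" for i by (rule card_ini_separating[OF sep sub(1)])
  have le: "N \<phi> i j \<le> N \<psi> i j" if "j \<le> n" for i j
  proof (cases "j = 0")
    case False
    have "cnt n \<psi> (lvl X i) (2 ^ (n - j)) \<le> cnt n \<phi> (lvl X i) (2 ^ (n - j))"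
      by (rule genericD[OF gen sub(2)]) simp
    then show ?thesis
      using card_tail[OF X _ that card\<phi>, of i] card_tail[OF X _ that card\<psi>, of i] False
      by (simp add: N_def)
  qed (simp add: N_def card\<phi> card\<psi>)
  have le\<phi>: "N \<phi> (Suc i) j \<le> N \<phi> (Suc i) (Suc j) + N \<phi> i (Suc j)" for i j
    unfolding N_def by (rule tail_step(1)[OF X])
  have eq\<psi>: "N \<psi> (Suc i) j = N \<psi> (Suc i) (Suc j) + N \<psi> i (Suc j)" if ij: "i + Suc j \<le> M" "j < n" for i j
    unfolding N_def
  proof (subst tail_step(2)[OF X], rule ballI)
    fix S assume S: "S \<in> tail (Suc j) (ini n \<psi> (lvl X i))"
    then have "j < s" if "s \<in> S" for s using that by (auto simp: tail_def Suc_le_eq)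
    then show "insert j S \<in> ini n \<psi> (lvl X (Suc i))"
      using S by (intro ini_insert_separating[OF X sep ex _ _ ij]) (auto simp: tail_def)
  qed
  have N0: "N f 0 j = card (ini n f (lvl X 0))" for f j
  proof -
    have "S = {}" if "S \<in> ini n f (lvl X 0)" for S
      using ini_card[OF sub(1) that] ini_fin[OF that] by simp
    then have "tail j (ini n f (lvl X 0)) = ini n f (lvl X 0)" by (auto simp: tail_def)
    then show ?thesis by (simp add: N_def)
  qed
  have eq: "i + j \<le> Suc M \<Longrightarrow> j \<le> n \<Longrightarrow> N \<phi> i j = N \<psi> i j" for i j
  proof (induction j arbitrary: i)
    case 0
    show ?case by (simp add: N_def card\<phi> card\<psi>)
  next
    case (Suc j)
    note IHj = Suc.IH
    show ?case using Suc.prems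
    proof (induction i)
      case 0
      show ?case by (simp add: N0 card\<phi> card\<psi>)
    next
      case (Suc i)
      have "N \<phi> (Suc i) j = N \<psi> (Suc i) j" using Suc.prems by (intro IHj) simp_all
      moreover have "N \<phi> i (Suc j) = N \<psi> i (Suc j)" using Suc.prems by (intro Suc.IH) simp_all
      moreover have "N \<psi> (Suc i) j = N \<psi> (Suc i) (Suc j) + N \<psi> i (Suc j)" using Suc.prems by (intro eq\<psi>) simp_all
      \<comment> \<open>The recursion bounds the generic number from below, minimality of generic
        tails from above.\<close>
      ultimately show ?case using le\<phi>[of i j] le[of "Suc j" "Suc i"] Suc.prems by simp
    qed
  qed
  have "N \<phi> (Suc i) j = N \<phi> (Suc i) (Suc j) + N \<phi> i (Suc j)"
    using eq[of "Suc i" j] eq[of "Suc i" "Suc j"] eq[of i "Suc j"] eq\<psi>[OF ij] ij by simp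
  then have "\<forall>S\<in>tail (Suc j) (ini n \<phi> (lvl X i)). insert j S \<in> ini n \<phi> (lvl X (Suc i))"
    unfolding N_def tail_step(2)[OF X] .
  moreover have "S \<in> tail (Suc j) (ini n \<phi> (lvl X i))" using S by (auto simp: tail_def Suc_le_eq)
  ultimately show ?thesis by blast
qed

end

section \<open>Shifted intersecting families\<close>

text \<open>The threshold 1 serves families of sets avoiding 0, which only shifts not producing 0
  can preserve.\<close>

definition shifted_from :: "nat \<Rightarrow> nat set set \<Rightarrow> bool" where
  "shifted_from q \<S> \<longleftrightarrow> (\<forall>S\<in>\<S>. \<forall>j\<ge>q. Suc j \<in> S \<longrightarrow> j \<notin> S \<longrightarrow> insert j (S - {Suc j}) \<in> \<S>)"

lemma shifted_from_mono: "shifted_from q \<S> \<Longrightarrow> q \<le> q' \<Longrightarrow> shifted_from q' \<S>"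
  by (simp add: shifted_from_def)

text \<open>A long move is composed of adjacent ones. If the neighbour i of \<open>Suc i\<close> is
  present, it makes the long move first and is then replaced by \<open>Suc i\<close>.\<close>

lemma shiftD:
  assumes sh: "shifted_from q \<S>"
  shows "S \<in> \<S> \<Longrightarrow> i \<in> S \<Longrightarrow> j \<notin> S \<Longrightarrow> q \<le> j \<Longrightarrow> j < i \<Longrightarrow> insert j (S - {i}) \<in> \<S>"
proof (induction i arbitrary: S)
  case (Suc i)
  show ?case
  proof (cases "i = j")
    case True
    then show ?thesis using sh Suc.prems by (simp add: shifted_from_def)
  next
    case False
    then have ij: "j < i" using Suc.prems by simp
    show ?thesis
    proof (cases "i \<in> S")
      case True
      define S1 where "S1 = insert j (S - {i})"
      have "S1 \<in> \<S>" unfolding S1_def using Suc.IH[OF Suc.prems(1) True Suc.prems(3,4) ij] .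
      moreover have "Suc i \<in> S1" "i \<notin> S1" using Suc.prems False by (simp_all add: S1_def)
      moreover have "q \<le> i" using Suc.prems ij by simp
      ultimately have "insert i (S1 - {Suc i}) \<in> \<S>" using sh by (simp add: shifted_from_def)
      moreover have "insert i (S1 - {Suc i}) = insert j (S - {Suc i})"
        using True ij by (auto simp: S1_def)
      ultimately show ?thesis by simp
    next
      case iS: False
      define S1 where "S1 = insert i (S - {Suc i})"
      have "q \<le> i" using Suc.prems ij by simp
      then have "S1 \<in> \<S>" using sh Suc.prems iS by (simp add: S1_def shifted_from_def)
      moreover have "j \<notin> S1" using Suc.prems False by (simp add: S1_def)
      ultimately have "insert j (S1 - {i}) \<in> \<S>" using ij Suc.prems(4) by (intro Suc.IH) (simp_all add: S1_def)
      moreover have "S1 - {i} = S - {Suc i}" using iS by (auto simp: S1_def)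
      ultimately show ?thesis by simp
    qed
  qed
qed simp

text \<open>Moving an element beyond the interval to a gap inside it lowers the sum of the
  set.\<close>

lemma shifted_compress:
  assumes sh: "shifted_from q \<S>"
  shows "S \<in> \<S> \<Longrightarrow> finite S \<Longrightarrow> S \<subseteq> {q..} \<Longrightarrow> {q..<q + card S} \<in> \<S>"
proof (induction "\<Sum>S" arbitrary: S rule: less_induct)
  case less
  let ?B = "{q..<q + card S}"
  show ?case
  proof (cases "S \<subseteq> ?B")
    case True
    have "S = ?B" by (rule card_subset_eq[OF _ True]) simp_all
    then show ?thesis using less.prems(1) by simp
  next
    case False
    then obtain i where i: "i \<in> S" "i \<notin> ?B" by blast
    then have io: "q + card S \<le> i" using less.prems(3) by auto
    have "\<not> ?B \<subseteq> S"
    proof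
      assume "?B \<subseteq> S"
      then have "?B = S" using less.prems(2) by (intro card_subset_eq) simp_all
      then show False using False by simp
    qed
    then obtain j where j: "j \<in> ?B" "j \<notin> S" by blast
    have ji: "j < i" "q \<le> j" using j io by simp_all
    define S' where "S' = insert j (S - {i})"
    have S': "S' \<in> \<S>" unfolding S'_def by (rule shiftD[OF sh less.prems(1) i(1) j(2) ji(2,1)])
    have fin: "finite (S - {i})" using less.prems(2) by simp
    have "card S' = Suc (card (S - {i}))" using fin j(2) by (simp add: S'_def)
    also have "\<dots> = card S" by (rule card_Suc_Diff1[OF less.prems(2) i(1)])
    finally have c: "card S' = card S" .
    have "\<Sum>S' = j + \<Sum>(S - {i})" using fin j(2) by (simp add: S'_def)
    moreover have "\<Sum>S = i + \<Sum>(S - {i})" using less.prems(2) i(1) by (rule sum.remove)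
    ultimately have "\<Sum>S' < \<Sum>S" using ji by simp
    moreover have "S' \<subseteq> {q..}" "finite S'" using less.prems ji by (auto simp: S'_def)
    ultimately have "{q..<q + card S'} \<in> \<S>" using S' by (intro less.hyps)
    then show ?thesis unfolding c .
  qed
qed

text \<open>Bracket matching: if x is in S, the ballot condition at \<open>Suc x\<close> leaves an
  earlier non-element unmatched.\<close>

lemma ballot_injection:
  assumes bal: "\<And>x. card (S \<inter> {p..<x}) \<le> card ({p..<x} - S)"
  shows "\<exists>f. inj_on f (S \<inter> {p..<x}) \<and> (\<forall>s\<in>S \<inter> {p..<x}. f s \<in> {p..<s} - (S :: nat set))"
proof (induction x)
  case (Suc x)
  then obtain f where f: "inj_on f (S \<inter> {p..<x})" "\<forall>s\<in>S \<inter> {p..<x}. f s \<in> {p..<s} - S" by blast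
  show ?case
  proof (cases "x \<in> S \<and> p \<le> x")
    case True
    have e: "S \<inter> {p..<Suc x} = insert x (S \<inter> {p..<x})" "{p..<Suc x} - S = {p..<x} - S"
      using True by (auto simp: less_Suc_eq)
    have "card (S \<inter> {p..<x}) < card ({p..<x} - S)" using bal[of "Suc x"] unfolding e by simp
    moreover have "card (f ` (S \<inter> {p..<x})) = card (S \<inter> {p..<x})" by (rule card_image[OF f(1)])
    ultimately have "\<not> {p..<x} - S \<subseteq> f ` (S \<inter> {p..<x})"
      using card_mono[of "f ` (S \<inter> {p..<x})" "{p..<x} - S"] by auto
    then obtain y where y: "y \<in> {p..<x} - S" "y \<notin> f ` (S \<inter> {p..<x})" by blast
    have "inj_on (f(x := y)) (insert x (S \<inter> {p..<x}))"
      using f(1) y(2) by (auto simp: inj_on_def)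
    moreover have "(f(x := y)) s \<in> {p..<s} - S" if "s \<in> insert x (S \<inter> {p..<x})" for s
      using that y(1) f(2) by (cases "s = x") auto
    ultimately show ?thesis unfolding e by blast
  next
    case False
    then have "S \<inter> {p..<Suc x} = S \<inter> {p..<x}" by (auto simp: less_Suc_eq)
    then show ?thesis using f by auto
  qed
qed simp

text \<open>Moving each element from p onwards down to its matched partner, one at a time, stays in
  the family, clears S there and leaves the part below p untouched.\<close>

lemma ballot_disjoint:
  assumes sh: "shifted_from q \<S>" and S: "S \<in> \<S>" "finite S" and p: "q \<le> p"
    and bal: "\<And>x. card (S \<inter> {p..<x}) \<le> card ({p..<x} - S)"
  shows "\<exists>A\<in>\<S>. A \<inter> {..<p} = S \<inter> {..<p} \<and> A \<inter> S \<inter> {p..} = {}"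
proof -
  obtain b where b: "\<And>s. s \<in> S \<Longrightarrow> s < b" using S(2) by (meson finite_nat_set_iff_bounded)
  define E where "E = S \<inter> {p..<b}"
  have E: "S \<inter> {p..} = E" using b by (auto simp: E_def)
  obtain f where f: "inj_on f E" "\<And>s. s \<in> E \<Longrightarrow> f s \<in> {p..<s} - S"
    using ballot_injection[OF bal, of b] unfolding E_def by blast
  have finE: "finite E" using S(2) by (simp add: E_def)
  have "D \<subseteq> E \<Longrightarrow> (S - D) \<union> f ` D \<in> \<S>" if "finite D" for D
    using that
  proof (induction D rule: finite_induct)
    case empty
    then show ?case using S(1) by simp
  next
    case (insert d D)
    define S1 where "S1 = (S - D) \<union> f ` D"
    have S1: "S1 \<in> \<S>" using insert by (simp add: S1_def)
    have dE: "d \<in> E" "D \<subseteq> E" using insert.prems by simp_all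
    have fD: "f s \<notin> S" if "s \<in> E" for s using f(2)[OF that] by blast
    have fd: "f d \<notin> f ` D" using f(1) dE insert.hyps by (auto simp: inj_on_def)
    have d1: "d \<in> S1" using dE insert.hyps by (simp add: S1_def E_def)
    have d2: "f d \<notin> S1" using fD[OF dE(1)] fd by (simp add: S1_def)
    have "q \<le> f d" "f d < d" using f(2)[OF dE(1)] p by auto
    then have "insert (f d) (S1 - {d}) \<in> \<S>" by (rule shiftD[OF sh S1 d1 d2])
    moreover have "d \<in> S" using dE(1) by (simp add: E_def)
    then have "d \<notin> f ` D" using fD dE(2) by blast
    then have "insert (f d) (S1 - {d}) = (S - insert d D) \<union> f ` insert d D"
      by (auto simp: S1_def)
    ultimately show ?case by simp
  qed
  from this[OF finE subset_refl] have "(S - E) \<union> f ` E \<in> \<S>" .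
  moreover have "f ` E \<inter> {..<p} = {}" using f(2) by fastforce
  moreover have "E \<inter> {..<p} = {}" by (auto simp: E_def)
  ultimately have "(S - E) \<union> f ` E \<in> \<S>" "((S - E) \<union> f ` E) \<inter> {..<p} = S \<inter> {..<p}"
    by blast+
  moreover have "((S - E) \<union> f ` E) \<inter> S \<inter> {p..} = {}"
    using f(2) E by blast
  ultimately show ?thesis by blast
qed

text \<open>\<open>kmax q S\<close> is half the length of the longest prefix of \<open>{q..}\<close> at least half of which lies in \<open>S\<close>;
  by maximality exactly half of it does, so complementing it preserves the cardinality.\<close>

definition kmax :: "nat \<Rightarrow> nat set \<Rightarrow> nat" where
  "kmax q S = (GREATEST k. k \<le> card (S \<inter> {q..<q + 2 * k}))"

definition refl_prefix :: "nat \<Rightarrow> nat set \<Rightarrow> nat set" where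
  "refl_prefix q S = (S - {q..<q + 2 * kmax q S}) \<union> ({q..<q + 2 * kmax q S} - S)"

lemma kmax_le: "finite S \<Longrightarrow> l \<le> card (S \<inter> {q..<q + 2 * l}) \<Longrightarrow> l \<le> kmax q S"
  unfolding kmax_def
proof (rule Greatest_le_nat)
  fix l assume "finite S" "l \<le> card (S \<inter> {q..<q + 2 * l})"
  then show "l \<le> card S" using card_mono[of S "S \<inter> {q..<q + 2 * l}"] by simp
qed

lemma kmax_ge: "finite S \<Longrightarrow> kmax q S \<le> card (S \<inter> {q..<q + 2 * kmax q S})"
  unfolding kmax_def
proof (rule GreatestI_nat)
  show "(0::nat) \<le> card (S \<inter> {q..<q + 2 * 0})" by simp
  fix l assume "finite S" "l \<le> card (S \<inter> {q..<q + 2 * l})"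
  then show "l \<le> card S" using card_mono[of S "S \<inter> {q..<q + 2 * l}"] by simp
qed

lemma kmax_greater:
  assumes "finite S" "kmax q S < l" shows "card (S \<inter> {q..<q + 2 * l}) < l"
proof (rule ccontr)
  assume "\<not> ?thesis"
  then have "l \<le> kmax q S" by (intro kmax_le[OF assms(1)]) simp
  then show False using assms(2) by simp
qed

text \<open>If more than half of the prefix lay in S, the prefix two places longer would still be at
  least half full.\<close>

lemma kmax_eq: "finite S \<Longrightarrow> card (S \<inter> {q..<q + 2 * kmax q S}) = kmax q S"
proof (rule antisym[OF _ kmax_ge])
  assume S: "finite S"
  have "card (S \<inter> {q..<q + 2 * kmax q S}) \<le> card (S \<inter> {q..<q + 2 * Suc (kmax q S)})"
    using S by (intro card_mono) auto
  then show "card (S \<inter> {q..<q + 2 * kmax q S}) \<le> kmax q S"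
    using kmax_greater[OF S, of q "Suc (kmax q S)"] by simp
qed

lemma kmax_eqI:
  assumes "finite S" "k \<le> card (S \<inter> {q..<q + 2 * k})" "\<And>l. k < l \<Longrightarrow> card (S \<inter> {q..<q + 2 * l}) < l"
  shows "kmax q S = k"
proof (rule antisym)
  show "k \<le> kmax q S" by (rule kmax_le[OF assms(1,2)])
  show "kmax q S \<le> k"
  proof (rule ccontr)
    assume "\<not> kmax q S \<le> k"
    then have "card (S \<inter> {q..<q + 2 * kmax q S}) < kmax q S" by (intro assms(3)) simp
    then show False using kmax_ge[OF assms(1), of q] by simp
  qed
qed

lemma card_split_prefix:
  assumes "finite S" "p \<le> (x::nat)" "q \<le> p"
  shows "card (S \<inter> {q..<x}) = card (S \<inter> {q..<p}) + card (S \<inter> {p..<x})"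
proof -
  have "S \<inter> {q..<x} = (S \<inter> {q..<p}) \<union> (S \<inter> {p..<x})" using assms by auto
  moreover have "(S \<inter> {q..<p}) \<inter> (S \<inter> {p..<x}) = {}" by auto
  ultimately show ?thesis using assms(1) by (simp add: card_Un_disjoint)
qed

text \<open>By maximality every longer even prefix is less than half full, and the balanced part
  cancels. Odd lengths are rounded up, which defines l.\<close>

lemma kmax_ballot:
  fixes q :: nat and S
  defines "p \<equiv> q + 2 * kmax q S"
  assumes S: "finite S"
  shows "card (S \<inter> {p..<x}) \<le> card ({p..<x} - S)"
proof (cases "p < x")
  case True
  define l where "l = (x - q + 1) div 2"
  have ox: "q + 2 * kmax q S < x" using True by (simp add: p_def)
  have l: "x \<le> q + 2 * l" "q + 2 * l \<le> x + 1" using ox by (auto simp: l_def)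
  have kl: "kmax q S < l" using ox l by linarith
  have "card (S \<inter> {p..<x}) \<le> card (S \<inter> {p..<q + 2 * l})" using S l by (intro card_mono) auto
  moreover have "card (S \<inter> {q..<q + 2 * l}) = kmax q S + card (S \<inter> {p..<q + 2 * l})"
    using card_split_prefix[OF S, of p "q + 2 * l" q] kl kmax_eq[OF S, of q] by (simp add: p_def)
  moreover have "card (S \<inter> {q..<q + 2 * l}) < l" by (rule kmax_greater[OF S kl])
  ultimately have 1: "kmax q S + card (S \<inter> {p..<x}) < l" by linarith
  have "card ({p..<x} - S) + card (S \<inter> {p..<x}) = card {p..<x}"
    using card_Diff_subset_Int[of "{p..<x}" S] card_mono[of "{p..<x}" "S \<inter> {p..<x}"] by (simp add: Int_commute)
  then have "card ({p..<x} - S) + card (S \<inter> {p..<x}) = x - p" by simp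
  then show ?thesis using 1 l True unfolding p_def by linarith
qed simp

lemma finite_refl_prefix [simp]: "finite S \<Longrightarrow> finite (refl_prefix q S)"
  by (simp add: refl_prefix_def)

lemma refl_prefix_subset: "S \<subseteq> {q..} \<Longrightarrow> refl_prefix q S \<subseteq> {q..}"
  by (auto simp: refl_prefix_def)

text \<open>The complement of a balanced prefix is balanced and nothing changes beyond it.
  Reflection is therefore an involution.\<close>

lemma kmax_refl:
  assumes S: "finite S"
  shows "kmax q (refl_prefix q S) = kmax q S"
proof -
  define k where "k = kmax q S"
  define p where "p = q + 2 * k"
  define S' where "S' = refl_prefix q S"
  have S': "S' = (S - {q..<p}) \<union> ({q..<p} - S)" by (simp add: S'_def refl_prefix_def p_def k_def)
  have fin: "finite S'" using S by (simp add: S'_def)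
  have k: "card (S \<inter> {q..<p}) = k" using kmax_eq[OF S, of q] by (simp add: p_def k_def)
  have "S' \<inter> {q..<p} = {q..<p} - (S \<inter> {q..<p})" unfolding S' by blast
  then have "card (S' \<inter> {q..<p}) = 2 * k - k"
    using k S by (simp add: card_Diff_subset p_def)
  then have k': "card (S' \<inter> {q..<p}) = k" by simp
  have "kmax q S' = k"
  proof (rule kmax_eqI[OF fin])
    show "k \<le> card (S' \<inter> {q..<q + 2 * k})" using k' by (simp add: p_def)
    fix l assume l: "k < l"
    have pl: "p \<le> q + 2 * l" "q \<le> p" using l by (simp_all add: p_def)
    have "S' \<inter> {p..<q + 2 * l} = S \<inter> {p..<q + 2 * l}" unfolding S' by auto
    then have "card (S' \<inter> {q..<q + 2 * l}) = card (S \<inter> {q..<q + 2 * l})"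
      using card_split_prefix[OF fin pl] card_split_prefix[OF S pl] k k' by simp
    then show "card (S' \<inter> {q..<q + 2 * l}) < l" using kmax_greater[OF S, of q l] l by (simp add: k_def)
  qed
  then show ?thesis by (simp add: S'_def k_def)
qed

lemma refl_refl: "finite S \<Longrightarrow> refl_prefix q (refl_prefix q S) = S"
  unfolding refl_prefix_def[of q "refl_prefix q S"] kmax_refl by (auto simp: refl_prefix_def)

text \<open>The member from \<open>ballot_disjoint\<close> agrees with S on the prefix, where the
  reflection is complementary, and avoids S beyond it. Hence reflections of members never belong to
  an intersecting family.\<close>

lemma refl_prefix_disjoint:
  assumes sh: "shifted_from q \<S>" and S: "S \<in> \<S>" "finite S" "S \<subseteq> {q..}"
  shows "\<exists>A\<in>\<S>. A \<inter> refl_prefix q S = {} \<and> A \<subseteq> {q..}"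
proof -
  define p where "p = q + 2 * kmax q S"
  have "q \<le> p" by (simp add: p_def)
  then obtain A where A: "A \<in> \<S>" "A \<inter> {..<p} = S \<inter> {..<p}" "A \<inter> S \<inter> {p..} = {}"
    using ballot_disjoint[OF sh S(1,2), of p] kmax_ballot[OF S(2), of q] unfolding p_def by blast
  have "A \<subseteq> {q..}"
  proof
    fix a assume a: "a \<in> A"
    show "a \<in> {q..}"
    proof (cases "a < p")
      case True
      then have "a \<in> S" using a A(2) by blast
      then show ?thesis using S(3) by blast
    next
      case False
      then show ?thesis using \<open>q \<le> p\<close> by simp
    qed
  qed
  moreover have "A \<inter> refl_prefix q S = {}"
  proof (rule equals0I)
    fix a assume a: "a \<in> A \<inter> refl_prefix q S"
    show False
    proof (cases "a < p")
      case True
      then have "a \<in> S" using a A(2) by blast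
      moreover have "a \<in> {q..<p}" using True a \<open>A \<subseteq> {q..}\<close> by auto
      ultimately show False using a by (auto simp: refl_prefix_def p_def)
    next
      case False
      then have "a \<in> S" using a by (auto simp: refl_prefix_def p_def)
      then show False using A(3) a False by auto
    qed
  qed
  ultimately show ?thesis using A(1) by blast
qed

section \<open>Injection into the sets containing 0, and its equality case\<close>

definition star_map :: "nat set \<Rightarrow> nat set" where
  "star_map S = (if 0 \<in> S then S else refl_prefix 0 S)"

lemma star_map_inj:
  assumes sh: "shifted_from 0 \<S>" and fin: "\<And>S. S \<in> \<S> \<Longrightarrow> finite S"
    and int: "\<And>S T. S \<in> \<S> \<Longrightarrow> T \<in> \<S> \<Longrightarrow> S \<inter> T \<noteq> {}"
  shows "inj_on star_map \<S>"
    and "\<And>S. S \<in> \<S> \<Longrightarrow> 0 \<in> star_map S"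
proof -
  have notin: "refl_prefix 0 S \<notin> \<S>" if S: "S \<in> \<S>" for S
    using refl_prefix_disjoint[OF sh S fin[OF S]] int by fastforce
  show "inj_on star_map \<S>"
  proof (rule inj_onI)
    fix S T assume ST: "S \<in> \<S>" "T \<in> \<S>" "star_map S = star_map T"
    show "S = T"
    proof (cases "0 \<in> S")
      case True
      then show ?thesis using ST notin[OF ST(2)] by (auto simp: star_map_def split: if_splits)
    next
      case False
      then have "0 \<notin> T" using ST notin[OF ST(1)] by (auto simp: star_map_def split: if_splits)
      then have "refl_prefix 0 S = refl_prefix 0 T" using ST False by (simp add: star_map_def)
      then have "refl_prefix 0 (refl_prefix 0 S) = refl_prefix 0 (refl_prefix 0 T)" by simp
      then show ?thesis by (simp add: refl_refl fin ST)
    qed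
  qed
  fix S assume S: "S \<in> \<S>"
  show "0 \<in> star_map S"
  proof (cases "0 \<in> S")
    case False
    \<comment> \<open>An empty prefix would make the reflection equal to S, a member; a nonempty one
      contains 0, which the reflection gains.\<close>
    have "kmax 0 S \<noteq> 0"
    proof
      assume "kmax 0 S = 0"
      then have "refl_prefix 0 S = S" by (simp add: refl_prefix_def)
      then show False using notin[OF S] S by simp
    qed
    then show ?thesis using False by (simp add: star_map_def refl_prefix_def)
  qed (simp add: star_map_def)
qed

lemma card_le_interval: "A \<subseteq> {a..<b} \<Longrightarrow> card A \<le> b - (a::nat)"
  using card_mono[of "{a..<b}" A] by simp

text \<open>A member avoiding 0 compresses to {1..r}, which Q misses, so Q is not a member. The
  longest balanced prefix of Q is {0, 1}, the gap at 2 * r - 1 keeping the prefix of length 2 * r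
  below half. So the preimage of Q is Q with 1 in place of 0, and that shifts to Q.\<close>

lemma shifted_maximum_star:
  assumes sh: "shifted_from 0 \<S>" and card: "\<And>S. S \<in> \<S> \<Longrightarrow> finite S \<and> card S = r"
    and int: "\<And>S T. S \<in> \<S> \<Longrightarrow> T \<in> \<S> \<Longrightarrow> S \<inter> T \<noteq> {}" and r: "2 \<le> r"
    and surj: "{0} \<union> {r + 1..<2 * r - 1} \<union> {2 * r} \<in> star_map ` \<S>" and S: "S \<in> \<S>"
  shows "0 \<in> S"
proof (rule ccontr)
  assume "0 \<notin> S"
  then have "S \<subseteq> {1..}" by (auto simp: Suc_le_eq intro: gr0I)
  then have "{1..<1 + card S} \<in> \<S>"
    using card[OF S] by (intro shifted_compress[OF shifted_from_mono[OF sh]] S) simp_all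
  then have B: "{1..<1 + r} \<in> \<S>" using card[OF S] by simp
  define Q where "Q = {0} \<union> {r + 1..<2 * r - 1} \<union> {2 * r}"
  have Qfin: "finite Q" by (simp add: Q_def)
  have QB: "Q \<inter> {1..<1 + r} = {}" using r by (auto simp: Q_def)
  then have Qn: "Q \<notin> \<S>" using int[OF _ B] by blast
  obtain T where T: "T \<in> \<S>" "Q = star_map T" using surj unfolding Q_def[symmetric] by blast
  have "0 \<notin> T" using T Qn by (auto simp: star_map_def split: if_splits)
  then have "Q = refl_prefix 0 T" using T by (simp add: star_map_def)
  then have TQ: "T = refl_prefix 0 Q" using refl_refl[of T 0] card[OF T(1)] by simp
  have "kmax 0 Q = 1"
  proof (rule kmax_eqI[OF Qfin])
    have "{0} \<subseteq> Q \<inter> {0..<0 + 2 * 1}" by (simp add: Q_def)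
    then have "card {0::nat} \<le> card (Q \<inter> {0..<0 + 2 * 1})" by (intro card_mono) simp_all
    then show "1 \<le> card (Q \<inter> {0..<0 + 2 * 1})" by simp
    fix l :: nat assume l: "1 < l"
    have cQ: "card Q \<le> r"
    proof -
      have "card Q \<le> card ({0} \<union> {r + 1..<2 * r - 1}) + card {2 * r}" unfolding Q_def by (rule card_Un_le)
      also have "\<dots> \<le> card {0::nat} + card {r + 1..<2 * r - 1} + card {2 * r}"
        by (intro add_right_mono card_Un_le)
      finally show ?thesis using r by simp
    qed
    show "card (Q \<inter> {0..<0 + 2 * l}) < l"
    proof (cases "r < l")
      case True
      have "card (Q \<inter> {0..<0 + 2 * l}) \<le> card Q" using Qfin by (intro card_mono) simp_all
      then show ?thesis using cQ True by linarith
    next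
      case False
      define b where "b = min (2 * l) (2 * r - 1)"
      have "Q \<inter> {0..<0 + 2 * l} \<subseteq> {0} \<union> {r + 1..<b}" using False by (auto simp: Q_def b_def)
      then have "card (Q \<inter> {0..<0 + 2 * l}) \<le> card ({0} \<union> {r + 1..<b})" by (intro card_mono) simp_all
      also have "\<dots> \<le> card {0::nat} + card {r + 1..<b}" by (rule card_Un_le)
      finally have "card (Q \<inter> {0..<0 + 2 * l}) \<le> 1 + (b - (r + 1))" by simp
      then show ?thesis using l False r by (auto simp: b_def min_def split: if_splits)
    qed
  qed
  then have "T = (Q - {0..<2}) \<union> ({0..<2} - Q)" unfolding TQ refl_prefix_def by (simp add: numeral_2_eq_2)
  moreover have "{0..<2::nat} = {0, 1}" by auto
  moreover have "1 \<notin> Q" "0 \<in> Q" using r by (simp_all add: Q_def)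
  ultimately have T': "T = insert 1 (Q - {0})" by auto
  have "Suc 0 \<in> T" using T' by simp
  then have "insert 0 (T - {Suc 0}) \<in> \<S>"
    using sh T(1) \<open>0 \<notin> T\<close> by (simp add: shifted_from_def)
  moreover have "insert 0 (T - {Suc 0}) = Q" using T' \<open>1 \<notin> Q\<close> \<open>0 \<in> Q\<close> by auto
  ultimately show False using Qn by simp
qed

text \<open>Reflecting from 1 and adding 0 embeds \<open>\<Y>\<close> into \<open>\<X>\<close>
  outside \<open>\<W>\<close>, and by cardinality the two parts exhaust \<open>\<X>\<close>. The
  test set misses {1..<r} in \<open>\<Y>\<close>, so it is an image; its part Q has an empty
  balanced prefix from 1, so Q is in \<open>\<Y>\<close> although it misses {0..<r} in
  \<open>\<W>\<close>.\<close>

lemma shifted_deletion_empty: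
  assumes W: "shifted_from 0 \<W>" "\<And>S. S \<in> \<W> \<Longrightarrow> finite S \<and> card S = r"
    and Y: "shifted_from 1 \<Y>" "\<And>T. T \<in> \<Y> \<Longrightarrow> finite T \<and> card T = r - 1 \<and> 0 \<notin> T" "\<Y> \<noteq> {}"
    and cross: "\<And>S T. S \<in> \<W> \<Longrightarrow> T \<in> \<Y> \<Longrightarrow> S \<inter> T \<noteq> {}" and r: "2 \<le> r"
    and X: "finite \<X>" "\<W> \<subseteq> \<X>" "\<And>T. T \<in> \<Y> \<Longrightarrow> insert 0 (refl_prefix 1 T) \<in> \<X>"
    and card: "card \<X> \<le> card \<W> + card \<Y>"
    and S1: "{0} \<union> {r..<2 * r - 2} \<union> {2 * r - 1} \<in> \<X>"
  shows "\<W> = {}"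
proof (rule ccontr)
  assume "\<W> \<noteq> {}"
  then obtain S where S: "S \<in> \<W>" by blast
  have "{0..<0 + card S} \<in> \<W>" using W(2)[OF S] by (intro shifted_compress[OF W(1) S]) auto
  then have B: "{0..<r} \<in> \<W>" using W(2)[OF S] by simp
  have Y1: "T \<subseteq> {1..}" if "T \<in> \<Y>" for T
    using Y(2)[OF that] by (auto simp: Suc_le_eq intro: gr0I)
  obtain T where T: "T \<in> \<Y>" using Y(3) by blast
  have "{1..<1 + card T} \<in> \<Y>" using Y(2)[OF T] by (intro shifted_compress[OF Y(1) T] Y1[OF T]) simp
  then have T0: "{1..<r} \<in> \<Y>" using Y(2)[OF T] r by simp
  define g where "g T = insert 0 (refl_prefix 1 T)" for T
  have n0: "0 \<notin> refl_prefix 1 T" if "T \<in> \<Y>" for T using refl_prefix_subset[OF Y1[OF that]] by auto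
  have inj: "inj_on g \<Y>"
  proof (rule inj_onI)
    fix T T' assume TT: "T \<in> \<Y>" "T' \<in> \<Y>" "g T = g T'"
    then have "refl_prefix 1 T = refl_prefix 1 T'"
      using n0 unfolding g_def by (simp add: insert_ident)
    then have "refl_prefix 1 (refl_prefix 1 T) = refl_prefix 1 (refl_prefix 1 T')" by simp
    then show "T = T'" using TT Y(2) by (simp add: refl_refl)
  qed
  have finW: "finite \<W>" using X by (rule_tac finite_subset[OF X(2)])
  have gX: "g ` \<Y> \<subseteq> \<X>" using X(3) by (auto simp: g_def)
  have finY: "finite (g ` \<Y>)" by (rule finite_subset[OF gX X(1)])
  have dis: "\<W> \<inter> g ` \<Y> = {}"
  proof (rule equals0I)
    fix S assume "S \<in> \<W> \<inter> g ` \<Y>"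
    then obtain T where T: "T \<in> \<Y>" "S = g T" "S \<in> \<W>" by blast
    obtain A where A: "A \<in> \<Y>" "A \<inter> refl_prefix 1 T = {}"
      using refl_prefix_disjoint[OF Y(1) T(1) _ Y1[OF T(1)]] Y(2)[OF T(1)] by blast
    have "S \<inter> A = {}" using A Y(2)[OF A(1)] T(2) by (auto simp: g_def)
    then show False using cross[OF T(3) A(1)] by simp
  qed
  have "card (\<W> \<union> g ` \<Y>) = card \<W> + card \<Y>"
    using finW finY dis by (simp add: card_Un_disjoint card_image[OF inj])
  then have eq: "\<W> \<union> g ` \<Y> = \<X>"
    using X(1,2) gX card card_mono[OF X(1), of "\<W> \<union> g ` \<Y>"] by (intro card_subset_eq) simp_all
  define Q where "Q = {r..<2 * r - 2} \<union> {2 * r - 1}"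
  have S1': "insert 0 Q \<in> \<W> \<union> g ` \<Y>" using S1 unfolding eq Q_def by (simp add: insert_commute)
  have "insert 0 Q \<inter> {1..<r} = {}" using r by (auto simp: Q_def)
  then have "insert 0 Q \<notin> \<W>" using cross[OF _ T0] by blast
  then obtain T where T: "T \<in> \<Y>" "insert 0 Q = g T" using S1' by blast
  have Q0: "0 \<notin> Q" using r by (simp add: Q_def)
  have "Q = refl_prefix 1 T" using T(2) Q0 n0[OF T(1)] unfolding g_def by (simp add: insert_ident)
  then have TQ: "T = refl_prefix 1 Q" using refl_refl[of T 1] Y(2)[OF T(1)] by simp
  have finQ: "finite Q" by (simp add: Q_def)
  have "kmax 1 Q = 0"
  proof (rule kmax_eqI[OF finQ])
    fix l :: nat assume l: "0 < l"
    have cQ: "card Q \<le> r - 1"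
    proof -
      have "card Q \<le> card {r..<2 * r - 2} + card {2 * r - 1}" unfolding Q_def by (rule card_Un_le)
      then show ?thesis using r by simp
    qed
    show "card (Q \<inter> {1..<1 + 2 * l}) < l"
    proof (cases "r \<le> l")
      case True
      have "card (Q \<inter> {1..<1 + 2 * l}) \<le> card Q" using finQ by (intro card_mono) simp_all
      then show ?thesis using cQ True r by linarith
    next
      case False
      define b where "b = min (1 + 2 * l) (2 * r - 2)"
      have "Q \<inter> {1..<1 + 2 * l} \<subseteq> {r..<b}" using False by (auto simp: Q_def b_def)
      then have "card (Q \<inter> {1..<1 + 2 * l}) \<le> b - r" by (rule card_le_interval)
      then show ?thesis using l False r by (auto simp: b_def min_def split: if_splits)
    qed
  qed simp
  then have "T = Q" unfolding TQ refl_prefix_def by simp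
  then have "{0..<r} \<inter> Q \<noteq> {}" using cross[OF B T(1)] by simp
  then show False using r by (auto simp: Q_def)
qed

section \<open>Intersecting families of faces\<close>

definition del :: "'a set set \<Rightarrow> 'a \<Rightarrow> 'a set set" where
  "del X x = {B\<in>X. x \<notin> B}"

lemma card_lvl_link:
  assumes X: "\<And>A B. A \<in> X \<Longrightarrow> B \<subseteq> A \<Longrightarrow> B \<in> X" "\<And>A. A \<in> X \<Longrightarrow> finite A"
  shows "card {B \<in> lvl X (Suc i). x \<in> B} = card (lvl (link X {x}) i)"
proof (rule bij_betw_same_card)
  show "bij_betw (\<lambda>B. B - {x}) {B \<in> lvl X (Suc i). x \<in> B} (lvl (link X {x}) i)"
  proof (rule bij_betw_byWitness[where f' = "insert x"])
    show "(\<lambda>B. B - {x}) ` {B \<in> lvl X (Suc i). x \<in> B} \<subseteq> lvl (link X {x}) i"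
      using X(1)[OF _ Diff_subset] by (auto simp: lvl_def link_def insert_absorb)
    show "insert x ` lvl (link X {x}) i \<subseteq> {B \<in> lvl X (Suc i). x \<in> B}"
      using X(2) by (auto simp: lvl_def link_def)
  qed (auto simp: lvl_def link_def)
qed

lemma card_lvl_del:
  assumes X: "\<And>A B. A \<in> X \<Longrightarrow> B \<subseteq> A \<Longrightarrow> B \<in> X" "\<And>A. A \<in> X \<Longrightarrow> finite A" and fin: "finite X"
  shows "card (lvl X (Suc i)) = card (lvl (del X x) (Suc i)) + card (lvl (link X {x}) i)"
proof -
  have "lvl X (Suc i) = lvl (del X x) (Suc i) \<union> {B \<in> lvl X (Suc i). x \<in> B}"
    "lvl (del X x) (Suc i) \<inter> {B \<in> lvl X (Suc i). x \<in> B} = {}"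
    by (auto simp: lvl_def del_def)
  moreover have "finite (lvl (del X x) (Suc i))" "finite {B \<in> lvl X (Suc i). x \<in> B}"
    using fin by (simp_all add: lvl_def del_def)
  ultimately show ?thesis using card_lvl_link[of X i x] X card_Un_disjoint[of "lvl (del X x) (Suc i)" "{B \<in> lvl X (Suc i). x \<in> B}"]
    by (simp only:)
qed

lemma double_count:
  assumes "finite V" "finite \<A>" "\<And>A. A \<in> \<A> \<Longrightarrow> A \<subseteq> V \<and> card A = r"
  shows "(\<Sum>x\<in>V. card {A\<in>\<A>. x \<in> A}) = r * card \<A>"
proof -
  have "(\<Sum>x\<in>V. card {A\<in>\<A>. x \<in> A}) = (\<Sum>A\<in>\<A>. r)"
  proof (rule sum_multicount_gen[OF assms(1,2)], rule ballI)
    fix A assume "A \<in> \<A>"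
    then have "{x \<in> V. x \<in> A} = A" "card A = r" using assms(3) by auto
    then show "card {x \<in> V. x \<in> A} = r" by simp
  qed
  then show ?thesis by simp
qed

section \<open>Erdos-Ko-Rado bounds from generic initial families\<close>

locale generic_shift = ground V for V :: "'a::linorder set" +
  fixes \<phi> \<psi> :: "nat \<Rightarrow> 'a \<Rightarrow> 'k::field" and n :: nat
  assumes inf_k: "infinite (UNIV :: 'k set)" and gen: "generic n \<phi>" and sep: "separating n \<psi>"
begin

abbreviation I :: "'a set set \<Rightarrow> nat set set" where
  "I \<equiv> ini n \<phi>"

text \<open>M is the available depth; M \<le> n ensures that each inserted index belongs to a form,
  and the empty face starts the construction of small initial sets.\<close>

definition good :: "'a set set \<Rightarrow> nat \<Rightarrow> bool" where
  "good X M \<longleftrightarrow> cpx X \<and> {} \<in> X \<and> M \<le> n \<and> iterated_exact_wrt \<psi> X M"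

text \<open>The size of the target of the reflection. It depends only on face numbers in the depth
  range (\<open>Rc_Suc\<close>), and for a cone it counts the faces through the apex
  (\<open>Rc_cone\<close>).\<close>

definition Rc :: "'a set set \<Rightarrow> nat \<Rightarrow> nat" where
  "Rc X i = card {S \<in> I (lvl X i). 0 \<in> S}"

lemma good_cpx: "good X M \<Longrightarrow> cpx X"
  by (simp add: good_def)

lemma lvl_sub: "good X M \<Longrightarrow> lvl X i \<subseteq> lvl (Pow V) i"
  using cpx_sub by (auto simp: good_def lvl_def)

lemma card_I: "\<A> \<subseteq> lvl (Pow V) i \<Longrightarrow> card (I \<A>) = card \<A>"
  by (rule generic_card[OF gen sep])

lemma I_card: "\<A> \<subseteq> lvl (Pow V) i \<Longrightarrow> S \<in> I \<A> \<Longrightarrow> finite S \<and> card S = i"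
  using ini_card ini_fin by blast

lemma I_shifted:
  assumes "\<A> \<subseteq> lvl (Pow V) i"
  shows "shifted_from 0 (I \<A>)"
proof -
  have "\<A> \<subseteq> Pow V" using assms by (auto simp: lvl_def)
  then show ?thesis
    unfolding shifted_from_def by (intro ballI allI impI generic_shifted[OF inf_k gen])
qed

lemma I_insert:
  "good X M \<Longrightarrow> S \<in> I (lvl X i) \<Longrightarrow> (\<And>s. s \<in> S \<Longrightarrow> j < s) \<Longrightarrow> i + Suc j \<le> M \<Longrightarrow>
    insert j S \<in> I (lvl X (Suc i))"
  by (rule generic_insert[OF gen _ sep, of X M]) (auto simp: good_def)

text \<open>Elements of R are inserted from the largest down; each insertion raises i by one while
  the room below shrinks by one.\<close>

lemma I_prefix:
  assumes X: "good X M"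
  shows "S \<in> I (lvl X i) \<Longrightarrow> (\<And>s. s \<in> S \<Longrightarrow> j \<le> s) \<Longrightarrow> R \<subseteq> {..<j} \<Longrightarrow> i + j \<le> M \<Longrightarrow>
    R \<union> S \<in> I (lvl X (i + card R))"
proof (induction j arbitrary: i S R)
  case (Suc j)
  show ?case
  proof (cases "j \<in> R")
    case True
    have "insert j S \<in> I (lvl X (Suc i))"
      using Suc.prems by (intro I_insert[OF X]) (auto simp: Suc_le_eq)
    moreover have "j \<le> s" if "s \<in> insert j S" for s using that Suc.prems(2)[of s] by auto
    moreover have "R - {j} \<subseteq> {..<j}" using Suc.prems(3) by (auto simp: less_Suc_eq)
    moreover have "Suc i + j \<le> M" using Suc.prems by simp
    ultimately have "(R - {j}) \<union> insert j S \<in> I (lvl X (Suc i + card (R - {j})))" by (rule Suc.IH)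
    moreover have "(R - {j}) \<union> insert j S = R \<union> S" using True by blast
    moreover have "finite R" using Suc.prems(3) finite_subset by blast
    then have "card R = Suc (card (R - {j}))" by (rule card.remove[OF _ True])
    ultimately show ?thesis by simp
  next
    case False
    then have "R \<subseteq> {..<j}" using Suc.prems(3) by (auto simp: less_Suc_eq)
    moreover have "j \<le> s" if "s \<in> S" for s using Suc.prems(2)[OF that] by simp
    ultimately show ?thesis using Suc.prems by (intro Suc.IH) simp_all
  qed
qed simp

lemma I_empty:
  assumes X: "good X M" shows "{} \<in> I (lvl X 0)"
proof -
  have "lvl X 0 = {{}}"
    using X cpx_fin by (auto simp: good_def lvl_def)
  then have "card (I (lvl X 0)) = 1" using card_I[OF lvl_sub[OF X, of 0]] by simp
  then obtain S where S: "S \<in> I (lvl X 0)" by (metis card.empty ex_in_conv zero_neq_one)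
  then have "S = {}" using I_card[OF lvl_sub[OF X] S] by auto
  then show ?thesis using S by simp
qed

lemma I_small:
  assumes X: "good X M" and R: "R \<subseteq> {..<M}" "card R = i"
  shows "R \<in> I (lvl X i)"
  using I_prefix[OF X I_empty[OF X], of M R] R by simp

lemma I_suffix:
  assumes X: "good X M"
  shows "S \<in> I (lvl X i) \<Longrightarrow> {s\<in>S. j \<le> s} \<in> I (lvl X (card {s\<in>S. j \<le> s}))"
proof (induction j)
  case 0
  then show ?case using I_card[OF lvl_sub[OF X] 0] by simp
next
  case (Suc j)
  let ?A = "{s\<in>S. j \<le> s}" and ?B = "{s\<in>S. Suc j \<le> s}"
  have A: "?A \<in> I (lvl X (card ?A))" using Suc by simp
  have fin: "finite S" using ini_fin[OF Suc.prems] .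
  show ?case
  proof (cases "j \<in> S")
    case True
    then have e: "?B = ?A - {j}" by auto
    have "j \<in> ?A" using True by simp
    then have c: "card ?A = Suc (card ?B)" unfolding e using fin by (intro card.remove) simp_all
    have "?A \<in> I (lvl X (Suc (card ?B)))" using A by (simp only: c)
    then have "?A - {j} \<in> I (lvl X (card ?B))"
      by (rule ini_remove_min[OF good_cpx[OF X]]) (use True in simp_all)
    then show ?thesis unfolding e .
  next
    case False
    then have "?B = ?A" by (auto simp: Suc_le_eq le_less)
    then show ?thesis using A by simp
  qed
qed

lemma I_swap:
  assumes X: "good X M" and S: "S \<in> I (lvl X i)" and R: "R \<subseteq> {..<j}" and le: "card {s\<in>S. j \<le> s} + j \<le> M"
  shows "R \<union> {s\<in>S. j \<le> s} \<in> I (lvl X (card {s\<in>S. j \<le> s} + card R))"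
  by (rule I_prefix[OF X I_suffix[OF X S] _ R le]) simp

lemma kmax_card_le: "finite S \<Longrightarrow> kmax q S \<le> card S"
  using kmax_eq[of S q] card_mono[of S "S \<inter> {q..<q + 2 * kmax q S}"] by simp

lemma refl_parts:
  assumes S: "finite S" "S \<subseteq> {q..}"
  defines "j \<equiv> q + 2 * kmax q S"
  shows "refl_prefix q S = ({q..<j} - S) \<union> {s\<in>S. j \<le> s}"
    and "card {s\<in>S. j \<le> s} + kmax q S = card S" and "card ({q..<j} - S) = kmax q S"
proof -
  show "refl_prefix q S = ({q..<j} - S) \<union> {s\<in>S. j \<le> s}"
    using S(2) by (auto simp: refl_prefix_def j_def)
  have k: "card (S \<inter> {q..<j}) = kmax q S" unfolding j_def by (rule kmax_eq[OF S(1)])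
  have "S = {s\<in>S. j \<le> s} \<union> (S \<inter> {q..<j})" "{s\<in>S. j \<le> s} \<inter> (S \<inter> {q..<j}) = {}" using S(2) by auto
  then show "card {s\<in>S. j \<le> s} + kmax q S = card S"
    using card_Un_disjoint[of "{s\<in>S. j \<le> s}" "S \<inter> {q..<j}"] k S(1) by simp
  have "{q..<j} - S = {q..<j} - (S \<inter> {q..<j})" by blast
  then have "card ({q..<j} - S) = card {q..<j} - kmax q S" using k S(1) by (simp add: card_Diff_subset)
  then show "card ({q..<j} - S) = kmax q S" by (simp add: j_def)
qed

text \<open>With k = \<open>kmax 0 S\<close> the swap takes place below 2k and keeps i - k elements,
  so it needs (i - k) + 2k \<le> M, and k \<le> i.\<close>

lemma I_refl:
  assumes X: "good X M" and S: "S \<in> I (lvl X i)" and i: "2 * i \<le> M"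
  shows "refl_prefix 0 S \<in> I (lvl X i)"
proof -
  have c: "finite S" "card S = i" using I_card[OF lvl_sub[OF X] S] by simp_all
  have S0: "S \<subseteq> {0..}" by simp
  note p = refl_parts[OF c(1) S0]
  have "({0..<0 + 2 * kmax 0 S} - S) \<union> {s\<in>S. 0 + 2 * kmax 0 S \<le> s}
    \<in> I (lvl X (card {s\<in>S. 0 + 2 * kmax 0 S \<le> s} + card ({0..<0 + 2 * kmax 0 S} - S)))"
    by (rule I_swap[OF X S]) (use p(2) kmax_card_le[OF c(1), of 0] c(2) i in auto)
  then show ?thesis unfolding p(1) p(3) p(2) c(2) .
qed

text \<open>The new element 0 precedes the reflected prefix, which moves the swap by one place and
  accounts for the extra 1.\<close>

lemma I_refl_1:
  assumes X: "good X M" and S: "S \<in> I (lvl X i)" "0 \<notin> S" and i: "2 * i + 1 \<le> M"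
  shows "insert 0 (refl_prefix 1 S) \<in> I (lvl X (Suc i))"
proof -
  have c: "finite S" "card S = i" using I_card[OF lvl_sub[OF X] S(1)] by simp_all
  have S1: "S \<subseteq> {1..}" using S(2) by (auto simp: Suc_le_eq intro: gr0I)
  note p = refl_parts[OF c(1) S1]
  define j where "j = 1 + 2 * kmax 1 S"
  define R where "R = insert 0 ({1..<j} - S)"
  have R: "card R = Suc (kmax 1 S)" using p(3) by (simp add: R_def j_def)
  have "R \<subseteq> {..<j}" by (auto simp: R_def j_def)
  then have "R \<union> {s\<in>S. j \<le> s} \<in> I (lvl X (card {s\<in>S. j \<le> s} + card R))"
    by (rule I_swap[OF X S(1)]) (use p(2) kmax_card_le[OF c(1), of 1] c(2) i in \<open>simp add: j_def\<close>)
  moreover have "card {s\<in>S. j \<le> s} + card R = Suc i" using p(2) c(2) R by (simp add: j_def)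
  moreover have "R \<union> {s\<in>S. j \<le> s} = insert 0 (refl_prefix 1 S)" unfolding p(1) R_def j_def by simp
  ultimately show ?thesis by simp
qed

lemma Rc_0 [simp]:
  assumes "good X M" shows "Rc X 0 = 0"
proof -
  have "S = {}" if "S \<in> I (lvl X 0)" for S using I_card[OF lvl_sub[OF assms] that] by auto
  then have "{S \<in> I (lvl X 0). 0 \<in> S} = {}" by blast
  then show ?thesis unfolding Rc_def by (simp only: card.empty)
qed

lemma Rc_split:
  assumes X: "good X M"
  shows "card (lvl X i) = Rc X i + card (tail 1 (I (lvl X i)))"
proof -
  have t: "tail 1 (I (lvl X i)) = {S \<in> I (lvl X i). 0 \<notin> S}"
    by (auto simp: tail_def Suc_le_eq intro: gr0I)
  have "I (lvl X i) = {S \<in> I (lvl X i). 0 \<in> S} \<union> {S \<in> I (lvl X i). 0 \<notin> S}" by blast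
  moreover have "{S \<in> I (lvl X i). 0 \<in> S} \<inter> {S \<in> I (lvl X i). 0 \<notin> S} = {}" by blast
  ultimately have "card (I (lvl X i)) = Rc X i + card {S \<in> I (lvl X i). 0 \<notin> S}"
    unfolding Rc_def by (subst card_Un_disjoint[symmetric]) (simp_all add: finite_ini)
  then show ?thesis unfolding t card_I[OF lvl_sub[OF X]] .
qed

text \<open>Inserting 0 matches the initial i-sets avoiding 0 with the larger ones containing it.
  This makes \<open>Rc\<close> an alternating sum of face numbers, and its identities follow from
  those of faces.\<close>

lemma Rc_Suc:
  assumes X: "good X M" and i: "i < M"
  shows "Rc X (Suc i) + Rc X i = card (lvl X i)"
proof -
  have "\<forall>S\<in>tail (Suc 0) (I (lvl X i)). insert 0 S \<in> I (lvl X (Suc i))"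
    using i by (intro ballI I_insert[OF X]) (auto simp: tail_def Suc_le_eq)
  then have "card (I (lvl X (Suc i))) = card (tail 1 (I (lvl X (Suc i)))) + card (tail 1 (I (lvl X i)))"
    using tail_step(2)[OF good_cpx[OF X], of 0 n \<phi> i] by simp
  then show ?thesis using Rc_split[OF X, of "Suc i"] Rc_split[OF X, of i] card_I[OF lvl_sub[OF X], of "Suc i"] by simp
qed

lemma cpx_rules: "good X M \<Longrightarrow> A \<in> X \<Longrightarrow> B \<subseteq> A \<Longrightarrow> B \<in> X" "good X M \<Longrightarrow> A \<in> X \<Longrightarrow> finite A" "good X M \<Longrightarrow> finite X"
  by (rule cpx_down[OF good_cpx] cpx_fin[OF good_cpx] finite_cpx[OF good_cpx]; assumption)+

text \<open>Coning satisfies the same recursion: faces avoiding a correspond to faces one larger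
  through a.\<close>

lemma Rc_cone:
  assumes X: "good X M" and cone: "\<And>B. B \<in> X \<Longrightarrow> card B < M \<Longrightarrow> insert a B \<in> X"
  shows "i \<le> M \<Longrightarrow> Rc X i = card {B \<in> lvl X i. a \<in> B}"
proof (induction i)
  case 0
  have "{B \<in> lvl X 0. a \<in> B} = {}" using cpx_rules(2)[OF X] by (auto simp: lvl_def)
  then show ?case by (simp only: Rc_0[OF X] card.empty)
next
  case (Suc i)
  have "lvl X i = {B \<in> lvl X i. a \<in> B} \<union> {B \<in> lvl X i. a \<notin> B}" by blast
  moreover have "{B \<in> lvl X i. a \<in> B} \<inter> {B \<in> lvl X i. a \<notin> B} = {}" by blast
  ultimately have "card (lvl X i) = card {B \<in> lvl X i. a \<in> B} + card {B \<in> lvl X i. a \<notin> B}"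
    using finite_lvl[OF good_cpx[OF X], of i]
      card_Un_disjoint[of "{B \<in> lvl X i. a \<in> B}" "{B \<in> lvl X i. a \<notin> B}"] by simp
  then have "Rc X (Suc i) = card {B \<in> lvl X i. a \<notin> B}"
    using Rc_Suc[OF X, of i] Suc by simp
  also have "{B \<in> lvl X i. a \<notin> B} = lvl (link X {a}) i"
    using cone Suc.prems by (auto simp: lvl_def link_def)
  also have "card \<dots> = card {B \<in> lvl X (Suc i). a \<in> B}"
    using card_lvl_link[of X i a] cpx_rules[OF X] by simp
  finally show ?case .
qed

lemma Rc_del:
  assumes X: "good X M" and D: "good (del X x) M'" and L: "good (link X {x}) M'" and M': "M' \<le> M"
  shows "i < M' \<Longrightarrow> Rc X (Suc i) = Rc (del X x) (Suc i) + Rc (link X {x}) i"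
proof (induction i)
  case 0
  have e: "lvl (del X x) 0 = lvl X 0" using cpx_rules(2)[OF X] by (auto simp: lvl_def del_def)
  have "0 < M" using 0 M' by linarith
  show ?case
    using Rc_Suc[OF X \<open>0 < M\<close>] Rc_Suc[OF D 0] unfolding e Rc_0[OF X] Rc_0[OF D] Rc_0[OF L] by linarith
next
  case (Suc i)
  have c: "card (lvl X (Suc i)) = card (lvl (del X x) (Suc i)) + card (lvl (link X {x}) i)"
    by (rule card_lvl_del[OF cpx_rules[OF X]])
  have "Suc i < M" "i < M'" using Suc.prems M' by linarith+
  then show ?case
    using c Rc_Suc[OF X, of "Suc i"] Rc_Suc[OF D Suc.prems] Rc_Suc[OF L, of i] Suc.IH by linarith
qed

lemma ekr_shift:
  assumes X: "good X M" and r: "2 * r \<le> M" and \<A>: "\<A> \<subseteq> lvl X r" "intersecting \<A>"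
  shows "inj_on star_map (I \<A>)" and "star_map ` I \<A> \<subseteq> {S \<in> I (lvl X r). 0 \<in> S}"
    and "card (star_map ` I \<A>) = card \<A>"
proof -
  have sub: "\<A> \<subseteq> lvl (Pow V) r" using \<A>(1) lvl_sub[OF X] by blast
  have subV: "\<A> \<subseteq> Pow V" using sub by (auto simp: lvl_def)
  have int: "S \<inter> T \<noteq> {}" if "S \<in> I \<A>" "T \<in> I \<A>" for S T
    by (rule ini_cross[OF _ subV subV that]) (use \<A>(2) in \<open>auto simp: intersecting_def\<close>)
  have fin: "finite S" if "S \<in> I \<A>" for S using ini_fin[OF that] .
  show inj: "inj_on star_map (I \<A>)" by (rule star_map_inj(1)[OF I_shifted[OF sub] fin int])
  then show "card (star_map ` I \<A>) = card \<A>" using card_image card_I[OF sub] by metis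
  show "star_map ` I \<A> \<subseteq> {S \<in> I (lvl X r). 0 \<in> S}"
  proof (rule image_subsetI)
    fix S assume S: "S \<in> I \<A>"
    have "0 \<in> star_map S" by (rule star_map_inj(2)[OF I_shifted[OF sub] fin int S])
    moreover have "S \<in> I (lvl X r)" using S ini_mono[OF \<A>(1)] by blast
    then have "star_map S \<in> I (lvl X r)" using I_refl[OF X _ r] by (simp add: star_map_def)
    ultimately show "star_map S \<in> {S \<in> I (lvl X r). 0 \<in> S}" by simp
  qed
qed

lemma ekr_bound:
  assumes X: "good X M" and r: "2 * r \<le> M" and \<A>: "\<A> \<subseteq> lvl X r" "intersecting \<A>"
  shows "card \<A> \<le> Rc X r"
proof -
  have "card (star_map ` I \<A>) \<le> Rc X r"
    unfolding Rc_def by (rule card_mono[OF _ ekr_shift(2)[OF assms]]) (simp add: finite_ini)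
  then show ?thesis using ekr_shift(3)[OF assms] by simp
qed

text \<open>If no link family exceeded the bound of its link, double counting incidences would give at most the
  incidences of the star of \<open>a\<close>; but at \<open>a\<close> itself the bound is strictly smaller.\<close>

lemma ekr_strict:
  assumes X: "good X M" and r: "2 \<le> r" "2 * r + 1 \<le> M" and a: "a \<in> V"
    and cone: "\<And>B. B \<in> X \<Longrightarrow> card B < M \<Longrightarrow> insert a B \<in> X"
    and D: "\<And>x. x \<in> V \<Longrightarrow> good (del X x) (M - 1)" and L: "\<And>x. x \<in> V \<Longrightarrow> good (link X {x}) (M - 1)"
    and \<A>: "\<A> \<subseteq> lvl X r" "intersecting \<A>" and max: "card \<A> = Rc X r"
  shows "\<exists>v. \<forall>A\<in>\<A>. v \<in> A"
proof -
  have r2: "2 * r \<le> M" using r by simp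
  have sub: "\<A> \<subseteq> lvl (Pow V) r" using \<A>(1) lvl_sub[OF X] by blast
  have fin\<A>: "finite \<A>" using \<A>(1) finite_lvl[OF good_cpx[OF X]] by (rule finite_subset)
  define F where "F = card \<A>"
  have F: "F = card {B \<in> lvl X r. a \<in> B}" using Rc_cone[OF X cone, of r] max r by (simp add: F_def)
  \<comment> \<open>Equal cardinalities make the reflection onto, which puts the test set of
    \<open>shifted_maximum_star\<close> into its image.\<close>
  have surj: "star_map ` I \<A> = {S \<in> I (lvl X r). 0 \<in> S}"
    using ekr_shift(2,3)[OF X r2 \<A>] max unfolding Rc_def by (intro card_subset_eq) (simp_all add: finite_ini)
  have int: "S \<inter> T \<noteq> {}" if "S \<in> I \<A>" "T \<in> I \<A>" for S T
  proof (rule ini_cross[OF _ _ _ that])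
    show "\<A> \<subseteq> Pow V" "\<A> \<subseteq> Pow V" using sub by (auto simp: lvl_def)
  qed (use \<A>(2) in \<open>auto simp: intersecting_def\<close>)
  have star: "0 \<in> S" if "S \<in> I \<A>" for S
  proof (rule shifted_maximum_star[OF I_shifted[OF sub] I_card[OF sub] int r(1) _ that])
    have "{0} \<union> {r + 1..<2 * r - 1} \<union> {2 * r} = insert 0 (insert (2 * r) {r + 1..<2 * r - 1})" by auto
    moreover have "card (insert 0 (insert (2 * r) {r + 1..<2 * r - 1})) = r" using r by simp
    \<comment> \<open>The largest element of the test set is 2 * r, so it is initial because 2 * r +
      1 \<le> M.\<close>
    ultimately have "{0} \<union> {r + 1..<2 * r - 1} \<union> {2 * r} \<in> I (lvl X r)"
      using r by (intro I_small[OF X]) auto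
    then show "{0} \<union> {r + 1..<2 * r - 1} \<union> {2 * r} \<in> star_map ` I \<A>" unfolding surj by simp
  qed simp_all
  define \<A>x where "\<A>x x = (\<lambda>A. A - {x}) ` {A\<in>\<A>. x \<in> A}" for x
  have c\<A>x: "card (\<A>x x) = card {A\<in>\<A>. x \<in> A}" for x
    unfolding \<A>x_def by (rule card_image) (auto simp: inj_on_def)
  have AV: "A \<subseteq> V" "finite A" "card A = r" "A \<in> X" if "A \<in> \<A>" for A
    using that sub \<A>(1) finite_sub by (auto simp: lvl_def)
  have "\<exists>x\<in>V. Rc (link X {x}) (r - 1) < card (\<A>x x)"
  proof (rule ccontr)
    assume "\<not> ?thesis"
    then have le: "card {A\<in>\<A>. x \<in> A} \<le> Rc (link X {x}) (r - 1)" if "x \<in> V" for x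
      using that c\<A>x[of x] by (metis not_less)
    let ?G = "{B \<in> lvl X r. a \<in> B}"
    have "finite ?G" using finite_lvl[OF good_cpx[OF X], of r] by simp
    then have G: "(\<Sum>x\<in>V. card {B\<in>?G. x \<in> B}) = r * F"
      unfolding F by (rule double_count[OF finV]) (use lvl_sub[OF X, of r] in \<open>auto simp: lvl_def\<close>)
    \<comment> \<open>The link of x is again a cone with apex a below M - 1, so its bound counts the
      faces through both a and x.\<close>
    have "Rc (link X {x}) (r - 1) = card {B\<in>?G. x \<in> B}" if x: "x \<in> V - {a}" for x
    proof -
      have xV: "x \<in> V" using x by simp
      have "Rc (link X {x}) (r - 1) = card {B \<in> lvl (link X {x}) (r - 1). a \<in> B}"
      proof (rule Rc_cone[OF L[OF xV]])
        fix B assume B: "B \<in> link X {x}" "card B < M - 1"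
        then have B': "B \<in> X" "x \<notin> B" "insert x B \<in> X" by (auto simp: link_def)
        then have "insert a B \<in> X" "insert a (insert x B) \<in> X"
          using cone[of B] cone[of "insert x B"] B(2) cpx_rules(2)[OF X B'(1)] by simp_all
        then show "insert a B \<in> link X {x}" using B' x by (auto simp: link_def insert_commute)
      qed (use r in simp)
      also have "\<dots> = card (lvl (link (link X {x}) {a}) (r - 2))"
        using card_lvl_link[of "link X {x}" "r - 2" a] cpx_rules[OF L[OF xV]] r by (simp add: Suc_diff_Suc numeral_2_eq_2)
      also have "lvl (link (link X {x}) {a}) (r - 2) = lvl (link (link X {a}) {x}) (r - 2)"
        by (auto simp: lvl_def link_def insert_commute)
      also have "card \<dots> = card {B \<in> lvl (link X {a}) (r - 1). x \<in> B}"
        using card_lvl_link[of "link X {a}" "r - 2" x] cpx_rules[OF L[OF a]] r by (simp add: Suc_diff_Suc numeral_2_eq_2)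
      also have "\<dots> = card {B\<in>?G. x \<in> B}"
      proof (rule bij_betw_same_card)
        show "bij_betw (insert a) {B \<in> lvl (link X {a}) (r - 1). x \<in> B} {B\<in>?G. x \<in> B}"
        proof (rule bij_betw_byWitness[where f' = "\<lambda>B. B - {a}"])
          show "insert a ` {B \<in> lvl (link X {a}) (r - 1). x \<in> B} \<subseteq> {B\<in>?G. x \<in> B}"
            using cpx_rules(2)[OF X] r by (auto simp: lvl_def link_def)
          show "(\<lambda>B. B - {a}) ` {B\<in>?G. x \<in> B} \<subseteq> {B \<in> lvl (link X {a}) (r - 1). x \<in> B}"
            using cpx_rules(1)[OF X _ Diff_subset] x by (auto simp: lvl_def link_def insert_absorb)
        qed (auto simp: lvl_def link_def)
      qed
      finally show ?thesis .
    qed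
    then have "(\<Sum>x\<in>V - {a}. Rc (link X {x}) (r - 1)) = (\<Sum>x\<in>V - {a}. card {B\<in>?G. x \<in> B})"
      by (rule sum.cong[OF refl])
    moreover have "r * F = card {B\<in>?G. a \<in> B} + (\<Sum>x\<in>V - {a}. card {B\<in>?G. x \<in> B})"
      unfolding G[symmetric] by (rule sum.remove[OF finV a])
    moreover have "{B\<in>?G. a \<in> B} = ?G" by blast
    ultimately have 1: "(\<Sum>x\<in>V - {a}. Rc (link X {x}) (r - 1)) + F = r * F" using F by simp
    have "F = card (lvl (link X {a}) (r - 1))"
      unfolding F using card_lvl_link[of X "r - 1" a] cpx_rules[OF X] r by simp
    \<comment> \<open>The interval {1..<r} is initial in the link of a and avoids 0, so strictly
      fewer sets than the whole level contain 0.\<close>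
    moreover have "{1..<r} \<in> tail 1 (I (lvl (link X {a}) (r - 1)))"
      using r by (auto simp: tail_def intro!: I_small[OF L[OF a]])
    then have "card (tail 1 (I (lvl (link X {a}) (r - 1)))) \<noteq> 0"
      by (auto simp: tail_def finite_ini)
    ultimately have 2: "Rc (link X {a}) (r - 1) < F" using Rc_split[OF L[OF a], of "r - 1"] by simp
    have "r * F = (\<Sum>x\<in>V. card {A\<in>\<A>. x \<in> A})"
      unfolding F_def using double_count[OF finV fin\<A>, of r] AV by simp
    also have "\<dots> \<le> (\<Sum>x\<in>V. Rc (link X {x}) (r - 1))" by (rule sum_mono[OF le])
    also have "\<dots> = Rc (link X {a}) (r - 1) + (\<Sum>x\<in>V - {a}. Rc (link X {x}) (r - 1))"
      by (rule sum.remove[OF finV a])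
    finally show False using 1 2 by simp
  qed
  then obtain x where x: "x \<in> V" "Rc (link X {x}) (r - 1) < card (\<A>x x)" by blast
  have subx: "\<A>x x \<subseteq> lvl (link X {x}) (r - 1)"
    using AV cpx_rules(1)[OF X _ Diff_subset] by (auto simp: \<A>x_def lvl_def link_def insert_absorb)
  have subx': "\<A>x x \<subseteq> lvl (Pow V) (r - 1)" using subx lvl_sub[OF L[OF x(1)]] by blast
  \<comment> \<open>These members are to be shown absent: their initial sets meet those of the link
    family, some of which avoid 0 by the choice of x.\<close>
  define \<B> where "\<B> = {A\<in>\<A>. x \<notin> A}"
  have subB: "\<B> \<subseteq> lvl (del X x) r" using \<A>(1) by (auto simp: \<B>_def lvl_def del_def)
  have subB': "\<B> \<subseteq> lvl (Pow V) r" using sub by (auto simp: \<B>_def)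
  define \<Y> where "\<Y> = {T \<in> I (\<A>x x). 0 \<notin> T}"
  define \<X> where "\<X> = {S \<in> I (lvl (del X x) r). 0 \<in> S}"
  have card\<Y>: "card (\<A>x x) \<le> card \<Y> + Rc (link X {x}) (r - 1)"
  proof -
    have "card (\<A>x x) = card (I (\<A>x x))" using card_I[OF subx'] by simp
    also have "I (\<A>x x) = \<Y> \<union> {T \<in> I (\<A>x x). 0 \<in> T}" by (auto simp: \<Y>_def)
    also have "card (\<Y> \<union> {T \<in> I (\<A>x x). 0 \<in> T}) \<le> card \<Y> + card {T \<in> I (\<A>x x). 0 \<in> T}" by (rule card_Un_le)
    also have "card {T \<in> I (\<A>x x). 0 \<in> T} \<le> Rc (link X {x}) (r - 1)"
      unfolding Rc_def using ini_mono[OF subx, of n \<phi>] by (intro card_mono) (auto simp: finite_ini)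
    finally show ?thesis by simp
  qed
  have "I \<B> = {}"
  proof (rule shifted_deletion_empty[where \<Y> = \<Y> and \<X> = \<X>])
    show "shifted_from 0 (I \<B>)" by (rule I_shifted[OF subB'])
    show "finite S \<and> card S = r" if "S \<in> I \<B>" for S by (rule I_card[OF subB' that])
    show "shifted_from 1 \<Y>"
      using I_shifted[OF subx'] unfolding shifted_from_def \<Y>_def by auto
    show "finite T \<and> card T = r - 1 \<and> 0 \<notin> T" if "T \<in> \<Y>" for T
      using that I_card[OF subx'] unfolding \<Y>_def by blast
    show "\<Y> \<noteq> {}" using card\<Y> x(2) by auto
    show "S \<inter> T \<noteq> {}" if "S \<in> I \<B>" "T \<in> \<Y>" for S T
    proof (rule ini_cross)
      show "S \<in> I \<B>" by fact
      show "T \<in> I (\<A>x x)" using that(2) by (simp add: \<Y>_def)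
      show "\<B> \<subseteq> Pow V" "\<A>x x \<subseteq> Pow V" using subB' subx' by (auto simp: lvl_def)
      fix A B assume "A \<in> \<B>" "B \<in> \<A>x x"
      then obtain A' where "A \<in> \<A>" "x \<notin> A" "A' \<in> \<A>" "B = A' - {x}" by (auto simp: \<B>_def \<A>x_def)
      moreover from this have "A \<inter> A' \<noteq> {}" using \<A>(2) by (auto simp: intersecting_def)
      ultimately show "A \<inter> B \<noteq> {}" by blast
    qed
    show "2 \<le> r" by (rule r(1))
    show "finite \<X>" by (simp add: \<X>_def finite_ini)
    show "I \<B> \<subseteq> \<X>"
    proof
      fix S assume S: "S \<in> I \<B>"
      have "\<B> \<subseteq> \<A>" by (auto simp: \<B>_def)
      then have "0 \<in> S" using S star ini_mono by blast
      then show "S \<in> \<X>" using S ini_mono[OF subB] by (auto simp: \<X>_def)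
    qed
    show "insert 0 (refl_prefix 1 T) \<in> \<X>" if T: "T \<in> \<Y>" for T
    proof -
      have "lvl (link X {x}) (r - 1) \<subseteq> lvl (del X x) (r - 1)" by (auto simp: lvl_def link_def del_def)
      then have "T \<in> I (lvl (del X x) (r - 1))" "0 \<notin> T"
        using T subx ini_mono[of "\<A>x x" "lvl (del X x) (r - 1)" n \<phi>] by (auto simp: \<Y>_def)
      then have "insert 0 (refl_prefix 1 T) \<in> I (lvl (del X x) (Suc (r - 1)))"
        using r by (intro I_refl_1[OF D[OF x(1)]]) simp_all
      then show ?thesis using r by (simp add: \<X>_def)
    qed
    \<comment> \<open>\<open>Rc\<close> splits into deletion and link just as \<open>\<A>\<close>
      splits into members avoiding and containing x; maximality compares the two.\<close>
    have "Rc X (Suc (r - 1)) = Rc (del X x) (Suc (r - 1)) + Rc (link X {x}) (r - 1)"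
      using r by (intro Rc_del[OF X D[OF x(1)] L[OF x(1)]]) simp_all
    moreover have "\<A> = \<B> \<union> {A\<in>\<A>. x \<in> A}" "\<B> \<inter> {A\<in>\<A>. x \<in> A} = {}" by (auto simp: \<B>_def)
    then have "card \<A> = card \<B> + card (\<A>x x)"
      unfolding c\<A>x using fin\<A> card_Un_disjoint[of \<B> "{A\<in>\<A>. x \<in> A}"] by (simp add: \<B>_def)
    ultimately show "card \<X> \<le> card (I \<B>) + card \<Y>"
      using card\<Y> max r card_I[OF subB'] by (simp add: \<X>_def Rc_def)
    have "{0} \<union> {r..<2 * r - 2} \<union> {2 * r - 1} = insert 0 (insert (2 * r - 1) {r..<2 * r - 2})" by auto
    moreover have "2 * r - 1 \<notin> {r..<2 * r - 2}" by auto
    then have "card (insert 0 (insert (2 * r - 1) {r..<2 * r - 2})) = r" using r by simp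
    ultimately have "{0} \<union> {r..<2 * r - 2} \<union> {2 * r - 1} \<in> I (lvl (del X x) r)"
      using r by (intro I_small[OF D[OF x(1)]]) auto
    then show "{0} \<union> {r..<2 * r - 2} \<union> {2 * r - 1} \<in> \<X>" by (simp add: \<X>_def)
  qed
  then have "card \<B> = 0" using card_I[OF subB'] by simp
  moreover have "finite \<B>" using fin\<A> by (simp add: \<B>_def)
  ultimately have "\<B> = {}" by simp
  then show ?thesis by (intro exI[of _ x]) (auto simp: \<B>_def)
qed

end

section \<open>Cohen-Macaulay complexes and near-cones\<close>

text \<open>The field may be finite, hence is replaced by a field of rational functions.\<close>

definition emb :: "'k::field \<Rightarrow> 'k poly fract" where
  "emb c = Fraction_Field.Fract [:c:] 1"

lemma emb_add: "emb (x + y) = emb x + emb y"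
  by (simp add: emb_def)

lemma emb_mult: "emb (x * y) = emb x * emb y"
  by (simp add: emb_def mult.commute)

lemma emb_one: "emb 1 = 1"
  by (simp add: emb_def One_fract_def pCons_one)

lemma infinite_poly_fract: "infinite (UNIV :: 'k::field poly fract set)"
proof -
  have "inj (\<lambda>m::nat. Fraction_Field.Fract (monom 1 m :: 'k poly) 1)"
    by (rule injI) (simp add: eq_fract monom_eq_iff')
  then show ?thesis by (rule range_inj_infinite[THEN infinite_super[rotated]]) simp
qed

lemma ex_inj_on_infinite:
  assumes "finite V" "infinite (UNIV :: 'b set)"
  shows "\<exists>\<alpha> :: 'a \<Rightarrow> 'b. inj_on \<alpha> V"
proof -
  obtain g :: "nat \<Rightarrow> 'b" where g: "inj g" using infinite_countable_subset[OF assms(2)] by blast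
  obtain h :: "'a \<Rightarrow> nat" where h: "inj_on h V" using finite_imp_inj_to_nat_seg[OF assms(1)] by blast
  have "inj_on (g \<circ> h) V" using h g by (intro comp_inj_on) (auto intro: inj_on_subset)
  then show ?thesis by blast
qed

section \<open>Exactness on the moment curve\<close>

context ground
begin

text \<open>Lagrange interpolation: the polynomial that is 1 at \<alpha> v and 0 at the other nodes
  expresses \<open>delta v\<close> by powers of \<alpha>.\<close>

lemma separating_moment:
  fixes \<alpha> :: "'a \<Rightarrow> 'k::field"
  assumes inj: "inj_on \<alpha> V"
  shows "separating (card V) (\<lambda>t v. \<alpha> v ^ t)"
  unfolding separating_def
proof
  fix v assume v: "v \<in> V"
  define q where "q = (\<Prod>w\<in>V - {v}. smult (inverse (\<alpha> v - \<alpha> w)) [:- \<alpha> w, 1:])"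
  have "degree q \<le> (\<Sum>w\<in>V - {v}. degree (smult (inverse (\<alpha> v - \<alpha> w)) [:- \<alpha> w, 1:]))"
    unfolding q_def using degree_prod_sum_le[of "V - {v}" "\<lambda>w. smult (inverse (\<alpha> v - \<alpha> w)) [:- \<alpha> w, 1:]"]
    by (simp add: o_def)
  also have "\<dots> \<le> (\<Sum>w\<in>V - {v}. 1)"
    by (rule sum_mono) (simp add: degree_smult_le[THEN order_trans])
  finally have "degree q \<le> card (V - {v})" by simp
  moreover have "Suc (card (V - {v})) = card V" using v by (intro card_Suc_Diff1) simp_all
  ultimately have deg: "degree q < card V" by linarith
  have "delta v x = (\<Sum>l<card V. coeff q l * \<alpha> x ^ l)" if x: "x \<in> V" for x
  proof -
    have "poly q (\<alpha> x) = delta v x"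
    proof (cases "x = v")
      case True
      have "inverse (\<alpha> v - \<alpha> w) * (\<alpha> v - \<alpha> w) = 1" if "w \<in> V - {v}" for w
        using that v inj by (intro left_inverse) (auto simp: inj_on_def)
      then have "(\<Prod>w\<in>V - {v}. inverse (\<alpha> v - \<alpha> w) * (\<alpha> v - \<alpha> w)) = 1" by (intro prod.neutral) blast
      then show ?thesis using True by (simp add: q_def poly_prod delta_def algebra_simps)
    next
      case False
      then have "(\<Prod>w\<in>V - {v}. inverse (\<alpha> v - \<alpha> w) * (\<alpha> x - \<alpha> w)) = 0"
        using x by (intro prod_zero) auto
      then show ?thesis using False by (simp add: q_def poly_prod delta_def)
    qed
    moreover have "poly q (\<alpha> x) = (\<Sum>l<card V. coeff q l * \<alpha> x ^ l)"
      unfolding poly_altdef using deg by (intro sum.mono_neutral_left) (auto simp: coeff_eq_0 not_le)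
    ultimately show ?thesis by simp
  qed
  then show "\<exists>c. \<forall>x\<in>V. delta v x = (\<Sum>l<card V. c l * \<alpha> x ^ l)" by blast
qed

lemma poly_chains_intro:
  fixes \<alpha> :: "'a \<Rightarrow> 'k::field"
  assumes "inj_on \<alpha> V" "infinite (UNIV :: 'k set)" "cpx X" "links_exact TYPE('k) X m"
  shows "poly_chains V \<alpha> X m"
proof (unfold_locales)
  show "exact f X i" if "i + card {v \<in> V. f v = 0} < m" for f :: "'a \<Rightarrow> 'k" and i
    by (rule exact_weights[OF assms(3,4) that])
qed (use assms in simp_all)

lemma iterated_exact_moment:
  fixes \<alpha> :: "'a \<Rightarrow> 'k::field"
  assumes "inj_on \<alpha> V" "infinite (UNIV :: 'k set)" "cpx X" "links_exact TYPE('k) X m"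
  shows "iterated_exact_wrt (\<lambda>t v. \<alpha> v ^ t) X m"
  unfolding iterated_exact_wrt_def
proof (intro allI impI)
  interpret poly_chains V \<alpha> X m by (rule poly_chains_intro[OF assms])
  fix i j u assume "i + Suc j \<le> m" "supp u (lvl X i)" "\<forall>t\<le>j. \<forall>B. bd (\<lambda>v. \<alpha> v ^ t) u B = 0"
  then show "\<exists>b. supp b (lvl X (Suc i)) \<and> (\<forall>t<j. \<forall>B. bd (\<lambda>v. \<alpha> v ^ t) b B = 0) \<and> (\<forall>B. bd (\<lambda>v. \<alpha> v ^ j) b B = u B)"
    using iterated_exact[of i j "\<lambda>_. 1" u] by simp
qed

text \<open>Deletion of a vertex costs one unit of depth: give the vertex weight zero.\<close>

lemma iterated_exact_moment_del:
  fixes \<alpha> :: "'a \<Rightarrow> 'k::field"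
  assumes "inj_on \<alpha> V" "infinite (UNIV :: 'k set)" "cpx X" "links_exact TYPE('k) X m" and x: "x \<in> V"
  shows "iterated_exact_wrt (\<lambda>t v. \<alpha> v ^ t) (del X x) (m - 1)"
  unfolding iterated_exact_wrt_def
proof (intro allI impI)
  interpret poly_chains V \<alpha> X m by (rule poly_chains_intro[OF assms(1-4)])
  fix i j u assume ij: "i + Suc j \<le> m - 1" and u: "supp u (lvl (del X x) i)"
    and cyc: "\<forall>t\<le>j. \<forall>B. bd (\<lambda>v. \<alpha> v ^ t) u B = 0"
  define c where "c v = (if v = x then 0 else 1 :: 'k)" for v
  have "{v\<in>V. c v = 0} = {x}" using x by (auto simp: c_def)
  then have i: "i + Suc j + card {v\<in>V. c v = 0} \<le> m" using ij by simp
  have bdc: "bd (\<lambda>v. c v * \<alpha> v ^ t) w B = bd (\<lambda>v. \<alpha> v ^ t) w B"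
    if w: "\<And>A. x \<in> A \<Longrightarrow> w A = 0" for w t B
  proof -
    have "osign v B * (c v * \<alpha> v ^ t) * w (insert v B) = osign v B * \<alpha> v ^ t * w (insert v B)" for v
      using w[of "insert x B"] by (simp add: c_def)
    then show ?thesis unfolding bd_def by (simp only:)
  qed
  have u0: "u A = 0" if "x \<in> A" for A
    by (rule suppD[OF u]) (use that in \<open>simp add: lvl_def del_def\<close>)
  have "lvl (del X x) i \<subseteq> lvl X i" by (auto simp: lvl_def del_def)
  then have "supp u (lvl X i)" by (rule supp_mono[OF u])
  then obtain b where b: "supp b (lvl X (Suc i))" "\<And>t B. t < j \<Longrightarrow> bd (\<lambda>v. c v * \<alpha> v ^ t) b B = 0"
    "\<And>B. bd (\<lambda>v. c v * \<alpha> v ^ j) b B = u B"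
    using iterated_exact[OF i, of u] cyc bdc[of u, OF u0] by auto
  \<comment> \<open>With weight zero at x, discarding the faces through x does not affect the
    boundary at faces avoiding x, and u lives only on those.\<close>
  define b' where "b' A = (if x \<in> A then 0 else b A)" for A
  have b'0: "b' A = 0" if "x \<in> A" for A using that by (simp add: b'_def)
  have bb: "bd (\<lambda>v. \<alpha> v ^ t) b' B = (if x \<in> B then 0 else bd (\<lambda>v. c v * \<alpha> v ^ t) b B)" for t B
  proof (cases "x \<in> B")
    case True
    then show ?thesis by (simp add: bd_def b'_def)
  next
    case False
    have "osign v B * (c v * \<alpha> v ^ t) * b' (insert v B) = osign v B * (c v * \<alpha> v ^ t) * b (insert v B)" for v
      using False by (simp add: c_def b'_def)
    then have "bd (\<lambda>v. c v * \<alpha> v ^ t) b' B = bd (\<lambda>v. c v * \<alpha> v ^ t) b B" unfolding bd_def by (simp only:)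
    then show ?thesis using bdc[of b', OF b'0] False by simp
  qed
  have "supp b' (lvl (del X x) (Suc i))"
  proof (rule suppI)
    fix A assume "A \<notin> lvl (del X x) (Suc i)"
    then have "x \<in> A \<or> A \<notin> lvl X (Suc i)" by (auto simp: lvl_def del_def)
    then show "b' A = 0" using suppD[OF b(1)] by (auto simp: b'_def)
  qed
  moreover have "bd (\<lambda>v. \<alpha> v ^ t) b' B = 0" if "t < j" for t B using b(2)[OF that] bb by simp
  moreover have "bd (\<lambda>v. \<alpha> v ^ j) b' B = u B" for B using b(3) bb u0 by simp
  ultimately show "\<exists>b. supp b (lvl (del X x) (Suc i)) \<and> (\<forall>t<j. \<forall>B. bd (\<lambda>v. \<alpha> v ^ t) b B = 0) \<and>
      (\<forall>B. bd (\<lambda>v. \<alpha> v ^ j) b B = u B)" by blast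
qed

section \<open>Reduced homology, exactness and purity\<close>

lemma bdry_bd:
  assumes X: "cpx X" and u: "supp u X" and B: "B \<in> X"
  shows "bdry X u B = bd (\<lambda>_. 1) u B"
proof -
  have "(\<Sum>v\<in>{v. v \<notin> B \<and> insert v B \<in> X}. osign v B * u (insert v B)) = (\<Sum>v\<in>V - B. osign v B * u (insert v B))"
  proof (rule sum.mono_neutral_left)
    show "{v. v \<notin> B \<and> insert v B \<in> X} \<subseteq> V - B" using cpx_sub[OF X] by blast
    show "\<forall>v\<in>V - B - {v. v \<notin> B \<and> insert v B \<in> X}. osign v B * u (insert v B) = 0"
      using suppD[OF u] by auto
  qed simp
  then show ?thesis using cpx_sub[OF X B] by (simp add: bdry_def bd_def)
qed

lemma exact_of_rhom:
  assumes X: "cpx X" and rh: "rhom_vanish (F :: 'k::field itself) X i"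
  shows "exact (\<lambda>_. 1 :: 'k) X i"
proof (rule exactI)
  fix u :: "'a set \<Rightarrow> 'k" assume u: "supp u (lvl X i)" and cyc: "\<And>B. bd (\<lambda>_. 1) u B = 0"
  have lX: "lvl X j \<subseteq> X" for j by (auto simp: lvl_def)
  have "bdry X u B = 0" if "B \<in> X" for B using bdry_bd[OF X supp_mono[OF u lX] that] cyc by simp
  then obtain b :: "'a set \<Rightarrow> 'k" where b: "\<And>A. A \<in> X \<Longrightarrow> card A = i \<Longrightarrow> bdry X b A = u A"
    using rh unfolding rhom_vanish_def by blast
  \<comment> \<open>\<open>rhom_vanish\<close> leaves b arbitrary off the level above; truncation
    does not change the boundary at level i.\<close>
  define b' where "b' = vec (lvl X (Suc i)) b"
  have b': "supp b' (lvl X (Suc i))" by (simp add: supp_def b'_def vec_def)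
  have "bd (\<lambda>_. 1) b' A = u A" for A
  proof (cases "A \<in> lvl X i")
    case True
    then have A: "A \<in> X" "card A = i" by (simp_all add: lvl_def)
    have "bdry X b' A = bdry X b A"
      unfolding bdry_def using A cpx_fin[OF X A(1)] by (intro sum.cong) (auto simp: b'_def vec_def lvl_def)
    then show ?thesis using bdry_bd[OF X supp_mono[OF b' lX] A(1)] b[OF A] by simp
  next
    case False
    then show ?thesis using suppD[OF u False] suppD[OF supp_bd[OF X b'], of A] by simp
  qed
  then show "\<exists>b. supp b (lvl X (Suc i)) \<and> (\<forall>B. bd (\<lambda>_. 1) b B = u B)" using b' by blast
qed

lemma maxcard_ge: "cpx X \<Longrightarrow> A \<in> X \<Longrightarrow> card A \<le> maxcard X"
  unfolding maxcard_def using finite_cpx by (intro Max_ge) auto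

lemma maxcard_attained:
  assumes "cpx X" "X \<noteq> {}" shows "\<exists>A\<in>X. card A = maxcard X"
proof -
  have "maxcard X \<in> card ` X"
    unfolding maxcard_def using finite_cpx[OF assms(1)] assms(2) by (intro Max_in) auto
  then show ?thesis by force
qed

text \<open>Purity: at a maximal face having both extendable and non-extendable vertices in its link,
  the link would be disconnected.\<close>

lemma pure_of_connected_links:
  assumes X: "cpx X" and ne: "X \<noteq> {}"
    and conn: "\<And>U. U \<in> X \<Longrightarrow> 1 < maxcard (link X U) \<Longrightarrow> exact (\<lambda>_. 1 :: 'k::field) (link X U) 1"
    and U: "U \<in> X"
  shows "\<exists>C\<in>X. U \<subseteq> C \<and> card C = maxcard X"
proof (rule ccontr)
  assume nf: "\<not> ?thesis"
  define full where "full U \<longleftrightarrow> (\<exists>C\<in>X. U \<subseteq> C \<and> card C = maxcard X)" for U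
  define P where "P U \<longleftrightarrow> U \<in> X \<and> full U \<and> (\<exists>v. v \<notin> U \<and> insert v U \<in> X \<and> \<not> full (insert v U))" for U
  have "full {}" using maxcard_attained[OF X ne] by (auto simp: full_def)
  have "finite U" by (rule cpx_fin[OF X U])
  moreover have "\<not> full U" using nf by (simp add: full_def)
  ultimately have "\<exists>U'. P U'" using U
  proof (induction U rule: finite_induct)
    case empty
    then show ?case using \<open>full {}\<close> by simp
  next
    case (insert v U)
    have "U \<in> X" using cpx_down[OF X insert.prems(2)] by blast
    then show ?case using insert by (cases "full U") (auto simp: P_def)
  qed
  then obtain U1 where U1: "P U1" ..
  have "\<forall>U. P U \<longrightarrow> card U < Suc (maxcard X)"
    using maxcard_ge[OF X] by (simp add: P_def less_Suc_eq_le)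
  \<comment> \<open>Maximality of \<open>U0\<close> among the full faces with a non-full extension
    makes badness spread along the edges of the link.\<close>
  from ex_has_greatest_nat[of P U1 card, OF U1 this]
  obtain U0 where U0: "P U0" and max: "\<And>U. P U \<Longrightarrow> card U \<le> card U0" by blast
  obtain v where v: "U0 \<in> X" "v \<notin> U0" "insert v U0 \<in> X" "\<not> full (insert v U0)" using U0 by (auto simp: P_def)
  obtain C where C: "C \<in> X" "U0 \<subseteq> C" "card C = maxcard X" using U0 by (auto simp: P_def full_def)
  have finU0: "finite U0" by (rule cpx_fin[OF X v(1)])
  define Y where "Y = link X U0"
  have Y: "cpx Y" unfolding Y_def by (rule cpx_link[OF X])
  have "card (insert v U0) \<le> maxcard X" by (rule maxcard_ge[OF X v(3)])
  moreover have "card (insert v U0) \<noteq> maxcard X" using v(3,4) by (auto simp: full_def)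
  ultimately have "2 \<le> card C - card U0" using C(3) v(2) finU0 by simp
  then have CU: "2 \<le> card (C - U0)" using C(2) finU0 by (simp add: card_Diff_subset)
  have "C - U0 \<in> Y"
    using C cpx_down[OF X C(1), of "C - U0"] by (simp add: Y_def link_def Un_absorb1)
  then have "1 < maxcard Y" using maxcard_ge[OF Y] CU by fastforce
  then have ex: "exact (\<lambda>_. 1 :: 'k) Y 1" using conn[OF v(1)] by (simp add: Y_def)
  have "C - U0 \<noteq> {}" using CU by (metis card.empty not_numeral_le_zero)
  then obtain w where w: "w \<in> C" "w \<notin> U0" by blast
  have wX: "insert w U0 \<in> X" using cpx_down[OF X C(1)] w C(2) by blast
  have wfull: "full (insert w U0)" using C w by (auto simp: full_def)
  define bad where "bad x \<longleftrightarrow> \<not> full (insert x U0)" for x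
  have vw: "v \<noteq> w" using v(4) wfull by blast
  have edge: "bad y" if e: "{x, y} \<in> Y" "x \<noteq> y" "bad x" for x y
  proof (rule ccontr)
    assume "\<not> bad y"
    then have fy: "full (insert y U0)" by (simp add: bad_def)
    have e': "x \<notin> U0" "y \<notin> U0" "insert x (insert y U0) \<in> X" using e(1) by (auto simp: Y_def link_def)
    have "insert y U0 \<in> X" using cpx_down[OF X e'(3)] by blast
    moreover have "\<not> full (insert x (insert y U0))" using e(3) by (auto simp: bad_def full_def)
    ultimately have "P (insert y U0)" using fy e' e(2) by (auto simp: P_def)
    then show False using max[of "insert y U0"] finU0 e'(2) by simp
  qed
  \<comment> \<open>Of the two vertices w is extendable to full size and v is not. Their difference
    is a cycle, so it bounds in the link.\<close>
  define c :: "'a set \<Rightarrow> 'k" where "c A = (if A = {w} then 1 else 0) - (if A = {v} then 1 else 0)" for A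
  have sing: "{v} \<in> lvl Y 1" "{w} \<in> lvl Y 1"
    using v w wX cpx_down[OF X v(3), of "{v}"] cpx_down[OF X wX, of "{w}"] by (simp_all add: lvl_def Y_def link_def)
  have vV: "v \<in> V" "w \<in> V" using cpx_sub[OF X v(3)] cpx_sub[OF X wX] by simp_all
  have bde: "bd (\<lambda>_. 1 :: 'k) f {} = (\<Sum>x\<in>V. f {x})" for f :: "'a set \<Rightarrow> 'k"
    by (simp add: bd_def osign_def)
  have sc: "supp c (lvl Y 1)" using sing by (auto simp: supp_def c_def)
  have "bd (\<lambda>_. 1) c B = 0" for B
  proof (cases "B = {}")
    case True
    have "(\<Sum>x\<in>V. c {x}) = (\<Sum>x\<in>V. if x = w then 1 else 0) - (\<Sum>x\<in>V. if x = v then 1 else 0)"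
      unfolding sum_subtractf[symmetric] by (intro sum.cong) (simp_all add: c_def)
    also have "\<dots> = 0" using vV by simp
    finally show ?thesis unfolding True bde .
  next
    case False
    have "supp (bd (\<lambda>_. 1) c) (lvl Y 0)" using supp_bd[OF Y sc] by simp
    moreover have "B \<notin> lvl Y 0" using False cpx_fin[OF Y] by (auto simp: lvl_def)
    ultimately show ?thesis by (rule suppD)
  qed
  from exactE[OF ex sc this] obtain b where b: "supp b (lvl Y (Suc 1))" "\<And>B. bd (\<lambda>_. 1) b B = c B" by blast
  \<comment> \<open>No edge joins a bad vertex to another kind, so the bad part of b has boundary
    -{v}, whose augmentation is not zero.\<close>
  define b' where "b' A = (if \<forall>x\<in>A. bad x then b A else 0)" for A
  have b': "bd (\<lambda>_. 1) b' {x} = (if bad x then c {x} else 0)" for x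
  proof (cases "bad x")
    case True
    have "b' (insert y {x}) = b (insert y {x})" if "y \<in> V - {x}" for y
    proof (cases "{x, y} \<in> Y")
      case True
      then have "bad y" using edge[OF True _ \<open>bad x\<close>] that by blast
      then show ?thesis using \<open>bad x\<close> by (simp add: b'_def)
    next
      case False
      then have "b (insert y {x}) = 0" by (intro suppD[OF b(1)]) (simp add: lvl_def insert_commute)
      then show ?thesis by (simp add: b'_def)
    qed
    then have "bd (\<lambda>_. 1) b' {x} = bd (\<lambda>_. 1) b {x}" by (simp add: bd_def)
    then show ?thesis using b(2) True by simp
  next
    case False
    then show ?thesis by (simp add: bd_def b'_def)
  qed
  have "bd (\<lambda>_. 1 :: 'k) (bd (\<lambda>_. 1) b') {} = 0" by simp
  then have "(\<Sum>x\<in>V. if bad x then c {x} else 0) = 0" unfolding bde b' .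
  moreover have "(\<Sum>x\<in>V. if bad x then c {x} else 0) = (\<Sum>x\<in>V. if x = v then -1 else 0)"
    using v(4) wfull vw by (intro sum.cong) (auto simp: c_def bad_def)
  ultimately show False using vV by simp
qed

end

section \<open>Depth, skeleta and near-cones\<close>

lemma cohen_macaulay_skel_0:
  fixes \<Delta> :: "'a::linorder set set"
  assumes "simplicial_complex \<Delta>" "\<forall>A\<in>\<Delta>. finite A"
  shows "cohen_macaulay F (skel 0 \<Delta>)"
proof -
  have "{} \<in> \<Delta>" using assms(1) by (auto simp: simplicial_complex_def)
  then have "skel 0 \<Delta> = {{}}" using assms(2) by (auto simp: skel_def)
  moreover have "link {{}} {} = {{} :: 'a set}" by (auto simp: link_def)
  moreover have "maxcard {{} :: 'a set} = 0" by (simp add: maxcard_def)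
  ultimately show ?thesis by (simp add: cohen_macaulay_def)
qed

text \<open>The skeleton consisting of the empty face always qualifies and \<open>maxcard\<close>
  bounds the candidates, so \<open>GREATEST\<close> is attained.\<close>

lemma depth_attained:
  assumes "simplicial_complex \<Delta>" "\<forall>A\<in>\<Delta>. finite A" and d: "depth F \<Delta> = d - 1"
  shows "nat d \<le> maxcard \<Delta>" "cohen_macaulay F (skel (nat d) \<Delta>)"
proof -
  define P where "P m \<longleftrightarrow> m \<le> maxcard \<Delta> \<and> cohen_macaulay F (skel m \<Delta>)" for m
  have "P 0" using cohen_macaulay_skel_0[OF assms(1,2)] by (simp add: P_def)
  then have "P (Greatest P)" by (rule GreatestI_nat[where b = "maxcard \<Delta>"]) (simp add: P_def)
  moreover have "Greatest P = nat d" using d by (simp add: depth_def P_def[abs_def])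
  ultimately show "nat d \<le> maxcard \<Delta>" "cohen_macaulay F (skel (nat d) \<Delta>)" by (simp_all add: P_def)
qed

context ground
begin

lemma cpx_skel:
  assumes "cpx X" shows "cpx (skel m X)"
  unfolding cpx_def
proof (intro conjI ballI allI impI)
  show "skel m X \<subseteq> Pow V" using assms by (auto simp: cpx_def skel_def)
  fix A B assume "A \<in> skel m X" "B \<subseteq> A"
  moreover from this have "card B \<le> card A" using cpx_fin[OF assms] by (intro card_mono) (auto simp: skel_def)
  ultimately show "B \<in> skel m X" using cpx_down[OF assms, of A B] by (simp add: skel_def)
qed

lemma maxcard_skel:
  assumes X: "cpx X" "X \<noteq> {}" and m: "m \<le> maxcard X"
  shows "maxcard (skel m X) = m"
proof (rule antisym)
  have S: "cpx (skel m X)" by (rule cpx_skel[OF X(1)])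
  obtain A where A: "A \<in> X" "card A = maxcard X" using maxcard_attained[OF X] by blast
  then obtain B where B: "B \<subseteq> A" "card B = m" using m obtain_subset_with_card_n[of m A] by auto
  have "B \<in> X" by (rule cpx_down[OF X(1) A(1) B(1)])
  then have BS: "B \<in> skel m X" using B(2) by (simp add: skel_def)
  then show "m \<le> maxcard (skel m X)" using maxcard_ge[OF S BS] B(2) by simp
  obtain C where "C \<in> skel m X" "card C = maxcard (skel m X)" using maxcard_attained[OF S] BS by blast
  then show "maxcard (skel m X) \<le> m" by (simp add: skel_def)
qed

lemma cohen_macaulay_pure:
  assumes X: "cpx X" "X \<noteq> {}" and cm: "cohen_macaulay (F :: 'k::field itself) X" and U: "U \<in> X"
  shows "\<exists>C\<in>X. U \<subseteq> C \<and> card C = maxcard X"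
proof (rule pure_of_connected_links[OF X _ U])
  show "exact (\<lambda>_. 1 :: 'k) (link X U) 1" if "U \<in> X" "1 < maxcard (link X U)" for U
    using cm that by (intro exact_of_rhom[OF cpx_link[OF X(1)], of F]) (simp add: cohen_macaulay_def)
qed

text \<open>By purity U lies in a face of full size, so the link of U is large enough to turn the
  range given by its dimension into the uniform one.\<close>

lemma cohen_macaulay_links_exact:
  assumes X: "cpx X" "X \<noteq> {}" and cm: "cohen_macaulay (F :: 'k::field itself) X"
  shows "links_exact TYPE('k) X (maxcard X)"
  unfolding links_exact_def
proof (intro ballI allI impI)
  fix U i assume U: "U \<in> X" and i: "i + card U < maxcard X"
  obtain C where C: "C \<in> X" "U \<subseteq> C" "card C = maxcard X" using cohen_macaulay_pure[OF X cm U] by blast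
  have L: "cpx (link X U)" by (rule cpx_link[OF X(1)])
  have "C - U \<in> link X U"
    using C cpx_down[OF X(1) C(1), of "C - U"] by (simp add: link_def Un_absorb1)
  then have "card (C - U) \<le> maxcard (link X U)" by (rule maxcard_ge[OF L])
  moreover have "card (C - U) = card C - card U" using cpx_fin[OF X(1) U] C(2) by (rule card_Diff_subset)
  ultimately have "i < maxcard (link X U)" using C(3) i by simp
  then have "rhom_vanish F (link X U) i" using cm U by (simp add: cohen_macaulay_def)
  then show "exact (\<lambda>_. 1 :: 'k) (link X U) i" by (rule exact_of_rhom[OF L])
qed

lemma links_exact_emb:
  assumes X: "cpx X" and ex: "links_exact TYPE('k::field) X m"
  shows "links_exact TYPE('k poly fract) X m"
  unfolding links_exact_def
proof (intro ballI allI impI)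
  fix U i assume "U \<in> X" "i + card U < m"
  then have "exact (\<lambda>_. 1 :: 'k) (link X U) i" using ex by (simp add: links_exact_def)
  then show "exact (\<lambda>_. 1 :: 'k poly fract) (link X U) i"
    by (rule exact_extend_field[of emb, OF emb_add emb_mult emb_one cpx_link[OF X]])
qed

lemma iterated_exact_moment_link:
  fixes \<alpha> :: "'a \<Rightarrow> 'k::field"
  assumes "inj_on \<alpha> V" "infinite (UNIV :: 'k set)" "cpx X" "links_exact TYPE('k) X m"
  shows "iterated_exact_wrt (\<lambda>t v. \<alpha> v ^ t) (link X {x}) (m - 1)"
  by (rule iterated_exact_moment[OF assms(1,2) cpx_link[OF assms(3)] links_exact_link[OF assms(3,4)]])

end

text \<open>B lies properly in a face of size m, and a vertex of that face outside B can be
  exchanged for a. Below the depth a near-cone is thus a cone.\<close>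

lemma cone_of_pure_shifted:
  assumes "simplicial_complex \<Delta>" "shifted_wrt \<Delta> a" "\<forall>A\<in>\<Delta>. finite A"
    and pure: "\<And>U. U \<in> skel m \<Delta> \<Longrightarrow> \<exists>C\<in>skel m \<Delta>. U \<subseteq> C \<and> card C = m"
    and B: "B \<in> skel m \<Delta>" "card B < m"
  shows "insert a B \<in> skel m \<Delta>"
proof -
  have down: "A' \<in> \<Delta>" if "A \<in> \<Delta>" "A' \<subseteq> A" for A A'
    using assms(1) that by (simp add: simplicial_complex_def)
  obtain C where C: "C \<in> \<Delta>" "B \<subseteq> C" "card C = m" using pure[OF B(1)] by (auto simp: skel_def)
  have "B \<noteq> C" using B(2) C(3) by blast
  then obtain w where w: "w \<in> C" "w \<notin> B" using C(2) by blast
  have "insert a (C - {w}) \<in> \<Delta>" using assms(2) C(1) w(1) by (simp add: shifted_wrt_def)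
  then have "insert a B \<in> \<Delta>" by (rule down) (use C(2) w(2) in blast)
  moreover have "card (insert a B) \<le> Suc (card B)" by (rule card_insert_le_m1) simp_all
  ultimately show ?thesis using B(2) by (simp add: skel_def)
qed

text \<open>The argument runs in the Cohen-Macaulay skeleton \<Gamma> given by the depth, which has
  the same faces of size r.\<close>

lemma near_cone_ekr:
  fixes F :: "'k::field itself" and \<Delta> :: "'a::linorder set set"
  assumes sc: "simplicial_complex \<Delta>" and fin: "\<forall>A\<in>\<Delta>. finite A"
    and d: "depth F \<Delta> = int m - 1" and r: "0 < r" "2 * r + 1 \<le> m" and sh: "shifted_wrt \<Delta> a"
  shows "{a} \<in> \<Delta>"
    and "\<A> \<subseteq> lvl \<Delta> r \<Longrightarrow> intersecting \<A> \<Longrightarrow> card \<A> \<le> card {A \<in> lvl \<Delta> r. a \<in> A}"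
    and "\<A> \<subseteq> lvl \<Delta> r \<Longrightarrow> intersecting \<A> \<Longrightarrow> 2 \<le> r \<Longrightarrow> card \<A> = card {A \<in> lvl \<Delta> r. a \<in> A} \<Longrightarrow>
      \<exists>v. \<forall>A\<in>\<A>. v \<in> A"
proof -
  define V where "V = \<Union>\<Delta>"
  have finV: "finite V" using sc fin by (simp add: V_def simplicial_complex_def)
  interpret ground V by unfold_locales (rule finV)
  define \<Gamma> where "\<Gamma> = skel m \<Delta>"
  have cD: "cpx \<Delta>" unfolding cpx_def using sc by (auto simp: simplicial_complex_def V_def)
  have neD: "\<Delta> \<noteq> {}" using sc by (simp add: simplicial_complex_def)
  have m: "m \<le> maxcard \<Delta>" and cm: "cohen_macaulay F \<Gamma>"
    using depth_attained[OF sc fin d] by (simp_all add: \<Gamma>_def)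
  have c: "cpx \<Gamma>" unfolding \<Gamma>_def by (rule cpx_skel[OF cD])
  have e\<Gamma>: "{} \<in> \<Gamma>" using neD cpx_down[OF cD _ empty_subsetI] by (auto simp: \<Gamma>_def skel_def)
  then have ne: "\<Gamma> \<noteq> {}" by blast
  have mc: "maxcard \<Gamma> = m" unfolding \<Gamma>_def by (rule maxcard_skel[OF cD neD m])
  have pure: "\<exists>C\<in>\<Gamma>. U \<subseteq> C \<and> card C = m" if "U \<in> \<Gamma>" for U
    using cohen_macaulay_pure[OF c ne cm that] by (simp only: mc)
  have cone: "insert a B \<in> \<Gamma>" if "B \<in> \<Gamma>" "card B < m" for B
    unfolding \<Gamma>_def by (rule cone_of_pure_shifted[OF sc sh fin]) (use pure that in \<open>simp_all add: \<Gamma>_def\<close>)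
  have "insert a {} \<in> \<Gamma>" by (rule cone[OF e\<Gamma>]) (use r in simp)
  then have a\<Gamma>: "{a} \<in> \<Delta>" by (simp add: \<Gamma>_def skel_def)
  then have aV: "a \<in> V" using cpx_sub[OF cD] by blast
  have ex: "links_exact TYPE('k poly fract) \<Gamma> m"
    using cohen_macaulay_links_exact[OF c ne cm] by (intro links_exact_emb[OF c]) (simp only: mc)
  obtain \<alpha> :: "'a \<Rightarrow> 'k poly fract" where \<alpha>: "inj_on \<alpha> V"
    using ex_inj_on_infinite[OF finV infinite_poly_fract] by blast
  define \<psi> where "\<psi> t v = \<alpha> v ^ t" for t v
  have \<psi>: "\<psi> = (\<lambda>t v. \<alpha> v ^ t)" by (intro HOL.ext) (simp add: \<psi>_def)
  define n where "n = card V"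
  obtain \<phi> :: "nat \<Rightarrow> 'a \<Rightarrow> 'k poly fract" where gen: "generic n \<phi>"
    using ex_generic[OF infinite_poly_fract] by blast
  have sep: "separating n \<psi>" unfolding n_def \<psi> by (rule separating_moment[OF \<alpha>])
  interpret generic_shift V \<phi> \<psi> n
    by unfold_locales (rule infinite_poly_fract gen sep)+
  obtain C where "C \<in> \<Gamma>" "card C = m" using pure[OF e\<Gamma>] by blast
  then have mn: "m \<le> n" unfolding n_def using card_mono[OF finV cpx_sub[OF c]] by blast
  have X: "good \<Gamma> m"
    unfolding good_def unfolding \<psi> using c e\<Gamma> mn iterated_exact_moment[OF \<alpha> infinite_poly_fract c ex] by blast
  have D: "good (del \<Gamma> x) (m - 1)" if "x \<in> V" for x
  proof -
    have "cpx (del \<Gamma> x)" using c by (auto simp: cpx_def del_def)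
    then show ?thesis unfolding good_def unfolding \<psi>
      using e\<Gamma> mn iterated_exact_moment_del[OF \<alpha> infinite_poly_fract c ex that] by (simp add: del_def)
  qed
  have L: "good (link \<Gamma> {x}) (m - 1)" if x: "x \<in> V" for x
  proof -
    obtain B where "B \<in> \<Delta>" "x \<in> B" using x by (auto simp: V_def)
    then have "{x} \<in> \<Delta>" using cpx_down[OF cD, of B "{x}"] by simp
    then have "{x} \<in> \<Gamma>" using r by (simp add: \<Gamma>_def skel_def)
    then have "{} \<in> link \<Gamma> {x}" using e\<Gamma> by (simp add: link_def)
    then show ?thesis unfolding good_def unfolding \<psi>
      using mn cpx_link[OF c] iterated_exact_moment_link[OF \<alpha> infinite_poly_fract c ex] by simp
  qed
  have lvl: "lvl \<Gamma> r = lvl \<Delta> r" using r by (auto simp: lvl_def \<Gamma>_def skel_def)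
  have Rc: "Rc \<Gamma> r = card {A \<in> lvl \<Delta> r. a \<in> A}"
    using Rc_cone[OF X cone, where i = r] r lvl by simp
  show "{a} \<in> \<Delta>" by (rule a\<Gamma>)
  show "card \<A> \<le> card {A \<in> lvl \<Delta> r. a \<in> A}" if "\<A> \<subseteq> lvl \<Delta> r" "intersecting \<A>"
    using ekr_bound[OF X, of r \<A>] that r by (simp add: lvl Rc)
  show "\<exists>v. \<forall>A\<in>\<A>. v \<in> A"
    if "\<A> \<subseteq> lvl \<Delta> r" "intersecting \<A>" "2 \<le> r" "card \<A> = card {A \<in> lvl \<Delta> r. a \<in> A}"
    by (rule ekr_strict[OF X that(3) r(2) aV cone D L]) (use that in \<open>simp_all only: lvl Rc\<close>)
qed

lemma intersecting_singletons:
  assumes "intersecting \<A>" "\<And>A. A \<in> \<A> \<Longrightarrow> card A = 1"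
  shows "\<exists>v. \<forall>A\<in>\<A>. v \<in> A"
proof (cases "\<A> = {}")
  case False
  then obtain A where A: "A \<in> \<A>" by blast
  obtain v where v: "A = {v}" using assms(2)[OF A] card_1_singletonE by blast
  have "v \<in> B" if "B \<in> \<A>" for B using assms(1) A that v by (auto simp: intersecting_def)
  then show ?thesis by blast
qed simp

theorem theorem1p3:
  fixes F :: "'k::field itself"
    and \<Delta> :: "'a::linorder set set"
    and d :: int and r :: nat and a :: 'a
  assumes "simplicial_complex \<Delta>"
    and "depth F \<Delta> = d - 1"
    and "0 < r" and "2 * int r < d"
    and "shifted_wrt \<Delta> a"
  shows "(\<forall>\<A>. \<A> \<subseteq> {A\<in>\<Delta>. card A = r} \<and> intersecting \<A> \<longrightarrow>
            (\<exists>v. {v} \<in> \<Delta> \<and> card \<A> \<le> fvec (r - 1) (link \<Delta> {v})))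
       \<and> (\<forall>\<A>. \<A> \<subseteq> {A\<in>\<Delta>. card A = r} \<and> intersecting \<A> \<and>
            (\<forall>\<B>. \<B> \<subseteq> {A\<in>\<Delta>. card A = r} \<and> intersecting \<B> \<longrightarrow> card \<B> \<le> card \<A>) \<longrightarrow>
            (\<exists>v. \<forall>A\<in>\<A>. v \<in> A))"
proof -
  have down: "B \<in> \<Delta>" if "A \<in> \<Delta>" "B \<subseteq> A" for A B
    using assms(1) that by (simp add: simplicial_complex_def)
  have fin: "\<forall>A\<in>\<Delta>. finite A"
  proof
    fix A assume that: "A \<in> \<Delta>"
    \<comment> \<open>The complex is a finite family, whereas an infinite face would contribute
      infinitely many subsets.\<close>
    have "Pow A \<subseteq> \<Delta>" using down[OF that] by blast
    then have "finite (Pow A)" by (rule finite_subset) (use assms(1) in \<open>simp add: simplicial_complex_def\<close>)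
    then show "finite A" by simp
  qed
  have d: "depth F \<Delta> = int (nat d) - 1" and r: "2 * r + 1 \<le> nat d" using assms(2,4) by simp_all
  note ekr = near_cone_ekr[OF assms(1) fin d assms(3) r assms(5)]
  have lvl: "{A\<in>\<Delta>. card A = r} = lvl \<Delta> r" by (simp add: lvl_def)
  have star: "card {A \<in> lvl \<Delta> r. a \<in> A} = fvec (r - 1) (link \<Delta> {a})"
    using card_lvl_link[OF down fin[rule_format], where i = "r - 1" and x = a] assms(3) by (simp add: fvec_def lvl_def)
  show ?thesis unfolding lvl
  proof (intro conjI allI impI; elim conjE)
    fix \<A> assume "\<A> \<subseteq> lvl \<Delta> r" "intersecting \<A>"
    then show "\<exists>v. {v} \<in> \<Delta> \<and> card \<A> \<le> fvec (r - 1) (link \<Delta> {v})"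
      using ekr(1,2) star by (intro exI[of _ a]) simp
  next
    fix \<A> assume \<A>: "\<A> \<subseteq> lvl \<Delta> r" "intersecting \<A>"
      and max: "\<forall>\<B>. \<B> \<subseteq> lvl \<Delta> r \<and> intersecting \<B> \<longrightarrow> card \<B> \<le> card \<A>"
    show "\<exists>v. \<forall>A\<in>\<A>. v \<in> A"
    proof (cases "r = 1")
      \<comment> \<open>The strictness argument starts at r = 2; singletons that intersect are
        equal.\<close>
      case True
      then have "card A = 1" if "A \<in> \<A>" for A using \<A>(1) that by (auto simp: lvl_def)
      then show ?thesis by (rule intersecting_singletons[OF \<A>(2)])
    next
      case False
      have "intersecting {A \<in> lvl \<Delta> r. a \<in> A}" by (auto simp: intersecting_def)
      moreover have "{A \<in> lvl \<Delta> r. a \<in> A} \<subseteq> lvl \<Delta> r" by blast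
      ultimately have "card {A \<in> lvl \<Delta> r. a \<in> A} \<le> card \<A>" using max by blast
      with ekr(2)[OF \<A>] have "card \<A> = card {A \<in> lvl \<Delta> r. a \<in> A}" by simp
      then show ?thesis using False assms(3) by (intro ekr(3)[OF \<A>]) simp_all
    qed
  qed
qed

end
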